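(* Let $\mathcal{F}$ be a foliation on a neighborhood of $0$ in $\mathbf{C}^n$, with a singularity at $0$, tangent to a non-degenerate vector field $Z$ (generating $\mathcal{F}$) satisfying Brjuno's condition $(\omega)$, and let $\lambda=(\lambda_1,\ldots,\lambda_n)$ be the eigenvalues of the linear part of $Z$ at $0$. Let $\nabla$ be a foliated connection on $T_\mathcal{F}$, let $\gamma=\nabla(Z)$, and suppose that $\nabla$ is generic in the following sense: for $\mu=-\gamma(0)$, one has $\mu\neq\langle K,\lambda\rangle$ for every $K\in(\mathbf{Z}_{\geq0})^n\setminus\{0\}$ and $$-\sum_{\nu\geq0}2^{-\nu}\log\omega'(2^{\nu+1})<\infty,\qquad \omega'(m)=\min_{2\leq|K|\leq m}|\langle K,\lambda\rangle-\mu|.$$ Then there exist coordinates in a neighborhood of $0$ where $\mathcal{F}$ is tangent to (generated by) a linear vector field $Z'$ whose Christoffel symbol $\nabla(Z')$ is constant.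
   Context: The foliation $\mathcal{F}$ is the one tangent to a holomorphic vector field $Z$ vanishing at $0$ (with zero set of codimension at least two); its other generators are the multiples of $Z$ by non-vanishing holomorphic functions. $T_\mathcal{F}$ denotes the tangent line bundle of $\mathcal{F}$, whose local sections are the multiples $fZ$, $f$ holomorphic. $Z$ is non-degenerate if its linear part at $0$ is invertible. A foliated connection on $T_\mathcal{F}$ (equivalently, a foliated affine structure on $\mathcal{F}$) is an additive map $\nabla$ assigning to each local section $Z$ of $T_\mathcal{F}$ a holomorphic function $\nabla(Z)$, its Christoffel symbol (defined also at the singular points), with $\nabla(fZ)=Zf+f\nabla(Z)$ for holomorphic $f$. Brjuno's condition $(\omega)$ for $Z$: the linear part of $Z$ at $0$ is diagonalizable with eigenvalues $\lambda_1,\ldots,\lambda_n$ which are non-resonant, i.e. $\lambda_j\neq\langle K,\lambda\rangle$ for all $j$ and all $K\in(\mathbf{Z}_{\geq0})^n$ with $|K|\geq2$, and, for $\omega(m)=\min\{|\langle K,\lambda\rangle-\lambda_j| : 1\leq j\leq n,\ 2\leq|K|\leq m\}$, one has $-\sum_{\nu\geq0}2^{-\nu}\log\omega(2^{\nu+1})<\infty$. Here $|K|=\sum K_i$ and $\langle K,\lambda\rangle=\sum K_i\lambda_i$. (Such a vector field is holomorphically linearizable.) *)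

theory Defs
  imports "HOL-Analysis.Analysis"
begin

section \<open>Holomorphic functions and maps on open subsets of \<open>\<complex>\<^sup>n\<close>\<close>

definition holo_on :: "(complex^'n::finite \<Rightarrow> complex) \<Rightarrow> (complex^'n) set \<Rightarrow> bool" where
  "holo_on f U \<longleftrightarrow> open U \<and>
     (\<forall>z\<in>U. \<exists>D. (f has_derivative D) (at z) \<and> (\<forall>c v. D (c *s v) = c * D v))"

definition holo_map_on :: "(complex^'n::finite \<Rightarrow> complex^'m::finite) \<Rightarrow> (complex^'n) set \<Rightarrow> bool" where
  "holo_map_on F U \<longleftrightarrow> (\<forall>i. holo_on (\<lambda>z. F z $ i) U)"

definition biholo_on :: "(complex^'n::finite \<Rightarrow> complex^'n) \<Rightarrow> (complex^'n) set \<Rightarrow> bool" where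
  "biholo_on \<phi> V \<longleftrightarrow> holo_map_on \<phi> V \<and> inj_on \<phi> V \<and> open (\<phi> ` V) \<and>
     holo_map_on (the_inv_into V \<phi>) (\<phi> ` V)"

text \<open>An analytic set has codimension at most one iff it contains a piece of smooth complex
  hypersurface (the dimension of an analytic set being that of its regular part).\<close>

definition codim_ge_two :: "(complex^'n::finite) set \<Rightarrow> bool" where
  "codim_ge_two A \<longleftrightarrow>
     \<not> (\<exists>W g p. holo_on g W \<and> p \<in> W \<and> g p = 0 \<and>
          frechet_derivative g (at p) \<noteq> (\<lambda>_. 0) \<and> {z\<in>W. g z = 0} \<subseteq> A)"

section \<open>Foliations by curves and foliated connections\<close>

text \<open>\<open>sections_on Z V\<close> are the sections over \<open>V\<close> of the tangent bundle of the foliation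
  generated by \<open>Z\<close>. Vector fields are total functions whose values outside \<open>V\<close> are irrelevant.\<close>

definition sections_on ::
  "(complex^'n::finite \<Rightarrow> complex^'n) \<Rightarrow> (complex^'n) set \<Rightarrow> (complex^'n \<Rightarrow> complex^'n) set" where
  "sections_on Z V = {X. \<exists>f. holo_on f V \<and> (\<forall>z\<in>V. X z = f z *s Z z)}"

definition generator_on ::
  "(complex^'n::finite \<Rightarrow> complex^'n) \<Rightarrow> (complex^'n) set \<Rightarrow> (complex^'n \<Rightarrow> complex^'n) \<Rightarrow> bool" where
  "generator_on Z V Z' \<longleftrightarrow>
     (\<exists>h. holo_on h V \<and> (\<forall>z\<in>V. h z \<noteq> 0) \<and> (\<forall>z\<in>V. Z' z = h z *s Z z))"

definition vf_apply ::
  "(complex^'n::finite \<Rightarrow> complex^'n) \<Rightarrow> (complex^'n \<Rightarrow> complex) \<Rightarrow> complex^'n \<Rightarrow> complex" where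
  "vf_apply X f z = frechet_derivative f (at z) (X z)"

text \<open>\<open>nabla V X\<close> is the Christoffel symbol of the section \<open>X\<close> over the open set \<open>V\<close>. The last
  clause says that \<open>nabla\<close> is a map of sheaves; with \<open>W = V\<close> it also says that \<open>nabla V X\<close> depends
  only on the values of \<open>X\<close> on \<open>V\<close>.\<close>

definition foliated_connection ::
  "(complex^'n::finite) set \<Rightarrow> (complex^'n \<Rightarrow> complex^'n) \<Rightarrow>
   ((complex^'n) set \<Rightarrow> (complex^'n \<Rightarrow> complex^'n) \<Rightarrow> complex^'n \<Rightarrow> complex) \<Rightarrow> bool" where
  "foliated_connection U Z nabla \<longleftrightarrow>
     (\<forall>V X. open V \<and> V \<subseteq> U \<and> X \<in> sections_on Z V \<longrightarrow> holo_on (nabla V X) V) \<and>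
     (\<forall>V X Y. open V \<and> V \<subseteq> U \<and> X \<in> sections_on Z V \<and> Y \<in> sections_on Z V \<longrightarrow>
        (\<forall>z\<in>V. nabla V (\<lambda>w. X w + Y w) z = nabla V X z + nabla V Y z)) \<and>
     (\<forall>V X f. open V \<and> V \<subseteq> U \<and> X \<in> sections_on Z V \<and> holo_on f V \<longrightarrow>
        (\<forall>z\<in>V. nabla V (\<lambda>w. f w *s X w) z = vf_apply X f z + f z * nabla V X z)) \<and>
     (\<forall>V W X Y. open V \<and> V \<subseteq> U \<and> open W \<and> W \<subseteq> V \<and>
        X \<in> sections_on Z V \<and> Y \<in> sections_on Z W \<and> (\<forall>z\<in>W. X z = Y z) \<longrightarrow>
        (\<forall>z\<in>W. nabla V X z = nabla W Y z))"

section \<open>Linear part and Brjuno's condition\<close>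

definition linear_part :: "(complex^'n::finite \<Rightarrow> complex^'n) \<Rightarrow> complex^'n^'n" where
  "linear_part Z = matrix (frechet_derivative Z (at 0))"

definition diag_mat :: "complex^'n::finite \<Rightarrow> complex^'n^'n" where
  "diag_mat lam = (\<chi> i j. if i = j then lam $ i else 0)"

definition diagonalizable_with :: "complex^'n^'n::finite \<Rightarrow> complex^'n \<Rightarrow> bool" where
  "diagonalizable_with A lam \<longleftrightarrow> (\<exists>P. invertible P \<and> A = P ** diag_mat lam ** matrix_inv P)"

definition mi_size :: "('n::finite \<Rightarrow> nat) \<Rightarrow> nat" where
  "mi_size K = (\<Sum>i\<in>UNIV. K i)"

definition mi_pair :: "('n::finite \<Rightarrow> nat) \<Rightarrow> complex^'n \<Rightarrow> complex" where
  "mi_pair K lam = (\<Sum>i\<in>UNIV. of_nat (K i) * lam $ i)"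

definition nonresonant :: "complex^'n::finite \<Rightarrow> bool" where
  "nonresonant lam \<longleftrightarrow> (\<forall>j K. mi_size K \<ge> 2 \<longrightarrow> lam $ j \<noteq> mi_pair K lam)"

definition omega :: "complex^'n::finite \<Rightarrow> nat \<Rightarrow> real" where
  "omega lam m = Min {cmod (mi_pair K lam - lam $ j) |K j. 2 \<le> mi_size K \<and> mi_size K \<le> m}"

definition omega' :: "complex^'n::finite \<Rightarrow> complex \<Rightarrow> nat \<Rightarrow> real" where
  "omega' lam \<mu> m = Min {cmod (mi_pair K lam - \<mu>) |K. 2 \<le> mi_size K \<and> mi_size K \<le> m}"

text \<open>For positive nonincreasing \<open>w\<close> the terms are bounded below by a summable sequence, so the sum
  is well defined in \<open>(-\<infinity>, \<infinity>]\<close> and summability expresses its finiteness.\<close>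

definition brjuno_sum_finite :: "(nat \<Rightarrow> real) \<Rightarrow> bool" where
  "brjuno_sum_finite w \<longleftrightarrow> summable (\<lambda>\<nu>. - ((1/2) ^ \<nu> * ln (w (2 ^ (\<nu> + 1)))))"

definition brjuno_condition :: "(complex^'n::finite \<Rightarrow> complex^'n) \<Rightarrow> complex^'n \<Rightarrow> bool" where
  "brjuno_condition Z lam \<longleftrightarrow>
     diagonalizable_with (linear_part Z) lam \<and> nonresonant lam \<and> brjuno_sum_finite (omega lam)"

definition generic_connection_value :: "complex^'n::finite \<Rightarrow> complex \<Rightarrow> bool" where
  "generic_connection_value lam \<mu> \<longleftrightarrow>
     (\<forall>K. K \<noteq> (\<lambda>_. 0) \<longrightarrow> \<mu> \<noteq> mi_pair K lam) \<and> brjuno_sum_finite (omega' lam \<mu>)"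

text \<open>In the coordinates \<open>\<phi>\<close> on \<open>V\<close>, the vector field \<open>X\<close> is the linear field \<open>w \<mapsto> B w\<close>.\<close>

definition linear_in_coords ::
  "(complex^'n::finite \<Rightarrow> complex^'n) \<Rightarrow> (complex^'n) set \<Rightarrow> (complex^'n \<Rightarrow> complex^'n) \<Rightarrow> bool" where
  "linear_in_coords \<phi> V X \<longleftrightarrow>
     (\<exists>B :: complex^'n^'n. \<forall>z\<in>V. frechet_derivative \<phi> (at z) (X z) = B *v \<phi> z)"

end

theory Submission
  imports Defs "HOL-Library.Function_Algebras" "HOL-Complex_Analysis.Cauchy_Integral_Formula"
begin

text \<open>Brjuno's theorem is applied twice. In coordinates linearizing \<open>Z\<close>, the equation
  \<open>Z f = \<gamma> - \<gamma> 0\<close> and then \<open>Z k = \<mu> k - \<mu> exp f\<close>, \<open>k 0 = 1\<close>, are diagonal on monomials, with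
  divisors \<open>\<langle>K,\<lambda>\<rangle>\<close> and \<open>\<langle>K,\<lambda>\<rangle> - \<mu>\<close> that decay at most exponentially, so they have convergent
  solutions. The field \<open>Z' = exp (- f) k Z\<close> has Christoffel symbol \<open>Z h + h \<gamma> = - \<mu>\<close> for
  \<open>h = exp (- f) k\<close>, and the same linear part as \<open>Z\<close>. Hence it satisfies Brjuno's condition as well,
  and linearizing it leaves the constant Christoffel symbol unchanged.

  For Brjuno's theorem itself, the linearizing series \<open>H\<close> satisfies the fixed point equation
  \<open>H = id + L\<inverse> (R \<circ> H)\<close>, where \<open>L\<inverse>\<close> divides by the small divisors. Brjuno's counting argument
  yields weights on the monomials for which \<open>\<ell>\<^sup>1\<close> is a Banach algebra and \<open>L\<inverse>\<close> is bounded on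
  products of series without constant term.\<close>

section \<open>Multi-indices and monomials\<close>

text \<open>For \<open>Z' = h Z\<close> the Leibniz rule gives the Christoffel symbol Z h + h
  \<gamma>, whose value at 0 is h(0) \<gamma>(0); with h(0) = 1 the only possible constant is
  therefore -\<mu>. The factor exp (- f) removes the variable coefficient from Z h + h \<gamma> =
  -\<mu> and leaves the constant coefficient \<mu>. The constant terms of the equation for k agree
  because k(0) = 1 and f(0) = 0. These equations are linear: each coefficient is divided once, so a
  divisor bounded below by a geometric sequence costs only a smaller radius. In the linearization
  the divisors accumulate: a coefficient of H at K carries products of divisors along trees, up to
  about |K| of them, and a fixed loss of radius at each division would leave nothing. The weights
  exp (- A) are built for this: A is superadditive and gains the logarithm of the inverse divisor,
  up to a constant, whenever two nonzero multi-indices are added, yet it grows at most linearly in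
  |K|, so the weighted series still converge on a polydisc. The linear growth is where the Brjuno
  sum enters.\<close>

definition mi_unit :: "'n \<Rightarrow> 'n \<Rightarrow> nat" where
  "mi_unit i = (\<lambda>j. if j = i then 1 else 0)"

definition mon :: "complex^'n::finite \<Rightarrow> ('n \<Rightarrow> nat) \<Rightarrow> complex" where
  "mon z K = (\<Prod>i\<in>UNIV. z $ i ^ K i)"

definition polydisc :: "real \<Rightarrow> (complex^'n::finite) set" where
  "polydisc r = {z. \<forall>i. cmod (z $ i) < r}"

definition cpolydisc :: "real \<Rightarrow> (complex^'n::finite) set" where
  "cpolydisc r = {z. \<forall>i. cmod (z $ i) \<le> r}"

text \<open>One real condition at the corner of the closed polydisc; by \<open>norm_mon_le\<close>
  it dominates the series at every point of \<open>cpolydisc r\<close>. Unordered summation avoids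
  choosing an enumeration of the multi-indices.\<close>

definition abs_conv :: "(('n::finite \<Rightarrow> nat) \<Rightarrow> complex) \<Rightarrow> real \<Rightarrow> bool" where
  "abs_conv a r \<longleftrightarrow> (\<lambda>K. cmod (a K) * r ^ mi_size K) summable_on UNIV"

definition ps_eval :: "(('n::finite \<Rightarrow> nat) \<Rightarrow> complex) \<Rightarrow> complex^'n \<Rightarrow> complex" where
  "ps_eval a z = (\<Sum>\<^sub>\<infinity>K. a K * mon z K)"

section \<open>Arithmetic of multi-indices\<close>

lemma mi_size_add [simp]: "mi_size (K + L) = mi_size K + mi_size (L :: 'n::finite \<Rightarrow> nat)"
  by (simp add: mi_size_def sum.distrib)

lemma mi_size_zero [simp]: "mi_size (0 :: 'n::finite \<Rightarrow> nat) = 0"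
  by (simp add: mi_size_def)

lemma mi_size_unit [simp]: "mi_size (mi_unit (i::'n::finite)) = 1"
  by (simp add: mi_size_def mi_unit_def)

lemma mi_size_eq_0_iff [simp]: "mi_size (K :: 'n::finite \<Rightarrow> nat) = 0 \<longleftrightarrow> K = 0"
  by (auto simp: mi_size_def fun_eq_iff)

lemma le_mi_size: "(K :: 'n::finite \<Rightarrow> nat) i \<le> mi_size K"
  unfolding mi_size_def by (rule member_le_sum) auto

lemma mi_pair_add [simp]: "mi_pair (K + L) lam = mi_pair K lam + mi_pair L (lam::complex^'n::finite)"
  unfolding mi_pair_def plus_fun_apply of_nat_add distrib_right by (rule sum.distrib)

lemma mi_pair_unit [simp]: "mi_pair (mi_unit i) lam = lam $ (i::'n::finite)"
proof -
  have "mi_pair (mi_unit i) lam = (\<Sum>j\<in>UNIV. if j = i then lam $ j else 0)"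
    unfolding mi_pair_def mi_unit_def by (rule sum.cong) auto
  then show ?thesis by simp
qed

lemma mi_pair_zero [simp]: "mi_pair 0 lam = 0"
  by (simp add: mi_pair_def)

lemma mi_le_diff_add: "L \<le> K \<Longrightarrow> (K - L) + L = (K :: 'n \<Rightarrow> nat)"
  by (auto simp: fun_eq_iff le_fun_def)

lemma mi_size_diff: "L \<le> K \<Longrightarrow> mi_size (K - L) = mi_size K - mi_size (L :: 'n::finite \<Rightarrow> nat)"
  by (metis add_diff_cancel_right' mi_le_diff_add mi_size_add)

lemma mi_size_mono: "L \<le> K \<Longrightarrow> mi_size L \<le> mi_size (K :: 'n::finite \<Rightarrow> nat)"
  unfolding mi_size_def by (rule sum_mono) (auto simp: le_fun_def)

lemma mi_add_unit_diff: "K i \<noteq> 0 \<Longrightarrow> (K - mi_unit i) + mi_unit i = (K :: 'n \<Rightarrow> nat)"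
  by (auto simp: fun_eq_iff mi_unit_def)

lemma mi_size_le_subset_PiE: "{K :: 'n::finite \<Rightarrow> nat. mi_size K \<le> m} \<subseteq> PiE UNIV (\<lambda>_. {..m})"
  using le_mi_size order_trans by (fastforce simp: PiE_def)

lemma finite_mi_size_le: "finite {K :: 'n::finite \<Rightarrow> nat. mi_size K \<le> m}"
  by (rule finite_subset[OF mi_size_le_subset_PiE]) (simp add: finite_PiE)

lemma finite_mi_le: "finite {L :: 'n::finite \<Rightarrow> nat. L \<le> K}"
  by (rule finite_subset[OF _ finite_mi_size_le[of "mi_size K"]]) (auto intro: mi_size_mono)

text \<open>Together with \<open>infinite_mi\<close> this yields a bijection from the naturals onto
  the multi-indices, through which a theorem on ordinary series reaches power series in several
  variables.\<close>

lemma countable_mi: "countable (UNIV :: ('n::finite \<Rightarrow> nat) set)"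
proof -
  have "(UNIV :: ('n \<Rightarrow> nat) set) = (\<Union>m. {K. mi_size K \<le> m})" by auto
  then show ?thesis by (metis countable_UN countableI_type countable_finite finite_mi_size_le)
qed

lemma infinite_mi: "infinite (UNIV :: ('n::finite \<Rightarrow> nat) set)"
proof
  assume fin: "finite (UNIV :: ('n \<Rightarrow> nat) set)"
  have "surj (\<lambda>K::'n \<Rightarrow> nat. K undefined)"
    by (rule surjI[where f = "\<lambda>n _. n"]) simp
  with fin show False by (metis finite_imageI infinite_UNIV_nat)
qed

section \<open>Monomials\<close>

lemma mon_add: "mon z (K + L) = mon z K * mon z (L :: 'n::finite \<Rightarrow> nat)"
  by (simp add: mon_def power_add prod.distrib)

lemma mon_zero [simp]: "mon z 0 = 1"
  by (simp add: mon_def)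

lemma mon_unit [simp]: "mon z (mi_unit i) = z $ (i::'n::finite)"
proof -
  have "mon z (mi_unit i) = (\<Prod>j\<in>UNIV. if j = i then z $ j else 1)"
    unfolding mon_def mi_unit_def by (rule prod.cong) auto
  then show ?thesis by simp
qed

lemma mon_at_0: "mon 0 (K :: 'n::finite \<Rightarrow> nat) = (if K = 0 then 1 else 0)"
proof (cases "K = 0")
  case False
  then obtain i where "K i \<noteq> 0" by (auto simp: fun_eq_iff)
  then show ?thesis unfolding mon_def using False by (auto intro!: prod_zero bexI[of _ i])
qed simp

lemma norm_mon: "cmod (mon z K) = (\<Prod>i\<in>UNIV. cmod (z $ i) ^ K (i::'n::finite))"
  by (simp add: mon_def norm_power flip: prod_norm)

lemma norm_mon_le:
  assumes "z \<in> cpolydisc r"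
  shows "cmod (mon z K) \<le> r ^ mi_size (K :: 'n::finite \<Rightarrow> nat)"
proof -
  have "cmod (mon z K) \<le> (\<Prod>i\<in>UNIV. r ^ K i)"
    unfolding norm_mon using assms by (intro prod_mono) (auto simp: cpolydisc_def intro: power_mono)
  then show ?thesis by (simp add: mi_size_def power_sum)
qed

section \<open>Polydiscs around the origin\<close>

lemma polydisc_subset_cpolydisc: "polydisc r \<subseteq> cpolydisc r"
  by (auto simp: polydisc_def cpolydisc_def less_imp_le)

lemma cpolydisc_mono: "r \<le> s \<Longrightarrow> cpolydisc r \<subseteq> cpolydisc s"
  by (auto simp: cpolydisc_def intro: order_trans)

lemma polydisc_mono: "r \<le> s \<Longrightarrow> polydisc r \<subseteq> polydisc s"
  by (auto simp: polydisc_def intro: less_le_trans)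

lemma cpolydisc_subset_polydisc: "r < s \<Longrightarrow> cpolydisc r \<subseteq> polydisc s"
  by (auto simp: polydisc_def cpolydisc_def intro: le_less_trans)

lemma zero_in_polydisc [simp]: "0 < r \<Longrightarrow> 0 \<in> polydisc r"
  by (auto simp: polydisc_def)

lemma open_polydisc: "open (polydisc r :: (complex^'n::finite) set)"
proof -
  have "polydisc r = (\<Inter>i. {z :: complex^'n. cmod (z $ i) < r})"
    by (auto simp: polydisc_def)
  moreover have "open {z :: complex^'n. cmod (z $ i) < r}" for i
    by (intro open_Collect_less continuous_intros)
  ultimately show ?thesis by auto
qed

lemma norm_le_polydisc:
  fixes z :: "complex^'n::finite"
  assumes "z \<in> cpolydisc r"
  shows "norm z \<le> real CARD('n) * r"
proof -
  have "norm z \<le> (\<Sum>i\<in>UNIV. cmod (z $ i))" unfolding norm_vec_def by (rule L2_set_le_sum) auto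
  also have "\<dots> \<le> (\<Sum>i\<in>(UNIV::'n set). r)"
    using assms by (intro sum_mono) (auto simp: cpolydisc_def)
  finally show ?thesis by simp
qed

lemma open_contains_cpolydisc:
  fixes U :: "(complex^'n::finite) set"
  assumes "open U" "0 \<in> U"
  obtains r where "r > 0" "cpolydisc r \<subseteq> U"
proof -
  obtain d where d: "d > 0" "ball 0 d \<subseteq> U" using assms openE by blast
  define r where "r = d / (2 * real CARD('n))"
  have "cpolydisc r \<subseteq> U"
  proof
    fix z :: "complex^'n" assume "z \<in> cpolydisc r"
    from norm_le_polydisc[OF this] have "norm z \<le> d / 2" by (simp add: r_def)
    with d show "z \<in> U" by (auto simp: subset_iff)
  qed
  moreover have "r > 0" using d by (simp add: r_def)
  ultimately show ?thesis using that by blast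
qed

section \<open>Absolutely convergent power series\<close>

lemma abs_convI:
  assumes "\<And>F. finite F \<Longrightarrow> (\<Sum>K\<in>F. cmod (a K) * r ^ mi_size K) \<le> B" "r \<ge> 0"
  shows "abs_conv a r"
  unfolding abs_conv_def
  by (rule nonneg_bdd_above_summable_on) (use assms in \<open>auto intro!: bdd_aboveI[where M = B]\<close>)

lemma abs_conv_mono:
  assumes "abs_conv a r" "\<And>K. cmod (b K) \<le> cmod (a K)" "0 \<le> s" "s \<le> r"
  shows "abs_conv b s"
  using assms(1) unfolding abs_conv_def
  by (rule summable_on_comparison_test) (use assms in \<open>auto intro!: mult_mono power_mono\<close>)

lemma abs_conv_summable:
  assumes "abs_conv a r" "z \<in> cpolydisc r"
  shows "(\<lambda>K. norm (a K * mon z K)) summable_on UNIV"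
  using assms(1) unfolding abs_conv_def
  by (rule summable_on_comparison_test)
     (auto simp: norm_mult intro!: mult_left_mono norm_mon_le[OF assms(2)])

lemma abs_conv_has_sum:
  assumes "abs_conv a r" "z \<in> cpolydisc r"
  shows "((\<lambda>K. a K * mon z K) has_sum ps_eval a z) UNIV"
  unfolding ps_eval_def by (rule has_sum_infsum[OF abs_summable_summable[OF abs_conv_summable[OF assms]]])

lemma ps_eval_at_0: "ps_eval a 0 = a 0"
proof -
  have "ps_eval a 0 = (\<Sum>\<^sub>\<infinity>K\<in>{0}. a K * mon 0 K)"
    unfolding ps_eval_def by (rule infsum_cong_neutral) (auto simp: mon_at_0)
  then show ?thesis by simp
qed

text \<open>With x_i = z_i / \<zeta>_i the right side is the Cauchy kernel of several variables. For
  the summability, a finite set of multi-indices is enlarged to a box, over which the sum factors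
  into one-variable geometric sums.\<close>

lemma has_sum_geometric_mon:
  fixes x :: "complex^'n::finite"
  assumes "x \<in> polydisc 1"
  shows "((\<lambda>K. mon x K) has_sum (\<Prod>i\<in>UNIV. 1 / (1 - x $ i))) UNIV"
    and "(\<lambda>K. norm (mon x K)) summable_on UNIV"
proof -
  have eq: "PiE UNIV (\<lambda>_. UNIV) = (UNIV :: ('n \<Rightarrow> nat) set)" by (simp add: PiE_UNIV_domain)
  have 1: "cmod (x $ i) < 1" for i using assms by (auto simp: polydisc_def)
  have gs: "(\<lambda>k. norm (y ^ k)) summable_on UNIV" if "norm y < 1" for y :: complex
    using that by (intro summable_nonneg_imp_summable_on) (auto simp: norm_power summable_geometric)
  have gsum: "infsum (\<lambda>k. y ^ k) UNIV = 1 / (1 - y)" if "norm y < 1" for y :: complex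
    using norm_summable_imp_has_sum[of "\<lambda>k. y ^ k" "1 / (1 - y)"] that
    by (intro infsumI) (auto simp: norm_power summable_geometric geometric_sums)
  show s: "(\<lambda>K. norm (mon x K)) summable_on UNIV"
  proof (rule nonneg_bdd_above_summable_on)
    show "bdd_above (sum (\<lambda>K. cmod (mon x K)) ` {F. F \<subseteq> UNIV \<and> finite F})"
    proof (rule bdd_aboveI2)
      fix F :: "('n \<Rightarrow> nat) set" assume "F \<in> {F. F \<subseteq> UNIV \<and> finite F}"
      then have fin: "finite F" by auto
      obtain m where m: "F \<subseteq> {K. mi_size K \<le> m}"
        using fin by (intro that[of "Max (mi_size ` F)"]) auto
      have "F \<subseteq> PiE UNIV (\<lambda>_. {..m})" using m mi_size_le_subset_PiE by blast
      then have "(\<Sum>K\<in>F. cmod (mon x K)) \<le> (\<Sum>K\<in>PiE UNIV (\<lambda>_. {..m}). cmod (mon x K))"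
        by (intro sum_mono2) (auto intro: finite_PiE)
      also have "\<dots> = (\<Prod>i\<in>UNIV. \<Sum>k\<le>m. cmod (x $ i) ^ k)"
        by (simp add: norm_mon prod_sum_PiE)
      also have "\<dots> \<le> (\<Prod>i\<in>UNIV. 1 / (1 - cmod (x $ i)))"
      proof (intro prod_mono conjI)
        fix i :: 'n
        have "(\<Sum>k\<le>m. cmod (x $ i) ^ k) \<le> (\<Sum>k. cmod (x $ i) ^ k)"
          using 1 by (intro sum_le_suminf) (auto simp: summable_geometric)
        then show "(\<Sum>k\<le>m. cmod (x $ i) ^ k) \<le> 1 / (1 - cmod (x $ i))"
          using 1 by (simp add: suminf_geometric)
      qed (auto intro: sum_nonneg)
      finally show "(\<Sum>K\<in>F. cmod (mon x K)) \<le> (\<Prod>i\<in>UNIV. 1 / (1 - cmod (x $ i)))" .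
    qed
  qed auto
  have "infsum (mon x) UNIV = (\<Prod>i\<in>UNIV. infsum (\<lambda>k. x $ i ^ k) UNIV)"
    using infsum_prod_PiE_abs[of UNIV "\<lambda>i k. x $ i ^ k" "\<lambda>_. UNIV"] 1 gs
    unfolding mon_def[abs_def] eq by simp
  also have "\<dots> = (\<Prod>i\<in>UNIV. 1 / (1 - x $ i))" using 1 gsum by auto
  finally show "((\<lambda>K. mon x K) has_sum (\<Prod>i\<in>UNIV. 1 / (1 - x $ i))) UNIV"
    using has_sum_infsum[OF abs_summable_summable[OF s]] by simp
qed

section \<open>Power series expansion of holomorphic functions\<close>

definition coord_upd :: "complex^'n \<Rightarrow> 'n::finite \<Rightarrow> complex \<Rightarrow> complex^'n" where
  "coord_upd z i w = (\<chi> j. if j = i then w else z $ j)"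

definition circ :: "real \<Rightarrow> real \<Rightarrow> complex" where
  "circ r t = of_real r * exp (2 * of_real pi * \<i> * of_real t)"

definition torus :: "real \<Rightarrow> (complex^'n::finite) set" where
  "torus r = {z. \<forall>i. cmod (z $ i) = r}"

text \<open>With the parametrization \<open>circ\<close>, dw / (2 pi i w) becomes dt, so a Cauchy
  integral over a circle is a plain mean over [0, 1] with kernel w / (w - z). Coordinates outside
  the list keep the values of the argument.\<close>

primrec torus_mean :: "real \<Rightarrow> 'n::finite list \<Rightarrow> (complex^'n \<Rightarrow> complex) \<Rightarrow> complex^'n \<Rightarrow> complex" where
  "torus_mean r [] g = g"
| "torus_mean r (i # is) g = (\<lambda>z. integral {0..1} (\<lambda>t. torus_mean r is g (coord_upd z i (circ r t))))"

lemma coord_upd_nth [simp]: "coord_upd z i w $ j = (if j = i then w else z $ j)"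
  by (simp add: coord_upd_def)

lemma norm_circ: "cmod (circ r t) = \<bar>r\<bar>"
  by (simp add: circ_def norm_mult)

lemma continuous_circ [continuous_intros]: "continuous_on A (circ r)"
  unfolding circ_def by (intro continuous_intros)

lemma coord_upd_torus: "z \<in> torus r \<Longrightarrow> 0 \<le> r \<Longrightarrow> coord_upd z i (circ r t) \<in> torus r"
  by (auto simp: torus_def norm_circ)

lemma continuous_coord_upd [continuous_intros]:
  "continuous_on A f \<Longrightarrow> continuous_on A g \<Longrightarrow> continuous_on A (\<lambda>x. coord_upd (f x) i (g x))"
  unfolding coord_upd_def
proof (intro continuous_on_vec_lambda)
  fix j
  assume "continuous_on A f" "continuous_on A g"
  then show "continuous_on A (\<lambda>x. if j = i then g x else f x $ j)"
    by (cases "j = i") (auto intro!: continuous_intros)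
qed

lemma continuous_torus_slice:
  assumes "continuous_on (torus r) g" "z \<in> torus r" "0 \<le> r"
  shows "continuous_on {0..1} (\<lambda>t. g (coord_upd z i (circ r t)))"
  by (rule continuous_on_compose2[OF assms(1)])
     (auto intro!: continuous_intros coord_upd_torus assms)

lemma continuous_torus_mean:
  assumes "continuous_on (torus r) g" "0 \<le> r"
  shows "continuous_on (torus r) (torus_mean r is g)"
proof (induction "is")
  case (Cons i "is")
  have "continuous_on (torus r \<times> cbox 0 1) (\<lambda>(z, t). torus_mean r is g (coord_upd z i (circ r t)))"
    unfolding case_prod_unfold
    by (rule continuous_on_compose2[OF Cons])
       (auto intro!: continuous_intros coord_upd_torus assms continuous_on_compose2[OF continuous_circ[of UNIV]])
  from integral_continuous_on_param[OF this] show ?case by simp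
qed (use assms in simp)

lemma torus_mean_diff:
  assumes "continuous_on (torus r) f" "continuous_on (torus r) g" "0 \<le> r" "z \<in> torus r"
  shows "torus_mean r is (\<lambda>z. f z - g z) z = torus_mean r is f z - torus_mean r is g z"
  using assms(4)
proof (induction "is" arbitrary: z)
  case (Cons i "is")
  have "torus_mean r (i # is) (\<lambda>z. f z - g z) z = integral {0..1} (\<lambda>t.
     torus_mean r is f (coord_upd z i (circ r t)) - torus_mean r is g (coord_upd z i (circ r t)))"
    by (auto intro!: integral_cong Cons.IH coord_upd_torus Cons.prems assms)
  also have "\<dots> = torus_mean r (i # is) f z - torus_mean r (i # is) g z"
    by (simp, intro Henstock_Kurzweil_Integration.integral_diff integrable_continuous_interval
       continuous_torus_slice continuous_torus_mean assms Cons.prems)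
  finally show ?case .
qed simp

lemma torus_mean_add:
  assumes "continuous_on (torus r) f" "continuous_on (torus r) g" "0 \<le> r" "z \<in> torus r"
  shows "torus_mean r is (\<lambda>z. f z + g z) z = torus_mean r is f z + torus_mean r is g z"
  using torus_mean_diff[of r "\<lambda>z. f z + g z" g z "is"] assms
  by (simp add: continuous_on_add)

lemma torus_mean_cmult: "torus_mean r is (\<lambda>z. c * f z) z = c * torus_mean r is f z"
  by (induction "is" arbitrary: z) auto

lemma torus_mean_sum:
  assumes "finite A" "\<And>k. k \<in> A \<Longrightarrow> continuous_on (torus r) (f k)" "0 \<le> r" "z \<in> torus r"
  shows "torus_mean r is (\<lambda>z. \<Sum>k\<in>A. f k z) z = (\<Sum>k\<in>A. torus_mean r is (f k) z)"
  using assms(1,2)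
proof (induction A rule: finite_induct)
  case empty
  show ?case using torus_mean_cmult[of r "is" 0 "\<lambda>_. 0" z] by simp
next
  case (insert k A)
  then show ?case
    by (simp add: torus_mean_add continuous_on_sum assms)
qed

lemma norm_torus_mean_le:
  assumes "continuous_on (torus r) g" "\<And>z. z \<in> torus r \<Longrightarrow> cmod (g z) \<le> B" "0 \<le> r" "z \<in> torus r"
  shows "cmod (torus_mean r is g z) \<le> B"
  using assms(4)
proof (induction "is" arbitrary: z)
  case (Cons i "is")
  have "0 \<le> B" using assms(2)[OF Cons.prems] norm_ge_zero order_trans by blast
  have "((\<lambda>t. torus_mean r is g (coord_upd z i (circ r t))) has_integral torus_mean r (i # is) g z) (cbox 0 1)"
    using integrable_integral[OF integrable_continuous_interval[OF
       continuous_torus_slice[OF continuous_torus_mean[OF assms(1,3)] Cons.prems assms(3)]]] by simp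
  from has_integral_bound[OF \<open>0 \<le> B\<close> this] show ?case
    using Cons.IH[OF coord_upd_torus[OF Cons.prems assms(3)]] by simp
qed (use assms in simp)

lemma Cauchy_circle_mean:
  assumes "f holomorphic_on cball 0 r" "cmod z < r"
  shows "integral {0..1} (\<lambda>t. f (circ r t) * (circ r t / (circ r t - z))) = f z"
proof -
  have path: "circlepath 0 r t = circ r t" for t
    by (simp add: circlepath circ_def)
  have "((\<lambda>u. f u / (u - z)) has_contour_integral (2 * of_real pi * \<i> * f z)) (circlepath 0 r)"
    using assms by (intro Cauchy_integral_circlepath)
      (auto intro: holomorphic_on_imp_continuous_on holomorphic_on_subset)
  then have "((\<lambda>t. f (circ r t) / (circ r t - z) * (2 * of_real pi * \<i> * circ r t))
      has_integral (2 * of_real pi * \<i> * f z)) {0..1}"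
    unfolding has_contour_integral_def
    by (rule has_integral_eq[rotated])
       (simp add: vector_derivative_circlepath01 path circ_def mult_ac)
  from has_integral_mult_right[OF this, of "1 / (2 * of_real pi * \<i>)"]
  show ?thesis by (intro integral_unique) (simp add: field_simps)
qed

lemma holo_on_imp_continuous_on: "holo_on f U \<Longrightarrow> continuous_on U f"
  unfolding holo_on_def
  by (meson continuous_at_imp_continuous_on has_derivative_continuous)

text \<open>The bridge from \<open>holo_on\<close>, a real Frechet derivative commuting with complex
  scalars, to the one-variable \<open>holomorphic_on\<close> that Cauchy's formula requires.\<close>

lemma holo_on_slice:
  assumes "holo_on f U" "\<And>w. w \<in> S \<Longrightarrow> coord_upd z i w \<in> U"
  shows "(\<lambda>w. f (coord_upd z i w)) holomorphic_on S"
proof -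
  have "\<exists>d. ((\<lambda>w. f (coord_upd z i w)) has_field_derivative d) (at w)" if w: "w \<in> S" for w
  proof -
    obtain D where D: "(f has_derivative D) (at (coord_upd z i w))" "\<And>c v. D (c *s v) = c * D v"
      using assms w unfolding holo_on_def by metis
    have "coord_upd z i = (\<lambda>w. coord_upd z i 0 + w *s axis i 1)"
      by (auto simp: fun_eq_iff vec_eq_iff axis_def)
    moreover have "((\<lambda>w. coord_upd z i 0 + w *s axis i 1) has_derivative (\<lambda>h. h *s axis i 1)) (at w)"
    proof -
      have bl: "bounded_linear (\<lambda>h::complex. h *s (axis i 1 :: complex^'a))"
        by (intro linear_conv_bounded_linear[THEN iffD1] linearI)
           (auto simp: vec_eq_iff ring_distribs)
      show ?thesis
        using has_derivative_add[OF has_derivative_const bounded_linear.has_derivative[OF bl has_derivative_ident]]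
        by simp
    qed
    ultimately have "(coord_upd z i has_derivative (\<lambda>h. h *s axis i 1)) (at w)" by metis
    from has_derivative_compose[OF this D(1)]
    have "((\<lambda>w. f (coord_upd z i w)) has_derivative (\<lambda>h. D (axis i 1) * h)) (at w)"
      by (simp add: D(2) mult.commute)
    then show ?thesis unfolding has_field_derivative_def by (auto intro!: exI)
  qed
  then show ?thesis
    by (auto simp: holomorphic_on_def field_differentiable_def intro: has_field_derivative_at_within)
qed

text \<open>One-variable Cauchy formula, coordinate by coordinate: each averaging replaces one
  coordinate of \<zeta> by that of z and removes its factor of the kernel. Partial lists serve the
  induction; a list of all coordinates gives f z.\<close>

lemma torus_mean_Cauchy_kernel:
  fixes z :: "complex^'n::finite"
  assumes f: "holo_on f U" and U: "cpolydisc r \<subseteq> U" and z: "z \<in> polydisc r"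
    and "distinct is" "\<zeta> \<in> torus r"
  shows "torus_mean r is (\<lambda>\<zeta>. f \<zeta> * (\<Prod>i\<in>UNIV. \<zeta> $ i / (\<zeta> $ i - z $ i))) \<zeta> =
    f (\<chi> i. if i \<in> set is then z $ i else \<zeta> $ i) * (\<Prod>i\<in>- set is. \<zeta> $ i / (\<zeta> $ i - z $ i))"
  using assms(4,5)
proof (induction "is" arbitrary: \<zeta>)
  case Nil
  then show ?case by simp
next
  case (Cons i "is")
  define F where "F w = f (coord_upd (\<chi> j. if j \<in> set is then z $ j else \<zeta> $ j) i w)" for w
  define P where "P = (\<Prod>j\<in>- set (i # is). \<zeta> $ j / (\<zeta> $ j - z $ j))"
  have r: "0 \<le> r" "cmod (z $ i) < r"
    using z by (auto simp: polydisc_def) (meson less_le_not_le linorder_not_le norm_ge_zero order_trans)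
  have eq1: "torus_mean r is (\<lambda>\<zeta>. f \<zeta> * (\<Prod>i\<in>UNIV. \<zeta> $ i / (\<zeta> $ i - z $ i))) (coord_upd \<zeta> i (circ r t))
      = P * (F (circ r t) * (circ r t / (circ r t - z $ i)))" for t
  proof -
    have i: "i \<notin> set is" using Cons.prems by simp
    define A where "A = - set (i # is)"
    have A: "- set is = insert i A" "i \<notin> A" using i by (auto simp: A_def)
    have "(\<Prod>j\<in>- set is. coord_upd \<zeta> i (circ r t) $ j / (coord_upd \<zeta> i (circ r t) $ j - z $ j))
      = circ r t / (circ r t - z $ i) * P"
      unfolding P_def A(1) A_def[symmetric] prod.insert[OF finite A(2)]
      by (rule arg_cong2[where f = "(*)"]) (use A(2) in \<open>auto intro!: prod.cong\<close>)
    moreover have "(\<chi> j. if j \<in> set is then z $ j else coord_upd \<zeta> i (circ r t) $ j) =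
      coord_upd (\<chi> j. if j \<in> set is then z $ j else \<zeta> $ j) i (circ r t)"
      using i by (auto simp: vec_eq_iff)
    ultimately show ?thesis
      using Cons.IH[OF _ coord_upd_torus[OF Cons.prems(2) r(1)], of i t] Cons.prems(1)
      by (simp add: F_def)
  qed
  have "F holomorphic_on cball 0 r" unfolding F_def
    using z Cons.prems U
    by (intro holo_on_slice[OF f] subsetD[OF U])
       (auto simp: polydisc_def torus_def cpolydisc_def intro: less_imp_le)
  from Cauchy_circle_mean[OF this r(2)]
  have "integral {0..1} (\<lambda>t. P * (F (circ r t) * (circ r t / (circ r t - z $ i)))) = P * F (z $ i)"
    by (simp only: Henstock_Kurzweil_Integration.integral_mult_right)
  moreover have "F (z $ i) = f (\<chi> j. if j \<in> set (i # is) then z $ j else \<zeta> $ j)"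
    unfolding F_def by (intro arg_cong[where f = f]) (auto simp: vec_eq_iff)
  ultimately show ?case unfolding torus_mean.simps eq1 by (simp add: P_def)
qed

lemma closed_torus: "closed (torus r :: (complex^'n::finite) set)"
proof -
  have "torus r = (\<Inter>i. {z :: complex^'n. cmod (z $ i) = r})" by (auto simp: torus_def)
  moreover have "closed {z :: complex^'n. cmod (z $ i) = r}" for i
    by (intro closed_Collect_eq continuous_intros)
  ultimately show ?thesis by auto
qed

lemma compact_torus: "compact (torus r :: (complex^'n::finite) set)"
proof -
  have "bounded (torus r :: (complex^'n) set)"
    by (rule boundedI[of _ "real CARD('n) * r"], rule norm_le_polydisc) (auto simp: torus_def cpolydisc_def)
  then show ?thesis using closed_torus compact_eq_bounded_closed by blast
qed

text \<open>The coefficients are the torus means of f / \<zeta>^K, which Cauchy's estimate bounds by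
  M / R^|K|. The kernel is expanded in the monomials of z / \<zeta>; its remainder after finitely
  many terms is bounded uniformly in \<zeta> by a tail of the sum of 2^(-|K|), so the mean may be
  taken term by term.\<close>

theorem holo_on_power_series:
  fixes f :: "complex^'n::finite \<Rightarrow> complex"
  assumes f: "holo_on f U" and "0 \<in> U"
  obtains a r where "r > 0" "cpolydisc r \<subseteq> U" "abs_conv a r"
    "\<And>z. z \<in> cpolydisc r \<Longrightarrow> f z = ps_eval a z"
proof -
  have "open U" using f by (simp add: holo_on_def)
  with \<open>0 \<in> U\<close> obtain R where R: "R > 0" "cpolydisc R \<subseteq> U"
    using open_contains_cpolydisc by blast
  have torus_sub: "torus R \<subseteq> (cpolydisc R :: (complex^'n) set)" by (auto simp: torus_def cpolydisc_def)
  have cont: "continuous_on (torus R) f"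
    using continuous_on_subset[OF holo_on_imp_continuous_on[OF f]] torus_sub R by blast
  obtain M where M: "\<And>\<zeta>. \<zeta> \<in> torus R \<Longrightarrow> cmod (f \<zeta>) \<le> M" "M > 0"
    using compact_imp_bounded[OF compact_continuous_image[OF cont compact_torus]]
    unfolding bounded_pos by auto
  \<comment> \<open>A base point for the mean: all coordinates are averaged, so any point of the
    torus gives the same value.\<close>
  define \<zeta>0 :: "complex^'n" where "\<zeta>0 = (\<chi> i. of_real R)"
  have \<zeta>0: "\<zeta>0 \<in> torus R" using R by (simp add: \<zeta>0_def torus_def)
  obtain "is" :: "'n list" where is_UNIV: "set is = UNIV" "distinct is"
    using finite_distinct_list[of "UNIV :: 'n set"] by auto
  define a where "a K = torus_mean R is (\<lambda>\<zeta>. f \<zeta> * inverse (mon \<zeta> K)) \<zeta>0" for K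
  have mon_nz: "mon \<zeta> K \<noteq> 0" if "\<zeta> \<in> torus R" for \<zeta> :: "complex^'n" and K
    using that R(1) by (auto simp: mon_def torus_def)
  have mon_norm: "cmod (mon \<zeta> K) = R ^ mi_size K" if "\<zeta> \<in> torus R" for \<zeta> :: "complex^'n" and K
    using that by (simp add: norm_mon torus_def mi_size_def power_sum)
  have cont_mon: "continuous_on A (\<lambda>z::complex^'n. mon z K)" for A K
    unfolding mon_def by (intro continuous_intros)
  have conta: "continuous_on (torus R) (\<lambda>\<zeta>. f \<zeta> * inverse (mon \<zeta> K))" for K
    by (intro continuous_intros cont cont_mon) (auto simp: mon_nz)
  have abound: "cmod (a K) * R ^ mi_size K \<le> M" for K
  proof -
    have "cmod (a K) \<le> M / R ^ mi_size K"
      unfolding a_def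
      by (rule norm_torus_mean_le[OF conta])
         (use R \<zeta>0 in \<open>auto simp: norm_mult norm_inverse mon_norm divide_inverse intro!: mult_right_mono M\<close>)
    then show ?thesis using R by (simp add: field_simps)
  qed
  \<comment> \<open>Halving the radius keeps |z_i / \<zeta>_i| at most 1/2, which gives both the
    convergence of the series and the uniform remainder.\<close>
  define r where "r = R / 2"
  have r: "r > 0" "r < R" using R by (auto simp: r_def)
  define q :: "complex^'n" where "q = (\<chi> i. of_real (1/2))"
  have q: "q \<in> polydisc 1" by (simp add: q_def polydisc_def)
  have mon_q: "norm (mon q K) = (1/2) ^ mi_size K" for K
    by (simp add: norm_mon q_def mi_size_def power_sum)
  have q_sum: "(\<lambda>K::'n \<Rightarrow> nat. (1/2::real) ^ mi_size K) summable_on (UNIV :: ('n \<Rightarrow> nat) set)"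
    using has_sum_geometric_mon(2)[OF q] by (simp add: mon_q)
  have conv: "abs_conv a r"
    unfolding abs_conv_def
  proof (rule summable_on_comparison_test[OF summable_on_cmult_right[OF q_sum, of M]])
    fix K :: "'n \<Rightarrow> nat"
    have "cmod (a K) * r ^ mi_size K = cmod (a K) * R ^ mi_size K * (1/2) ^ mi_size K"
      by (simp add: r_def power_divide)
    also have "\<dots> \<le> M * (1/2) ^ mi_size K" by (intro mult_right_mono abound) simp
    finally show "cmod (a K) * r ^ mi_size K \<le> M * (1/2) ^ mi_size K" .
  qed (use r in auto)
  have "f z = ps_eval a z" if z: "z \<in> cpolydisc r" for z
  proof -
    have zR: "z \<in> polydisc R" using z r cpolydisc_subset_polydisc by blast
    define k where "k \<zeta> = (\<Prod>i\<in>UNIV. \<zeta> $ i / (\<zeta> $ i - z $ i))" for \<zeta>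
    have fz: "f z = torus_mean R is (\<lambda>\<zeta>. f \<zeta> * k \<zeta>) \<zeta>0"
      using torus_mean_Cauchy_kernel[OF f R(2) zR is_UNIV(2) \<zeta>0] is_UNIV(1)
      by (simp add: k_def)
    have contk: "continuous_on (torus R) k"
      unfolding k_def using zR
      by (intro continuous_intros) (simp add: torus_def polydisc_def, metis less_irrefl)
    define S where "S = (\<Sum>\<^sub>\<infinity>K::'n \<Rightarrow> nat. (1/2::real) ^ mi_size K)"
    define T where "T F = (\<Sum>K\<in>F. (1/2::real) ^ mi_size K)" for F :: "('n \<Rightarrow> nat) set"
    have T: "(T \<longlongrightarrow> S) (finite_subsets_at_top UNIV)"
      unfolding T_def[abs_def] S_def using has_sum_infsum[OF q_sum] by (simp add: has_sum_def)
    have kF: "cmod (k \<zeta> - (\<Sum>K\<in>F. mon z K * inverse (mon \<zeta> K))) \<le> S - T F"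
      if "finite F" and \<zeta>: "\<zeta> \<in> torus R" for F \<zeta>
    proof -
      define x :: "complex^'n" where "x = (\<chi> i. z $ i / \<zeta> $ i)"
      have nz: "\<zeta> $ i \<noteq> 0" for i using \<zeta> R(1) by (auto simp: torus_def)
      have xh: "x \<in> cpolydisc (1/2)"
        using z \<zeta> R(1) by (auto simp: x_def cpolydisc_def torus_def norm_divide r_def field_simps)
      then have x1: "x \<in> polydisc 1" using cpolydisc_subset_polydisc[of "1/2" 1] by auto
      have monx: "mon x K = mon z K * inverse (mon \<zeta> K)" for K
        by (simp add: mon_def x_def power_divide prod_dividef divide_inverse[symmetric])
      have "k \<zeta> = (\<Prod>i\<in>UNIV. 1 / (1 - x $ i))"
        unfolding k_def x_def using nz by (intro prod.cong) (auto simp: field_simps)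
      then have sumk: "(mon x has_sum k \<zeta>) UNIV" using has_sum_geometric_mon(1)[OF x1] by simp
      have "((mon x) has_sum (k \<zeta> - sum (mon x) F)) (UNIV - F)"
        by (rule has_sum_Diff[OF sumk]) (use that in auto)
      moreover have "((\<lambda>K. (1/2::real) ^ mi_size K) has_sum (S - T F)) (UNIV - F)"
        unfolding S_def T_def by (rule has_sum_Diff) (use that q_sum in auto)
      moreover have "norm (mon x K) \<le> (1/2) ^ mi_size K" for K using norm_mon_le[OF xh] .
      ultimately have "norm (k \<zeta> - sum (mon x) F) \<le> S - T F"
        by (rule norm_infsum_le)
      then show ?thesis by (simp add: monx)
    qed
    have est: "dist (\<Sum>K\<in>F. a K * mon z K) (f z) \<le> M * (S - T F)" if F: "finite F" for F
    proof -
      have "(\<Sum>K\<in>F. a K * mon z K) = torus_mean R is (\<lambda>\<zeta>. \<Sum>K\<in>F. mon z K * (f \<zeta> * inverse (mon \<zeta> K))) \<zeta>0"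
        using F R \<zeta>0 by (subst torus_mean_sum)
          (auto simp: torus_mean_cmult a_def mult.commute intro!: continuous_on_mult_left conta)
      also have "f z - \<dots> = torus_mean R is
         (\<lambda>\<zeta>. f \<zeta> * k \<zeta> - (\<Sum>K\<in>F. mon z K * (f \<zeta> * inverse (mon \<zeta> K)))) \<zeta>0"
        unfolding fz using R \<zeta>0
        by (subst torus_mean_diff) (auto intro!: continuous_intros cont contk cont_mon simp: mon_nz)
      also have "\<dots> = torus_mean R is
         (\<lambda>\<zeta>. f \<zeta> * (k \<zeta> - (\<Sum>K\<in>F. mon z K * inverse (mon \<zeta> K)))) \<zeta>0"
        by (simp add: algebra_simps sum_distrib_left)
      also have "cmod \<dots> \<le> M * (S - T F)"
        by (rule norm_torus_mean_le)
           (use R \<zeta>0 M(2) in \<open>auto intro!: continuous_intros cont contk cont_mon mult_mono M(1) kF[OF F] simp: mon_nz norm_mult\<close>)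
      finally show ?thesis by (simp add: dist_norm norm_minus_commute)
    qed
    have "((\<lambda>F. M * (S - T F)) \<longlongrightarrow> M * (S - S)) (finite_subsets_at_top UNIV)"
      by (intro tendsto_intros T)
    then have "((\<lambda>F. M * (S - T F)) \<longlongrightarrow> 0) (finite_subsets_at_top UNIV)" by simp
    then have "((\<lambda>F. dist (\<Sum>K\<in>F. a K * mon z K) (f z)) \<longlongrightarrow> 0) (finite_subsets_at_top UNIV)"
      by (rule tendsto_sandwich[OF _ _ tendsto_const, rotated -1])
         (auto intro!: eventually_finite_subsets_at_top_weakI est)
    then have "((\<lambda>K. a K * mon z K) has_sum f z) UNIV"
      unfolding has_sum_def by (subst tendsto_dist_iff)
    then show ?thesis unfolding ps_eval_def by (simp add: infsumI)
  qed
  moreover have "cpolydisc r \<subseteq> U" using R r cpolydisc_mono[of r R] by auto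
  ultimately show ?thesis using that r conv by blast
qed

section \<open>Differentiation of power series\<close>

definition ps_deriv :: "'n \<Rightarrow> (('n::finite \<Rightarrow> nat) \<Rightarrow> complex) \<Rightarrow> ('n \<Rightarrow> nat) \<Rightarrow> complex" where
  "ps_deriv i a K = of_nat (K i + 1) * a (K + mi_unit i)"

lemma inj_add_mi_unit: "inj (\<lambda>K::'n \<Rightarrow> nat. K + mi_unit i)"
  by (rule injI) simp

lemma mi_unit_nth [simp]: "mi_unit i j = (if j = i then 1 else 0)"
  by (simp add: mi_unit_def)

lemma range_add_mi_unit: "range (\<lambda>K::'n \<Rightarrow> nat. K + mi_unit i) = {K. K i \<noteq> 0}"
proof (intro equalityI subsetI)
  fix K :: "'n \<Rightarrow> nat" assume "K \<in> {K. K i \<noteq> 0}"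
  then have "K = (K - mi_unit i) + mi_unit i" by (simp add: mi_add_unit_diff)
  then show "K \<in> range (\<lambda>K. K + mi_unit i)" by blast
qed auto

text \<open>Differentiation multiplies a coefficient by up to |K|; any shrinking of the radius pays
  for that factor.\<close>

lemma nat_times_power_bound:
  fixes s r :: real
  assumes "0 < s" "s < r"
  obtains C where "C \<ge> 0" "\<And>n. real n * s ^ n \<le> C * r ^ n"
proof -
  have "(\<lambda>n. real n * (s / r) ^ n) \<longlonglongrightarrow> 0"
    using assms powser_times_n_limit_0[of "s / r"] by simp
  then have "Bseq (\<lambda>n. real n * (s / r) ^ n)"
    by (intro convergent_imp_Bseq convergentI)
  then obtain C where C: "C > 0" "\<And>n. norm (real n * (s / r) ^ n) \<le> C" by (auto simp: Bseq_def)
  have "real n * s ^ n \<le> C * r ^ n" for n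
  proof -
    have "real n * (s / r) ^ n \<le> C" using C(2)[of n] assms by simp
    then show ?thesis using assms by (simp add: power_divide field_simps)
  qed
  with C(1) that show ?thesis by (meson less_imp_le)
qed

text \<open>Lets a claim at a point of the open polydisc be proved on a smaller one, where there is
  room for the factor |K|.\<close>

lemma polydisc_shrink:
  fixes z :: "complex^'n::finite"
  assumes "z \<in> polydisc r"
  obtains s where "0 < s" "s < r" "z \<in> polydisc s"
proof -
  define m where "m = Max ((\<lambda>i. cmod (z $ i)) ` UNIV)"
  have m: "cmod (z $ i) \<le> m" for i unfolding m_def by (rule Max_ge) auto
  have "m \<in> (\<lambda>i. cmod (z $ i)) ` UNIV" unfolding m_def by (rule Max_in) auto
  then have "0 \<le> m" "m < r" using assms by (auto simp: polydisc_def)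
  moreover have "cmod (z $ i) < (m + r) / 2" for i using m[of i] \<open>m < r\<close> by (simp add: field_simps)
  ultimately show ?thesis by (intro that[of "(m + r) / 2"]) (auto simp: polydisc_def)
qed

lemma abs_conv_mult_size:
  assumes "abs_conv a r" "0 < s" "s < r"
  shows "(\<lambda>K. real (mi_size K) * cmod (a K) * s ^ mi_size K) summable_on UNIV"
proof -
  obtain C where C: "C \<ge> 0" "\<And>n. real n * s ^ n \<le> C * r ^ n"
    using nat_times_power_bound assms(2,3) by blast
  show ?thesis
  proof (rule summable_on_comparison_test)
    show "(\<lambda>K. C * (cmod (a K) * r ^ mi_size K)) summable_on UNIV"
      using assms(1) unfolding abs_conv_def by (rule summable_on_cmult_right)
    fix K
    have "cmod (a K) * (real (mi_size K) * s ^ mi_size K) \<le> cmod (a K) * (C * r ^ mi_size K)"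
      by (intro mult_left_mono C) simp
    then show "real (mi_size K) * cmod (a K) * s ^ mi_size K \<le> C * (cmod (a K) * r ^ mi_size K)"
      by (simp add: mult_ac)
  qed (use assms in auto)
qed

lemma abs_conv_ps_deriv:
  assumes "abs_conv a r" "0 \<le> s" "s < r"
  shows "abs_conv (ps_deriv i a) s"
proof -
  define t where "t = (s + r) / 2"
  have t: "0 < t" "t < r" "s \<le> t" using assms by (auto simp: t_def)
  have "(\<lambda>K. real (mi_size K) * cmod (a K) * t ^ mi_size K) summable_on range (\<lambda>K. K + mi_unit i)"
    by (rule summable_on_subset_banach[OF abs_conv_mult_size[OF assms(1) t(1,2)]]) simp
  then have "(\<lambda>K. real (mi_size (K + mi_unit i)) * cmod (a (K + mi_unit i)) * t ^ mi_size (K + mi_unit i)) summable_on UNIV"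
    by (subst (asm) summable_on_reindex[OF inj_add_mi_unit]) (simp add: o_def)
  from summable_on_cmult_right[OF this, of "1 / t"]
  have *: "(\<lambda>K. real (mi_size K + 1) * cmod (a (K + mi_unit i)) * t ^ mi_size K) summable_on UNIV"
    using t by (simp add: mult.assoc)
  have "abs_conv (ps_deriv i a) t"
    unfolding abs_conv_def
  proof (rule summable_on_comparison_test[OF *])
    fix K
    have "cmod (ps_deriv i a K) = real (K i + 1) * cmod (a (K + mi_unit i))"
      unfolding ps_deriv_def norm_mult by (simp only: norm_of_nat)
    also have "\<dots> \<le> real (mi_size K + 1) * cmod (a (K + mi_unit i))"
      using le_mi_size[of K i] by (intro mult_right_mono) auto
    finally show "cmod (ps_deriv i a K) * t ^ mi_size K \<le> real (mi_size K + 1) * cmod (a (K + mi_unit i)) * t ^ mi_size K"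
      by (rule mult_right_mono) (use t in simp)
  qed (use t in auto)
  then show ?thesis by (rule abs_conv_mono) (use assms t in auto)
qed

text \<open>Returns to the original indices after the shift in \<open>ps_deriv\<close>. Where
  \<open>K i = 0\<close> the subtraction is truncated, but there the factor \<open>K i\<close> kills
  the term.\<close>

lemma ps_eval_ps_deriv:
  "ps_eval (ps_deriv i a) z = (\<Sum>\<^sub>\<infinity>K. a K * (of_nat (K i) * mon z (K - mi_unit i)))"
proof -
  have "(\<Sum>\<^sub>\<infinity>K. a K * (of_nat (K i) * mon z (K - mi_unit i))) =
    (\<Sum>\<^sub>\<infinity>K\<in>range (\<lambda>K. K + mi_unit i). a K * (of_nat (K i) * mon z (K - mi_unit i)))"
    by (rule infsum_cong_neutral) (auto simp: range_add_mi_unit)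
  also have "\<dots> = ps_eval (ps_deriv i a) z"
    by (subst infsum_reindex[OF inj_add_mi_unit])
       (auto simp: o_def ps_eval_def ps_deriv_def mult_ac intro!: infsum_cong)
  finally show ?thesis by simp
qed

lemma has_derivative_mon:
  fixes z :: "complex^'n::finite"
  shows "((\<lambda>z. mon z K) has_derivative (\<lambda>v. \<Sum>i\<in>UNIV. v $ i * (of_nat (K i) * mon z (K - mi_unit i)))) (at z within S)"
proof -
  have "((\<lambda>z. mon z K) has_derivative
     (\<lambda>v. \<Sum>i\<in>UNIV. (of_nat (K i) * (v $ i) * z $ i ^ (K i - 1)) * (\<Prod>j\<in>UNIV - {i}. z $ j ^ K j))) (at z within S)"
    unfolding mon_def
    by (intro has_derivative_prod has_derivative_power bounded_linear_imp_has_derivative bounded_linear_vec_nth)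
  moreover have "of_nat (K i) * (v $ i) * z $ i ^ (K i - 1) * (\<Prod>j\<in>UNIV - {i}. z $ j ^ K j)
      = v $ i * (of_nat (K i) * mon z (K - mi_unit i))" for v i
  proof -
    have "mon z (K - mi_unit i) = z $ i ^ (K i - 1) * (\<Prod>j\<in>UNIV - {i}. z $ j ^ K j)"
      unfolding mon_def by (subst prod.remove[of _ i]) (auto intro!: prod.cong)
    then show ?thesis by simp
  qed
  ultimately show ?thesis by (simp only:)
qed

text \<open>Termwise differentiation by \<open>has_derivative_series\<close>, which wants a convex
  set and a series over the naturals; hence the smaller polydisc and the enumeration
  \<open>\<kappa>\<close>. The partial derivatives converge uniformly by the Weierstrass
  test.\<close>

theorem has_derivative_ps_eval:
  fixes z :: "complex^'n::finite"
  assumes conv: "abs_conv a r" and z: "z \<in> polydisc r"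
  shows "(ps_eval a has_derivative (\<lambda>v. \<Sum>i\<in>UNIV. v $ i * ps_eval (ps_deriv i a) z)) (at z)"
proof -
  obtain s where s: "0 < s" "s < r" "z \<in> polydisc s" using polydisc_shrink z by blast
  define S :: "(complex^'n) set" where "S = polydisc s"
  have "convex {w :: complex. cmod w < s}"
    using convex_ball[of "0::complex" s] by (simp add: ball_def)
  then have "convex S"
    unfolding S_def polydisc_def convex_def by (simp add: scaleR_vec_def)
  have S_sub: "S \<subseteq> cpolydisc s" "S \<subseteq> cpolydisc r"
    using polydisc_subset_cpolydisc cpolydisc_mono[of s r] s(2) unfolding S_def by auto
  define \<kappa> :: "nat \<Rightarrow> 'n \<Rightarrow> nat" where "\<kappa> = from_nat_into UNIV"
  have \<kappa>: "bij_betw \<kappa> UNIV UNIV" unfolding \<kappa>_def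
    by (rule bij_betw_from_nat_into[OF countable_mi infinite_mi])
  \<comment> \<open>A bound for the terms of every partial derivative. The exponent |K| - 1 is
    written as |K| with a factor 1/s, so that K = 0 needs no separate formula.\<close>
  define M where "M n = (1 / s) * (real (mi_size (\<kappa> n)) * cmod (a (\<kappa> n)) * s ^ mi_size (\<kappa> n))" for n
  have "(\<lambda>n. real (mi_size (\<kappa> n)) * cmod (a (\<kappa> n)) * s ^ mi_size (\<kappa> n)) summable_on UNIV"
    using abs_conv_mult_size[OF conv s(1,2)]
    by (subst summable_on_reindex_bij_betw[OF \<kappa>, where f = "\<lambda>K. real (mi_size K) * cmod (a K) * s ^ mi_size K"])
  then have M: "summable M"
    unfolding M_def by (intro summable_mult summable_on_imp_summable)
  define d where "d n i x = a (\<kappa> n) * (of_nat (\<kappa> n i) * mon x (\<kappa> n - mi_unit i))" for n i x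
  have d_le: "norm (d n i x) \<le> M n" if x: "x \<in> S" for n i x
  proof (cases "\<kappa> n i = 0")
    case True
    then show ?thesis using s by (simp add: d_def M_def)
  next
    case False
    then have sz: "mi_size (\<kappa> n) = Suc (mi_size (\<kappa> n - mi_unit i))"
      by (metis mi_add_unit_diff mi_size_add mi_size_unit Suc_eq_plus1)
    have "norm (d n i x) \<le> cmod (a (\<kappa> n)) * (real (mi_size (\<kappa> n)) * s ^ mi_size (\<kappa> n - mi_unit i))"
      unfolding d_def norm_mult norm_of_nat
      using x S_sub le_mi_size by (intro mult_left_mono mult_mono norm_mon_le) auto
    also have "\<dots> = M n" using s by (simp add: M_def sz)
    finally show ?thesis .
  qed
  have sums_deriv: "(\<lambda>n. d n i x) sums ps_eval (ps_deriv i a) x" if x: "x \<in> S" for i x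
  proof -
    have "(\<lambda>n. norm (d n i x)) summable_on UNIV"
      by (rule summable_nonneg_imp_summable_on)
         (use d_le[OF x] M in \<open>auto intro: summable_comparison_test'[of M 0]\<close>)
    then have "(\<lambda>n. d n i x) summable_on UNIV" by (rule abs_summable_summable)
    moreover have "infsum (\<lambda>n. d n i x) UNIV = ps_eval (ps_deriv i a) x"
      unfolding d_def ps_eval_ps_deriv
      by (rule infsum_reindex_bij_betw[OF \<kappa>, where f = "\<lambda>K. a K * (of_nat (K i) * mon x (K - mi_unit i))"])
    ultimately show ?thesis by (metis has_sum_imp_sums has_sum_infsum)
  qed
  have sums_f: "(\<lambda>n. a (\<kappa> n) * mon x (\<kappa> n)) sums ps_eval a x" if x: "x \<in> S" for x
  proof (rule has_sum_imp_sums)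
    show "((\<lambda>n. a (\<kappa> n) * mon x (\<kappa> n)) has_sum ps_eval a x) UNIV"
      using abs_conv_has_sum[OF conv subsetD[OF S_sub(2) x]]
      by (subst has_sum_reindex_bij_betw[OF \<kappa>, where f = "\<lambda>K. a K * mon x K"])
  qed
  have "\<exists>g. \<forall>x\<in>S. (\<lambda>n. a (\<kappa> n) * mon x (\<kappa> n)) sums (g x) \<and>
     (g has_derivative (\<lambda>v. \<Sum>i\<in>UNIV. v $ i * ps_eval (ps_deriv i a) x)) (at x within S)"
  proof (rule has_derivative_series[OF \<open>convex S\<close>, where f' = "\<lambda>n x v. \<Sum>i\<in>UNIV. v $ i * d n i x"])
    fix n x
    have "((\<lambda>x. a (\<kappa> n) * mon x (\<kappa> n)) has_derivative
      (\<lambda>v. a (\<kappa> n) * (\<Sum>i\<in>UNIV. v $ i * (of_nat (\<kappa> n i) * mon x (\<kappa> n - mi_unit i))))) (at x within S)"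
      by (intro has_derivative_mult_right has_derivative_mon)
    then show "((\<lambda>x. a (\<kappa> n) * mon x (\<kappa> n)) has_derivative (\<lambda>v. \<Sum>i\<in>UNIV. v $ i * d n i x)) (at x within S)"
      by (simp add: d_def sum_distrib_left mult_ac)
  next
    fix e :: real assume e: "e > 0"
    \<comment> \<open>The error is shared equally among the coordinates, each of which satisfies
      |h_i| \<le> |h|.\<close>
    define e' where "e' = e / real CARD('n)"
    have e': "e' > 0" using e by (simp add: e'_def)
    have "\<forall>\<^sub>F n in sequentially. \<forall>i\<in>UNIV. \<forall>x\<in>S. dist (\<Sum>k<n. d k i x) (ps_eval (ps_deriv i a) x) < e'"
    proof (rule eventually_ball_finite)
      show "\<forall>i\<in>UNIV. \<forall>\<^sub>F n in sequentially. \<forall>x\<in>S. dist (\<Sum>k<n. d k i x) (ps_eval (ps_deriv i a) x) < e'"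
      proof
        fix i
        have "uniform_limit S (\<lambda>n x. \<Sum>k<n. d k i x) (\<lambda>x. suminf (\<lambda>k. d k i x)) sequentially"
          by (rule Weierstrass_m_test[OF _ M]) (use d_le in auto)
        from uniform_limitD[OF this e'] show "\<forall>\<^sub>F n in sequentially. \<forall>x\<in>S. dist (\<Sum>k<n. d k i x) (ps_eval (ps_deriv i a) x) < e'"
          by (rule eventually_mono) (simp add: sums_unique[OF sums_deriv])
      qed
    qed simp
    then show "\<forall>\<^sub>F n in sequentially. \<forall>x\<in>S. \<forall>h. norm ((\<Sum>k<n. \<Sum>i\<in>UNIV. h $ i * d k i x)
        - (\<Sum>i\<in>UNIV. h $ i * ps_eval (ps_deriv i a) x)) \<le> e * norm h"
    proof eventually_elim
      case (elim n)
      show ?case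
      proof (intro ballI allI)
        fix x and h :: "complex^'n" assume x: "x \<in> S"
        have "(\<Sum>k<n. \<Sum>i\<in>UNIV. h $ i * d k i x) = (\<Sum>i\<in>UNIV. h $ i * (\<Sum>k<n. d k i x))"
          by (subst sum.swap) (simp add: sum_distrib_left)
        then have "norm ((\<Sum>k<n. \<Sum>i\<in>UNIV. h $ i * d k i x) - (\<Sum>i\<in>UNIV. h $ i * ps_eval (ps_deriv i a) x))
          = norm (\<Sum>i\<in>UNIV. h $ i * ((\<Sum>k<n. d k i x) - ps_eval (ps_deriv i a) x))"
          by (simp add: sum_subtractf right_diff_distrib)
        also have "\<dots> \<le> (\<Sum>i\<in>(UNIV::'n set). norm h * e')"
          using elim x unfolding dist_norm
          by (intro sum_norm_le) (auto simp: norm_mult less_imp_le intro!: mult_mono Finite_Cartesian_Product.norm_nth_le)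
        also have "\<dots> = e * norm h" by (simp add: e'_def)
        finally show "norm ((\<Sum>k<n. \<Sum>i\<in>UNIV. h $ i * d k i x)
          - (\<Sum>i\<in>UNIV. h $ i * ps_eval (ps_deriv i a) x)) \<le> e * norm h" .
      qed
    qed
  next
    show "z \<in> S" using s by (simp add: S_def)
    then show "(\<lambda>n. a (\<kappa> n) * mon z (\<kappa> n)) sums ps_eval a z" by (rule sums_f)
  qed
  then obtain g where g: "\<And>x. x \<in> S \<Longrightarrow> (\<lambda>n. a (\<kappa> n) * mon x (\<kappa> n)) sums (g x)"
    "\<And>x. x \<in> S \<Longrightarrow> (g has_derivative (\<lambda>v. \<Sum>i\<in>UNIV. v $ i * ps_eval (ps_deriv i a) x)) (at x within S)"
    by blast
  have zS: "z \<in> S" "open S" using s open_polydisc by (auto simp: S_def)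
  have "(g has_derivative (\<lambda>v. \<Sum>i\<in>UNIV. v $ i * ps_eval (ps_deriv i a) z)) (at z)"
    using g(2)[OF zS(1)] unfolding at_within_open[OF zS] .
  then show ?thesis
    by (rule has_derivative_transform_within_open[OF _ zS(2,1)])
       (rule sums_unique2[OF g(1) sums_f])
qed

lemma holo_on_ps_eval:
  fixes a :: "('n::finite \<Rightarrow> nat) \<Rightarrow> complex"
  assumes "abs_conv a r"
  shows "holo_on (ps_eval a) (polydisc r)"
  unfolding holo_on_def
proof (intro conjI ballI open_polydisc exI)
  fix z :: "complex^'n" assume "z \<in> polydisc r"
  then show "(ps_eval a has_derivative (\<lambda>v. \<Sum>i\<in>UNIV. v $ i * ps_eval (ps_deriv i a) z)) (at z)"
    by (rule has_derivative_ps_eval[OF assms])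
qed (simp add: sum_distrib_left mult_ac)

section \<open>Products of power series\<close>

definition conv :: "(('n::finite \<Rightarrow> nat) \<Rightarrow> complex) \<Rightarrow> (('n \<Rightarrow> nat) \<Rightarrow> complex) \<Rightarrow> ('n \<Rightarrow> nat) \<Rightarrow> complex" where
  "conv a b K = (\<Sum>L | L \<le> K. a L * b (K - L))"

definition conv_one :: "('n::finite \<Rightarrow> nat) \<Rightarrow> complex" where
  "conv_one K = (if K = 0 then 1 else 0)"

text \<open>Powers of the tuple h are spelled as words, so that a product of at least two factors
  splits into its first factor and the rest; that splitting is where a division by a small divisor
  can be absorbed.\<close>

primrec conv_word :: "('n \<Rightarrow> ('n::finite \<Rightarrow> nat) \<Rightarrow> complex) \<Rightarrow> 'n list \<Rightarrow> ('n \<Rightarrow> nat) \<Rightarrow> complex" where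
  "conv_word h [] = conv_one"
| "conv_word h (i # is) = conv (h i) (conv_word h is)"

text \<open>Convolution is commutative, so any word containing each i exactly \<open>M i\<close>
  times would serve; the choice operator fixes one order of the coordinates for all M.\<close>

definition mi_word :: "('n::finite \<Rightarrow> nat) \<Rightarrow> 'n list" where
  "mi_word M = concat (map (\<lambda>i. replicate (M i) i) (SOME xs. set xs = UNIV \<and> distinct xs))"

text \<open>The bound s on the l1 norm with weight w, expressed by finite partial sums so that
  summability is part of the statement.\<close>

definition weighted_le :: "(('n::finite \<Rightarrow> nat) \<Rightarrow> real) \<Rightarrow> (('n \<Rightarrow> nat) \<Rightarrow> complex) \<Rightarrow> real \<Rightarrow> bool" where
  "weighted_le w a s \<longleftrightarrow> (\<forall>F. finite F \<longrightarrow> (\<Sum>K\<in>F. cmod (a K) * w K) \<le> s)"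

lemma mi_enum:
  obtains xs :: "'n::finite list" where "set xs = UNIV" "distinct xs"
    "\<And>M. mi_word M = concat (map (\<lambda>i. replicate (M i) i) xs)"
proof -
  have "\<exists>xs :: 'n list. set xs = UNIV \<and> distinct xs"
    using finite_distinct_list[of "UNIV :: 'n set"] by auto
  from someI_ex[OF this] that show ?thesis unfolding mi_word_def by blast
qed

lemma length_mi_word [simp]: "length (mi_word M) = mi_size M"
proof -
  obtain xs :: "'a list" where xs: "set xs = UNIV" "distinct xs"
    "mi_word M = concat (map (\<lambda>i. replicate (M i) i) xs)" using mi_enum by metis
  then show ?thesis
    using sum.distinct_set_conv_list[OF xs(2), of M] by (simp add: length_concat o_def mi_size_def)
qed

lemma prod_list_mi_word: "prod_list (map (\<lambda>i. x i) (mi_word M)) = (\<Prod>i\<in>UNIV. (x i :: complex) ^ M i)"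
proof -
  obtain xs :: "'a list" where xs: "set xs = UNIV" "distinct xs"
    "mi_word M = concat (map (\<lambda>i. replicate (M i) i) xs)" using mi_enum by metis
  have "prod_list (map x (concat (map (\<lambda>i. replicate (M i) i) ys))) = prod_list (map (\<lambda>i. x i ^ M i) ys)" for ys
    by (induction ys) (auto simp: prod_list_replicate)
  then show ?thesis
    using prod.distinct_set_conv_list[OF xs(2), of "\<lambda>i. x i ^ M i"] xs by simp
qed

lemma weighted_leD: "weighted_le w a s \<Longrightarrow> finite F \<Longrightarrow> (\<Sum>K\<in>F. cmod (a K) * w K) \<le> s"
  by (simp add: weighted_le_def)

lemma weighted_le_nonneg: "weighted_le w a s \<Longrightarrow> 0 \<le> s"
  using weighted_leD[of w a s "{}"] by simp

lemma weighted_le_imp_abs_conv: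
  assumes "weighted_le w a s" "0 \<le> r" "\<And>K. r ^ mi_size K \<le> w K"
  shows "abs_conv a r"
proof (rule abs_convI)
  fix F :: "('a \<Rightarrow> nat) set" assume "finite F"
  have "(\<Sum>K\<in>F. cmod (a K) * r ^ mi_size K) \<le> (\<Sum>K\<in>F. cmod (a K) * w K)"
    by (intro sum_mono mult_left_mono assms) auto
  also have "\<dots> \<le> s" by (rule weighted_leD) fact+
  finally show "(\<Sum>K\<in>F. cmod (a K) * r ^ mi_size K) \<le> s" .
qed fact

text \<open>The divisor \<open>d\<close> is \<open>1\<close> for plain products; a small divisor is absorbed by the weights.\<close>

lemma weighted_le_conv_div:
  assumes a: "weighted_le w a s" and b: "weighted_le w b t"
    and w: "\<And>K. 0 \<le> w K"
    and div: "\<And>L M. a L \<noteq> 0 \<Longrightarrow> b M \<noteq> 0 \<Longrightarrow> w (L + M) \<le> c * cmod (d (L + M)) * (w L * w M)"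
    and d: "\<And>K. d K = 0 \<Longrightarrow> conv a b K = 0" and "0 \<le> c"
  shows "weighted_le w (\<lambda>K. conv a b K / d K) (c * (s * t))"
  unfolding weighted_le_def
proof (intro allI impI)
  fix F :: "('a \<Rightarrow> nat) set" assume F: "finite F"
  define G where "G = (\<Union>K\<in>F. {L. L \<le> K})"
  have G: "finite G" using F by (auto simp: G_def finite_mi_le)
  have diff_le: "K - L \<le> K" for K L :: "'a \<Rightarrow> nat" by (simp add: le_fun_def)
  have "(\<Sum>K\<in>F. cmod (conv a b K / d K) * w K) \<le>
    (\<Sum>K\<in>F. \<Sum>L | L \<le> K. c * ((cmod (a L) * w L) * (cmod (b (K - L)) * w (K - L))))"
  proof (rule sum_mono)
    fix K
    show "cmod (conv a b K / d K) * w K \<le>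
       (\<Sum>L | L \<le> K. c * ((cmod (a L) * w L) * (cmod (b (K - L)) * w (K - L))))" (is "?l \<le> ?r")
    proof (cases "d K = 0")
      \<comment> \<open>Division by zero yields 0, so the left side vanishes and only the sign of
        the right side is at stake.\<close>
      case True
      have "0 \<le> ?r" using w \<open>0 \<le> c\<close> by (intro sum_nonneg) auto
      then show ?thesis using True by simp
    next
      case False
      have "cmod (conv a b K / d K) * w K \<le> (\<Sum>L | L \<le> K. cmod (a L * b (K - L))) / cmod (d K) * w K"
        unfolding conv_def norm_divide using w
        by (intro mult_right_mono divide_right_mono norm_sum) auto
      also have "\<dots> = (\<Sum>L | L \<le> K. cmod (a L) * cmod (b (K - L)) * (w K / cmod (d K)))"
        by (simp add: sum_distrib_right sum_divide_distrib norm_mult)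
      also have "\<dots> \<le> ?r"
      proof (rule sum_mono)
        fix L assume L: "L \<in> {L. L \<le> K}"
        show "cmod (a L) * cmod (b (K - L)) * (w K / cmod (d K)) \<le>
          c * ((cmod (a L) * w L) * (cmod (b (K - L)) * w (K - L)))"
        proof (cases "a L = 0 \<or> b (K - L) = 0")
          case False
          have LK: "L + (K - L) = K" using L by (metis add.commute mem_Collect_eq mi_le_diff_add)
          have "w K / cmod (d K) \<le> c * (w L * w (K - L))"
            using div[of L "K - L"] False \<open>d K \<noteq> 0\<close> unfolding LK
            by (simp add: field_simps)
          then have "cmod (a L) * cmod (b (K - L)) * (w K / cmod (d K)) \<le>
            cmod (a L) * cmod (b (K - L)) * (c * (w L * w (K - L)))"
            by (intro mult_left_mono) auto
          then show ?thesis by (simp add: mult_ac)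
        qed auto
      qed
      finally show ?thesis .
    qed
  qed
  also have "\<dots> = (\<Sum>(K, L)\<in>(SIGMA K:F. {L. L \<le> K}).
      c * ((cmod (a L) * w L) * (cmod (b (K - L)) * w (K - L))))"
    using F finite_mi_le by (subst sum.Sigma) auto
  \<comment> \<open>The pairs (L, K - L) are distinct and both entries lie below K, so the sum
    embeds into one over \<open>G \<times> G\<close>, where it factors.\<close>
  also have "\<dots> = (\<Sum>(L, M)\<in>(\<lambda>(K, L). (L, K - L)) ` (SIGMA K:F. {L. L \<le> K}).
      c * ((cmod (a L) * w L) * (cmod (b M) * w M)))"
  proof (subst sum.reindex)
    show "inj_on (\<lambda>(K, L). (L, K - L)) (SIGMA K:F. {L. L \<le> K})"
      by (rule inj_on_inverseI[where g = "\<lambda>(L, M). (M + L, L)"]) (auto simp: mi_le_diff_add)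
  qed (simp add: case_prod_unfold o_def)
  also have "\<dots> \<le> (\<Sum>(L, M)\<in>G \<times> G. c * ((cmod (a L) * w L) * (cmod (b M) * w M)))"
    using w \<open>0 \<le> c\<close> G diff_le by (intro sum_mono2) (auto simp: G_def)
  also have "\<dots> = (\<Sum>L\<in>G. \<Sum>M\<in>G. c * ((cmod (a L) * w L) * (cmod (b M) * w M)))"
    by (rule sum.cartesian_product[symmetric])
  also have "\<dots> = c * ((\<Sum>L\<in>G. cmod (a L) * w L) * (\<Sum>M\<in>G. cmod (b M) * w M))"
    by (subst sum_product) (simp only: sum_distrib_left)
  also have "\<dots> \<le> c * (s * t)"
    using G w weighted_le_nonneg[OF a] \<open>0 \<le> c\<close>
    by (intro mult_left_mono mult_mono weighted_leD a b sum_nonneg) auto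
  finally show "(\<Sum>K\<in>F. cmod (conv a b K / d K) * w K) \<le> c * (s * t)" .
qed

lemma weighted_le_conv:
  assumes "weighted_le w a s" "weighted_le w b t" "\<And>K. 0 \<le> w K"
    "\<And>L M. w (L + M) \<le> w L * w M"
  shows "weighted_le w (conv a b) (s * t)"
  using weighted_le_conv_div[OF assms(1,2,3), of 1 "\<lambda>_. 1"] assms(4) by simp

lemma weighted_le_conv_one:
  assumes "w 0 \<le> 1" "0 \<le> w 0"
  shows "weighted_le w conv_one 1"
  unfolding weighted_le_def
proof (intro allI impI)
  fix F :: "('a \<Rightarrow> nat) set" assume "finite F"
  have "(\<Sum>K\<in>F. cmod (conv_one K) * w K) = (\<Sum>K\<in>F. if K = 0 then w 0 else 0)"
    by (rule sum.cong) (auto simp: conv_one_def)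
  also have "\<dots> \<le> 1" using \<open>finite F\<close> assms by (simp add: sum.delta')
  finally show "(\<Sum>K\<in>F. cmod (conv_one K) * w K) \<le> 1" .
qed

lemma weighted_le_conv_word:
  assumes "\<And>i. weighted_le w (h i) s" "\<And>K. 0 \<le> w K" "w 0 \<le> 1" "\<And>L M. w (L + M) \<le> w L * w M"
  shows "weighted_le w (conv_word h is) (s ^ length is)"
  by (induction "is") (use assms in \<open>auto intro!: weighted_le_conv weighted_le_conv_one\<close>)

lemma abs_conv_imp_weighted_le:
  assumes "abs_conv a r" "0 \<le> r"
  obtains s where "weighted_le (\<lambda>K. r ^ mi_size K) a s"
proof
  show "weighted_le (\<lambda>K. r ^ mi_size K) a (\<Sum>\<^sub>\<infinity>K. cmod (a K) * r ^ mi_size K)"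
    unfolding weighted_le_def
    using assms finite_sum_le_infsum[of "\<lambda>K. cmod (a K) * r ^ mi_size K" UNIV] by (simp add: abs_conv_def)
qed

lemma abs_conv_conv:
  assumes "abs_conv a r" "abs_conv b r" "0 \<le> r"
  shows "abs_conv (conv a b) r"
proof -
  obtain s t where "weighted_le (\<lambda>K. r ^ mi_size K) a s" "weighted_le (\<lambda>K. r ^ mi_size K) b t"
    using abs_conv_imp_weighted_le assms by metis
  then have "weighted_le (\<lambda>K. r ^ mi_size K) (conv a b) (s * t)"
    by (rule weighted_le_conv) (use assms in \<open>auto simp: power_add\<close>)
  then show ?thesis by (rule weighted_le_imp_abs_conv) (use assms in auto)
qed

lemma abs_conv_conv_one: "0 \<le> r \<Longrightarrow> abs_conv conv_one r"
  by (rule weighted_le_imp_abs_conv[OF weighted_le_conv_one[of "\<lambda>K. r ^ mi_size K"]]) auto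

lemma ps_eval_conv_one: "ps_eval conv_one z = 1"
proof -
  have "ps_eval conv_one z = (\<Sum>\<^sub>\<infinity>K\<in>{0}. 1 * mon z K)"
    unfolding ps_eval_def by (rule infsum_cong_neutral) (auto simp: conv_one_def)
  then show ?thesis by simp
qed

text \<open>The double series over (L, M) is absolutely summable. Summed by rows it is the product
  of the values; summed over L + M = K it is the series of the convolution.\<close>

lemma ps_eval_conv:
  assumes a: "abs_conv a r" and b: "abs_conv b r" and z: "z \<in> cpolydisc r"
  shows "ps_eval (conv a b) z = ps_eval a z * ps_eval b z"
proof -
  define f where "f L M = (a L * mon z L) * (b M * mon z M)" for L M
  note sa = abs_conv_summable[OF a z] and sb = abs_conv_summable[OF b z]
  have "(\<lambda>x. norm (case x of (L, M) \<Rightarrow> f L M)) summable_on UNIV \<times> UNIV"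
  proof (rule Infinite_Sum.abs_summable_on_Sigma_iff[THEN iffD2], intro conjI ballI)
    fix L
    show "(\<lambda>M. norm (case (L, M) of (L, M) \<Rightarrow> f L M)) summable_on UNIV"
      unfolding f_def using summable_on_cmult_right[OF sb, of "norm (a L * mon z L)"]
      by (simp add: norm_mult mult_ac)
  next
    have "infsum (\<lambda>M. norm (f L M)) UNIV = norm (a L * mon z L) * infsum (\<lambda>M. norm (b M * mon z M)) UNIV" for L
      unfolding f_def norm_mult[of "a L * mon z L"] using sb by (intro infsum_cmult_right) auto
    then show "(\<lambda>L. norm (\<Sum>\<^sub>\<infinity>M. norm (case (L, M) of (L, M) \<Rightarrow> f L M))) summable_on UNIV"
      using summable_on_cmult_left[OF sa, of "infsum (\<lambda>M. norm (b M * mon z M)) UNIV"]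
      by (simp add: infsum_nonneg)
  qed
  then obtain S where S: "((\<lambda>(L, M). f L M) has_sum S) (UNIV \<times> UNIV)"
    by (rule that[OF has_sum_infsum[OF abs_summable_summable]])
  have "((\<lambda>L. (a L * mon z L) * ps_eval b z) has_sum S) UNIV"
    by (rule has_sum_SigmaD[OF S]) (simp add: f_def has_sum_cmult_right abs_conv_has_sum[OF b z])
  moreover have "((\<lambda>L. (a L * mon z L) * ps_eval b z) has_sum (ps_eval a z * ps_eval b z)) UNIV"
    by (intro has_sum_cmult_left abs_conv_has_sum[OF a z])
  ultimately have S_eq: "S = ps_eval a z * ps_eval b z" by (rule has_sum_unique)
  have "((\<lambda>(K, L). f L (K - L)) has_sum S) (SIGMA K:UNIV. {L. L \<le> K})"
    using S
    by (rule has_sum_reindex_bij_witness[of _ "\<lambda>(L, M). (M + L, L)" "\<lambda>(K, L). (L, K - L)", THEN iffD2, rotated -1])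
       (auto simp: mi_le_diff_add le_fun_def)
  then have "((\<lambda>K. conv a b K * mon z K) has_sum S) UNIV"
  proof (rule has_sum_SigmaD)
    fix K
    have "(\<Sum>L | L \<le> K. f L (K - L)) = conv a b K * mon z K"
      unfolding conv_def sum_distrib_right f_def
    proof (rule sum.cong)
      fix L assume "L \<in> {L. L \<le> K}"
      then have "mon z K = mon z (K - L) * mon z L"
        by (metis mem_Collect_eq mi_le_diff_add mon_add)
      then show "a L * mon z L * (b (K - L) * mon z (K - L)) = a L * b (K - L) * mon z K" by simp
    qed simp
    then show "((\<lambda>L. case (K, L) of (K, L) \<Rightarrow> f L (K - L)) has_sum conv a b K * mon z K) {L. L \<le> K}"
      using finite_mi_le by (intro has_sum_finiteI) auto
  qed
  then show ?thesis unfolding S_eq[symmetric] ps_eval_def[of "conv a b"] by (rule infsumI)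
qed

lemma conv_word_abs_conv:
  assumes "\<And>i. abs_conv (h i) r" "0 \<le> r"
  shows "abs_conv (conv_word h is) r"
  by (induction "is") (use assms in \<open>auto intro!: abs_conv_conv abs_conv_conv_one\<close>)

lemma ps_eval_conv_word:
  assumes "\<And>i. abs_conv (h i) r" "0 \<le> r" "z \<in> cpolydisc r"
  shows "ps_eval (conv_word h is) z = prod_list (map (\<lambda>i. ps_eval (h i) z) is)"
  by (induction "is")
     (use assms in \<open>auto simp: ps_eval_conv_one ps_eval_conv[OF assms(1) conv_word_abs_conv[OF assms(1,2)] assms(3)]\<close>)

section \<open>Products of series without constant term: order of vanishing and
  triangularity\<close>

lemma conv_cong_le:
  assumes "\<And>L. L \<le> K \<Longrightarrow> a L = a' L" "\<And>L. L \<le> K \<Longrightarrow> b L = b' L"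
  shows "conv a b K = conv a' b' K"
  unfolding conv_def by (rule sum.cong) (auto intro!: arg_cong2[where f = "(*)"] assms simp: le_fun_def)

text \<open>Each factor without constant term raises the order of the product by at least
  one.\<close>

lemma conv_word_eq_0:
  assumes "\<And>i. h i 0 = 0" "mi_size K < length is"
  shows "conv_word h is K = 0"
  using assms(2)
proof (induction "is" arbitrary: K)
  case (Cons i "is")
  have "h i L * conv_word h is (K - L) = 0" if L: "L \<le> K" for L
  proof (cases "L = 0")
    case False
    then have "mi_size L > 0" by (metis gr0I mi_size_eq_0_iff)
    then have "mi_size (K - L) < length is"
      using Cons.prems mi_size_diff[OF L] mi_size_mono[OF L] by (simp add: less_Suc_eq_le)
    then have "conv_word h is (K - L) = 0" by (rule Cons.IH)
    then show ?thesis by simp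
  qed (use assms in simp)
  then show ?case unfolding conv_word.simps conv_def by (intro sum.neutral ballI) blast
qed simp

lemma conv_word_cong_le:
  assumes "\<And>i L. L \<le> K \<Longrightarrow> h i L = h' i L"
  shows "conv_word h is K = conv_word h' is K"
  using assms
proof (induction "is" arbitrary: K)
  case (Cons i "is")
  show ?case unfolding conv_word.simps
  proof (rule conv_cong_le[OF Cons.prems])
    fix L assume "L \<le> K"
    then show "conv_word h is L = conv_word h' is L"
      by (intro Cons.IH Cons.prems) (erule order_trans)
  qed
qed simp

text \<open>If one of at least two factors used its coefficient of full degree |K|, the others would
  have to use their constant terms, which vanish. This makes the recursion for the linearizing
  series triangular in the degree.\<close>

lemma conv_word_cong_less:
  assumes h: "\<And>i L. mi_size L < mi_size K \<Longrightarrow> h i L = h' i L" "\<And>i. h i 0 = 0" "\<And>i. h' i 0 = 0"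
    and len: "length is \<ge> 2"
  shows "conv_word h is K = conv_word h' is K"
proof -
  obtain i js where "is": "is = i # js" "js \<noteq> []" using len by (cases "is"; cases "tl is") auto
  have "h i L * conv_word h js (K - L) = h' i L * conv_word h' js (K - L)" if L: "L \<le> K" for L
  proof (cases "L = 0 \<or> L = K")
    case True
    have "length js > 0" using "is" by simp
    then show ?thesis
      using True conv_word_eq_0[of h "0" js] conv_word_eq_0[of h' "0" js] h by auto
  next
    case False
    have ne: "K - L \<noteq> 0" using False mi_le_diff_add[OF L] by auto
    have sz: "mi_size K = mi_size (K - L) + mi_size L" by (metis L mi_le_diff_add mi_size_add)
    have "mi_size L < mi_size K" "mi_size (K - L) < mi_size K"
      using sz ne False mi_size_eq_0_iff[of "K - L"] mi_size_eq_0_iff[of L] by linarith+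
    moreover have "conv_word h js (K - L) = conv_word h' js (K - L)"
      using calculation by (intro conv_word_cong_le h(1)) (meson mi_size_mono le_less_trans)
    ultimately show ?thesis using h(1) by simp
  qed
  then show ?thesis unfolding "is" conv_word.simps conv_def by (intro sum.cong) auto
qed

section \<open>Brjuno's estimate of products of small divisors\<close>

text \<open>The products that occur are indexed by trees with arbitrary branching. Splitting a node into
  binary ones only adds to the count of nodes satisfying \<open>P\<close>, so binary trees suffice.\<close>

inductive divisor_tree :: "(('n \<Rightarrow> nat) \<Rightarrow> bool) \<Rightarrow> ('n \<Rightarrow> nat) \<Rightarrow> nat \<Rightarrow> bool" for P where
  leaf: "divisor_tree P K (of_bool (P K))"
| node: "divisor_tree P L a \<Longrightarrow> divisor_tree P M b \<Longrightarrow> L \<noteq> 0 \<Longrightarrow> M \<noteq> 0 \<Longrightarrow>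
    divisor_tree P (L + M) (a + b + of_bool (P (L + M)))"

text \<open>The maximum over all trees makes the count superadditive by construction: optimal trees
  for L and M are grafted onto a new root.\<close>

definition divisor_count :: "(('n \<Rightarrow> nat) \<Rightarrow> bool) \<Rightarrow> ('n \<Rightarrow> nat) \<Rightarrow> nat" where
  "divisor_count P K = Max {a. divisor_tree P K a}"

text \<open>The third clause strengthens the induction: below a node \<open>K'\<close> that satisfies \<open>P\<close>, the node
  \<open>K'\<close> can be counted in addition.\<close>

lemma divisor_tree_bound:
  fixes P :: "('n::finite \<Rightarrow> nat) \<Rightarrow> bool"
  assumes big: "\<And>K. P K \<Longrightarrow> m < mi_size K"
    and gap: "\<And>K L. P K \<Longrightarrow> P L \<Longrightarrow> L \<le> K \<Longrightarrow> L \<noteq> K \<Longrightarrow> mi_size L + m \<le> mi_size K"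
    and "divisor_tree P K a"
  shows "(mi_size K \<le> m \<longrightarrow> a = 0) \<and> (m < mi_size K \<longrightarrow> m * (a + 1) \<le> 2 * mi_size K) \<and>
    (\<forall>K'. P K' \<and> K \<le> K' \<and> K \<noteq> K' \<longrightarrow> m * (a + 2) \<le> 2 * mi_size K')"
  using assms(3)
proof induction
  case (leaf K)
  show ?case
  proof (cases "P K")
    case True
    have "m * 3 \<le> 2 * mi_size K'" if "P K'" "K \<le> K'" "K \<noteq> K'" for K'
      using gap[OF that(1) True that(2,3)] big[OF True] by simp
    then show ?thesis using big[OF True] True by (auto simp: numeral_3_eq_3)
  next
    case False
    have "m + m \<le> 2 * mi_size K'" if "P K'" for K' using big[OF that] by simp
    then show ?thesis using False by auto
  qed
next
  case (node L a M b)
  let ?K = "L + M"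
  have pos: "mi_size L > 0" "mi_size M > 0"
    using node.hyps by (metis gr0I mi_size_eq_0_iff)+
  have le: "L \<le> ?K" "M \<le> ?K" by (auto simp: le_fun_def)
  have ne: "L \<noteq> ?K" "M \<noteq> ?K" using node.hyps by auto
  \<comment> \<open>K' may be the root itself. With K' = L + M this bounds the count when P holds at
    the root; with larger K' it is the third clause when P fails there.\<close>
  have both: "m * (a + b + 2) \<le> 2 * mi_size K'" if K': "P K'" "?K \<le> K'" for K'
  proof -
    have K'm: "m < mi_size K'" using big K' by blast
    have szK: "mi_size L + mi_size M \<le> mi_size K'" using mi_size_mono[OF K'(2)] by simp
    have leL: "L \<le> K'" "L \<noteq> K'" and leM: "M \<le> K'" "M \<noteq> K'"
      using le K'(2) ne by (auto dest: order_antisym)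
    \<comment> \<open>A child of size at most m counts nothing. A single larger child is covered by
      the third clause for that child; for two larger children the spare units of the second clause
      add up to the required 2.\<close>
    consider "mi_size L \<le> m" "mi_size M \<le> m" | "mi_size L \<le> m" "m < mi_size M"
      | "m < mi_size L" "mi_size M \<le> m" | "m < mi_size L" "m < mi_size M" by linarith
    then show ?thesis
    proof cases
      case 1
      then have "a = 0" "b = 0" using node.IH by auto
      then show ?thesis using K'm by simp
    next
      case 2
      then have "a = 0" "m * (b + 2) \<le> 2 * mi_size K'" using node.IH leM K' by auto
      then show ?thesis by simp
    next
      case 3
      then have "b = 0" "m * (a + 2) \<le> 2 * mi_size K'" using node.IH leL K' by auto
      then show ?thesis by simp
    next
      case 4
      then have "m * (a + 1) \<le> 2 * mi_size L" "m * (b + 1) \<le> 2 * mi_size M" using node.IH by auto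
      then have "m * (a + 1) + m * (b + 1) \<le> 2 * mi_size K'" using szK by linarith
      then show ?thesis by (simp add: algebra_simps)
    qed
  qed
  have "(mi_size ?K \<le> m \<longrightarrow> a + b + of_bool (P ?K) = 0) \<and>
    (m < mi_size ?K \<longrightarrow> m * (a + b + of_bool (P ?K) + 1) \<le> 2 * mi_size ?K) \<and>
    (\<forall>K'. P K' \<and> ?K \<le> K' \<and> ?K \<noteq> K' \<longrightarrow> m * (a + b + of_bool (P ?K) + 2) \<le> 2 * mi_size K')"
  proof (cases "P ?K")
    case True
    have "m * (a + b + 3) \<le> 2 * mi_size K'" if "P K'" "?K \<le> K'" "?K \<noteq> K'" for K'
    proof -
      have "m * (a + b + 3) = m * (a + b + 2) + m" by (simp add: algebra_simps)
      also have "\<dots> \<le> 2 * mi_size ?K + 2 * m" using both[OF True] by simp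
      also have "\<dots> \<le> 2 * mi_size K'" using gap[OF that(1) True that(2,3)] by simp
      finally show ?thesis .
    qed
    then show ?thesis using both[OF True] big[OF True] True by (simp add: numeral_3_eq_3)
  next
    case False
    have "m * (a + b + 1) \<le> 2 * mi_size ?K" if "m < mi_size ?K"
    proof -
      consider "mi_size L \<le> m" "mi_size M \<le> m" | "mi_size L \<le> m" "m < mi_size M"
        | "m < mi_size L" "mi_size M \<le> m" | "m < mi_size L" "m < mi_size M" by linarith
      then show ?thesis
      proof cases
        case 1
        then have "a = 0" "b = 0" using node.IH by auto
        then show ?thesis using that by simp
      next
        case 2
        then have "a = 0" "m * (b + 1) \<le> 2 * mi_size M" using node.IH by auto
        then show ?thesis by simp
      next
        case 3
        then have "b = 0" "m * (a + 1) \<le> 2 * mi_size L" using node.IH by auto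
        then show ?thesis by simp
      next
        case 4
        then have "m * (a + 1) \<le> 2 * mi_size L" "m * (b + 1) \<le> 2 * mi_size M" using node.IH by auto
        then show ?thesis by (simp add: algebra_simps)
      qed
    qed
    moreover have "a + b = 0" if "mi_size ?K \<le> m" using that pos node.IH by simp
    ultimately show ?thesis using False both by simp
  qed
  moreover have "(\<lambda>i. L i + M i) = ?K" by (simp add: fun_eq_iff)
  ultimately show ?case by (simp only:)
qed

lemma divisor_count:
  fixes P :: "('n::finite \<Rightarrow> nat) \<Rightarrow> bool"
  assumes big: "\<And>K. P K \<Longrightarrow> m < mi_size K"
    and gap: "\<And>K L. P K \<Longrightarrow> P L \<Longrightarrow> L \<le> K \<Longrightarrow> L \<noteq> K \<Longrightarrow> mi_size L + m \<le> mi_size K"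
    and "m > 0"
  shows "mi_size K \<le> m \<Longrightarrow> divisor_count P K = 0"
    and "m * divisor_count P K \<le> 2 * mi_size K"
    and "L \<noteq> 0 \<Longrightarrow> M \<noteq> 0 \<Longrightarrow>
      divisor_count P L + divisor_count P M + of_bool (P (L + M)) \<le> divisor_count P (L + M)"
proof -
  have bound: "(mi_size K \<le> m \<longrightarrow> a = 0) \<and> (m < mi_size K \<longrightarrow> m * (a + 1) \<le> 2 * mi_size K)"
    if "divisor_tree P K a" for K a
    using divisor_tree_bound[of P m K a] big gap that by blast
  have bound': "m * a \<le> 2 * mi_size K" if "divisor_tree P K a" for K a
    using bound[OF that] by (cases "mi_size K \<le> m") auto
  have fin: "finite {a. divisor_tree P K a}" for K
  proof (rule finite_subset)
    show "{a. divisor_tree P K a} \<subseteq> {..2 * mi_size K}"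
    proof
      fix a assume "a \<in> {a. divisor_tree P K a}"
      then have "m * a \<le> 2 * mi_size K" using bound' by simp
      moreover have "a \<le> m * a" using \<open>m > 0\<close> by simp
      ultimately have "a \<le> 2 * mi_size K" by linarith
      then show "a \<in> {..2 * mi_size K}" by simp
    qed
  qed simp
  have tree: "divisor_tree P K (divisor_count P K)" for K
  proof -
    have "divisor_count P K \<in> {a. divisor_tree P K a}"
      unfolding divisor_count_def using divisor_tree.leaf by (intro Max_in fin) blast
    then show ?thesis by simp
  qed
  show "mi_size K \<le> m \<Longrightarrow> divisor_count P K = 0" using bound[OF tree] by simp
  show "m * divisor_count P K \<le> 2 * mi_size K" by (rule bound'[OF tree])
  show "divisor_count P L + divisor_count P M + of_bool (P (L + M)) \<le> divisor_count P (L + M)"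
    if "L \<noteq> 0" "M \<noteq> 0"
    unfolding divisor_count_def[of P "L + M"]
    by (rule Max_ge[OF fin]) (use divisor_tree.node[OF tree tree that] in simp)
qed

section \<open>The function \<open>omega\<close> and the small divisors at scale \<nu>\<close>

lemma finite_divisors:
  "finite {cmod (mi_pair K lam - lam $ j) |K (j::'n::finite). 2 \<le> mi_size K \<and> mi_size K \<le> m}"
proof (rule finite_subset)
  show "{cmod (mi_pair K lam - lam $ j) |K j. 2 \<le> mi_size K \<and> mi_size K \<le> m} \<subseteq>
    (\<lambda>(K, j). cmod (mi_pair K lam - lam $ j)) ` ({K. mi_size K \<le> m} \<times> UNIV)" by auto
qed (intro finite_imageI finite_cartesian_product finite_mi_size_le finite)

lemma omega_le: "2 \<le> mi_size K \<Longrightarrow> mi_size K \<le> m \<Longrightarrow> omega lam m \<le> cmod (mi_pair K lam - lam $ j)"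
  unfolding omega_def using finite_divisors by (intro Min_le) blast+

lemma mi_size_two: "mi_size (mi_unit i + mi_unit (i::'n::finite)) = 2"
  by (simp del: One_nat_def)

lemma omega_pos:
  assumes "nonresonant (lam :: complex^'n::finite)" "m \<ge> 2"
  shows "omega lam m > 0"
proof -
  let ?S = "{cmod (mi_pair K lam - lam $ j) |K j. 2 \<le> mi_size K \<and> mi_size K \<le> m}"
  have "?S \<noteq> {}" using mi_size_two assms(2) by (auto intro!: exI[of _ "mi_unit undefined + mi_unit undefined"])
  moreover have "\<forall>x\<in>?S. 0 < x" using assms(1) unfolding nonresonant_def by clarsimp metis
  ultimately show ?thesis unfolding omega_def using finite_divisors by (subst Min_gr_iff) auto
qed

lemma omega_antimono:
  assumes "2 \<le> k" "k \<le> m"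
  shows "omega (lam :: complex^'n::finite) m \<le> omega lam k"
  unfolding omega_def
proof (rule Min_antimono)
  show "{cmod (mi_pair K lam - lam $ j) |K j. 2 \<le> mi_size K \<and> mi_size K \<le> k} \<noteq> {}"
    using mi_size_two assms(1) by (auto intro!: exI[of _ "mi_unit undefined + mi_unit undefined"])
qed (use finite_divisors assms in auto)

text \<open>The factor 1/2 makes the difference of two such divisors fall below
  \<open>omega\<close>, the contradiction behind the gap property. Quantifying over j inside lets
  the two divisors belong to different components.\<close>

definition small_divisor :: "complex^'n::finite \<Rightarrow> nat \<Rightarrow> ('n \<Rightarrow> nat) \<Rightarrow> bool" where
  "small_divisor lam \<nu> K \<longleftrightarrow> 2 \<le> mi_size K \<and> (\<exists>j. cmod (mi_pair K lam - lam $ j) < omega lam (2 ^ (\<nu> + 1)) / 2)"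

lemma small_divisor_big:
  assumes "nonresonant lam" "small_divisor lam \<nu> K"
  shows "2 ^ (\<nu> + 1) < mi_size K"
proof (rule ccontr)
  assume *: "\<not> 2 ^ (\<nu> + 1) < mi_size K"
  obtain j where "cmod (mi_pair K lam - lam $ j) < omega lam (2 ^ (\<nu> + 1)) / 2" "2 \<le> mi_size K"
    using assms(2) by (auto simp: small_divisor_def)
  moreover have "omega lam (2 ^ (\<nu> + 1)) \<le> cmod (mi_pair K lam - lam $ j)"
    using * calculation by (intro omega_le) auto
  moreover have "omega lam (2 ^ (\<nu> + 1)) > 0" by (rule omega_pos[OF assms(1)]) simp
  ultimately show False by linarith
qed

text \<open>The difference of two small divisors is itself a divisor, of index \<open>K - L + e\<^sub>i\<close>.\<close>

lemma small_divisor_gap: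
  assumes "small_divisor lam \<nu> K" "small_divisor lam \<nu> L" "L \<le> K" "L \<noteq> K"
  shows "mi_size L + 2 ^ (\<nu> + 1) \<le> mi_size K"
proof (rule ccontr)
  assume *: "\<not> mi_size L + 2 ^ (\<nu> + 1) \<le> mi_size K"
  obtain j where j: "cmod (mi_pair K lam - lam $ j) < omega lam (2 ^ (\<nu> + 1)) / 2"
    using assms by (auto simp: small_divisor_def)
  obtain i where i: "cmod (mi_pair L lam - lam $ i) < omega lam (2 ^ (\<nu> + 1)) / 2"
    using assms by (auto simp: small_divisor_def)
  define D where "D = K - L"
  have K: "K = D + L" using mi_le_diff_add[OF assms(3)] by (simp add: D_def)
  have "D \<noteq> 0" using assms(4) K by auto
  then have "mi_size D > 0" by (metis gr0I mi_size_eq_0_iff)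
  \<comment> \<open>Here 0 < |D| < \<open>2 ^ (\<nu> + 1)\<close>, so D plus a unit has size at
    least 2 and at most \<open>2 ^ (\<nu> + 1)\<close>, just inside the range of
    \<open>omega\<close>.\<close>
  then have "omega lam (2 ^ (\<nu> + 1)) \<le> cmod (mi_pair (D + mi_unit i) lam - lam $ j)"
    using * K by (intro omega_le) auto
  also have "mi_pair (D + mi_unit i) lam - lam $ j =
     (mi_pair K lam - lam $ j) - (mi_pair L lam - lam $ i)" by (simp add: K)
  also have "cmod \<dots> \<le> cmod (mi_pair K lam - lam $ j) + cmod (mi_pair L lam - lam $ i)"
    by (rule norm_triangle_ineq4)
  finally show False using i j by linarith
qed

text \<open>The price of scale \<nu>: an index that is small at scale \<nu> but not at \<nu> + 1 has
  divisor at least half of \<open>omega\<close> at \<open>2 ^ (\<nu> + 2)\<close>, so exp of this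
  coefficient exceeds the inverse divisor. The truncation at 0 keeps all contributions to A
  nonnegative.\<close>

definition brjuno_coeff :: "complex^'n::finite \<Rightarrow> nat \<Rightarrow> real" where
  "brjuno_coeff lam \<nu> = max 0 (ln (2 / omega lam (2 ^ (\<nu> + 2))))"

lemma summable_brjuno_coeff:
  assumes "nonresonant lam" "brjuno_sum_finite (omega lam)"
  shows "summable (\<lambda>\<nu>. brjuno_coeff lam \<nu> * (1/2) ^ \<nu>)"
proof -
  \<comment> \<open>As \<open>omega\<close> is nonincreasing, l dominates every ln
    \<open>omega\<close> from 2 on. Adding it keeps the majorant nonnegative where the coefficient
    is truncated at 0.\<close>
  define l where "l = \<bar>ln (omega lam 2)\<bar>"
  define x where "x \<nu> = - ((1/2) ^ \<nu> * ln (omega lam (2 ^ (\<nu> + 1))))" for \<nu> :: nat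
  have "summable x" using assms(2) unfolding brjuno_sum_finite_def x_def .
  then have "summable (\<lambda>\<nu>. x (Suc \<nu>))" by (simp only: summable_Suc_iff)
  moreover have "summable (\<lambda>\<nu>. (ln 2 + l) * (1/2) ^ \<nu>)"
    by (rule summable_mult[OF summable_geometric]) simp
  ultimately have "summable (\<lambda>\<nu>. 2 * x (Suc \<nu>) + (ln 2 + l) * (1/2) ^ \<nu>)"
    by (rule summable_add[OF summable_mult])
  then show ?thesis
  proof (rule summable_comparison_test'[where N = 0])
    fix \<nu> :: nat
    let ?w = "omega lam (2 ^ (\<nu> + 2))"
    have w: "0 < ?w" "0 < omega lam 2" by (rule omega_pos[OF assms(1)], simp)+
    have "(2::nat) \<le> 2 ^ (\<nu> + 2)" by simp
    then have "ln ?w \<le> ln (omega lam 2)" using w omega_antimono[of 2 "2 ^ (\<nu> + 2)" lam] by simp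
    then have "ln ?w \<le> l" by (simp add: l_def)
    moreover have "0 \<le> l" "0 \<le> ln (2::real)" by (simp_all add: l_def)
    moreover have "ln (2 / ?w) = ln 2 - ln ?w" using w by (simp add: ln_div)
    ultimately have "brjuno_coeff lam \<nu> \<le> - ln ?w + (ln 2 + l)"
      unfolding brjuno_coeff_def by linarith
    then have "brjuno_coeff lam \<nu> * (1/2) ^ \<nu> \<le> (- ln ?w + (ln 2 + l)) * (1/2) ^ \<nu>"
      by (intro mult_right_mono) auto
    also have "\<dots> = 2 * x (Suc \<nu>) + (ln 2 + l) * (1/2) ^ \<nu>"
      by (simp add: x_def field_simps)
    finally show "norm (brjuno_coeff lam \<nu> * (1/2) ^ \<nu>) \<le> 2 * x (Suc \<nu>) + (ln 2 + l) * (1/2) ^ \<nu>"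
      by (simp add: brjuno_coeff_def)
  qed
qed

text \<open>A adds up, over all scales, the price of the scale times the maximal number of small
  divisors there. That number is at most |K| / 2^\<nu>, so the Brjuno sum makes A linear in |K|.
  Superadditivity comes from the counts, with a surplus whenever the index L + M is itself small;
  that surplus pays for the divisor.\<close>

theorem brjuno_weight:
  fixes lam :: "complex^'n::finite"
  assumes nonres: "nonresonant lam" and brj: "brjuno_sum_finite (omega lam)"
  obtains A :: "('n \<Rightarrow> nat) \<Rightarrow> real" and B c :: real where
    "c > 0" "A 0 = 0" "\<And>i. A (mi_unit i) = 0" "\<And>K. A K \<le> B * mi_size K"
    "\<And>L M. A L + A M \<le> A (L + M)"
    "\<And>L M j. L \<noteq> 0 \<Longrightarrow> M \<noteq> 0 \<Longrightarrow>
       exp (A L + A M) \<le> c * cmod (mi_pair (L + M) lam - lam $ j) * exp (A (L + M))"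
proof -
  define T where "T \<nu> K = divisor_count (small_divisor lam \<nu>) K" for \<nu> K
  define a where "a = brjuno_coeff lam"
  define A where "A K = (\<Sum>\<nu>. a \<nu> * real (T \<nu> K))" for K
  define B where "B = (\<Sum>\<nu>. a \<nu> * (1/2) ^ \<nu>)"
  \<comment> \<open>The value 2 / \<open>omega lam 2\<close> handles indices that are not small even
    at scale 0; being at least 1, c may be inserted for all others.\<close>
  define c where "c = max 1 (2 / omega lam 2)"
  have a0: "a \<nu> \<ge> 0" for \<nu> by (simp add: a_def brjuno_coeff_def)
  have sum_a: "summable (\<lambda>\<nu>. a \<nu> * (1/2) ^ \<nu>)"
    using summable_brjuno_coeff[OF assms] by (simp add: a_def)
  have count0: "T \<nu> K = 0" if "mi_size K \<le> 2 ^ (\<nu> + 1)" for \<nu> K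
    unfolding T_def
    by (rule divisor_count(1)[of _ "2 ^ (\<nu> + 1)", OF small_divisor_big[OF nonres] small_divisor_gap _ that]) simp_all
  have count_le: "2 ^ (\<nu> + 1) * T \<nu> K \<le> 2 * mi_size K" for \<nu> K
    unfolding T_def
    by (rule divisor_count(2)[of _ "2 ^ (\<nu> + 1)", OF small_divisor_big[OF nonres] small_divisor_gap]) simp_all
  have count_super: "T \<nu> L + T \<nu> M + of_bool (small_divisor lam \<nu> (L + M)) \<le> T \<nu> (L + M)"
    if "L \<noteq> 0" "M \<noteq> 0" for \<nu> L M
    unfolding T_def
    by (rule divisor_count(3)[of _ "2 ^ (\<nu> + 1)", OF small_divisor_big[OF nonres] small_divisor_gap _ that]) simp_all
  have T_le: "a \<nu> * real (T \<nu> K) \<le> real (mi_size K) * (a \<nu> * (1/2) ^ \<nu>)" for \<nu> K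
  proof -
    have "2 * 2 ^ \<nu> * T \<nu> K \<le> 2 * mi_size K" using count_le[of \<nu> K] by simp
    then have "2 ^ \<nu> * T \<nu> K \<le> mi_size K" by simp
    then have "2 ^ \<nu> * real (T \<nu> K) \<le> real (mi_size K)"
      by (metis of_nat_le_iff of_nat_mult of_nat_numeral of_nat_power)
    then have "real (T \<nu> K) \<le> real (mi_size K) * (1/2) ^ \<nu>" by (simp add: field_simps power_divide)
    from mult_left_mono[OF this a0[of \<nu>]] show ?thesis by (simp add: mult_ac)
  qed
  have sum_T: "summable (\<lambda>\<nu>. a \<nu> * real (T \<nu> K))" for K
    by (rule summable_comparison_test'[OF summable_mult[OF sum_a, of "real (mi_size K)"], of 0])
       (use T_le a0 in auto)
  have A_zero: "A K = 0" if "mi_size K \<le> 1" for K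
  proof -
    have "T \<nu> K = 0" for \<nu> by (rule count0[OF order_trans[OF that]]) simp
    then show ?thesis by (simp add: A_def)
  qed
  have sum_S: "summable (\<lambda>\<nu>. a \<nu> * of_bool (small_divisor lam \<nu> K))" for K
  proof (rule summable_finite[of "{..mi_size K}"])
    fix \<nu> assume "\<nu> \<notin> {..mi_size K}"
    then have "mi_size K < 2 ^ (\<nu> + 1)" using less_exp[of "\<nu> + 1"] by simp
    then show "a \<nu> * of_bool (small_divisor lam \<nu> K) = 0"
      using small_divisor_big[OF nonres, of \<nu> K] by auto
  qed simp
  have super: "A L + A M + (\<Sum>\<nu>. a \<nu> * of_bool (small_divisor lam \<nu> (L + M))) \<le> A (L + M)"
    if "L \<noteq> 0" "M \<noteq> 0" for L M
  proof -
    have "A L + A M + (\<Sum>\<nu>. a \<nu> * of_bool (small_divisor lam \<nu> (L + M)))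
      = (\<Sum>\<nu>. a \<nu> * real (T \<nu> L) + a \<nu> * real (T \<nu> M) + a \<nu> * of_bool (small_divisor lam \<nu> (L + M)))"
      unfolding A_def by (simp add: suminf_add sum_T sum_S summable_add)
    also have "\<dots> \<le> (\<Sum>\<nu>. a \<nu> * real (T \<nu> (L + M)))"
    proof (rule suminf_le)
      fix \<nu>
      have "T \<nu> L + T \<nu> M + of_bool (small_divisor lam \<nu> (L + M)) \<le> T \<nu> (L + M)"
        by (rule count_super[OF that])
      then have "real (T \<nu> L) + real (T \<nu> M) + of_bool (small_divisor lam \<nu> (L + M)) \<le> real (T \<nu> (L + M))"
        by (metis of_nat_add of_nat_le_iff of_nat_of_bool)
      from mult_left_mono[OF this a0[of \<nu>]]
      show "a \<nu> * real (T \<nu> L) + a \<nu> * real (T \<nu> M) + a \<nu> * of_bool (small_divisor lam \<nu> (L + M))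
        \<le> a \<nu> * real (T \<nu> (L + M))" by (simp add: distrib_left)
    qed (intro summable_add sum_T sum_S)+
    finally show ?thesis by (simp add: A_def)
  qed
  have div: "1 \<le> c * cmod (mi_pair K lam - lam $ j) * exp (\<Sum>\<nu>. a \<nu> * of_bool (small_divisor lam \<nu> K))"
    if K: "2 \<le> mi_size K" for K j
  proof -
    let ?s = "\<Sum>\<nu>. a \<nu> * of_bool (small_divisor lam \<nu> K)"
    let ?e = "cmod (mi_pair K lam - lam $ j)"
    have c1: "1 \<le> c" by (simp add: c_def)
    have s0: "0 \<le> ?s" by (rule suminf_nonneg[OF sum_S]) (use a0 in auto)
    have "\<exists>\<nu>. \<not> small_divisor lam \<nu> K"
      using small_divisor_big[OF nonres, of "mi_size K" K] less_exp[of "mi_size K + 1"] by force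
    \<comment> \<open>The first scale at which K is no longer small: failing there bounds the
      divisor from below, and being small one scale earlier puts the matching price into the
      exponent.\<close>
    define \<nu> where "\<nu> = (LEAST \<nu>. \<not> small_divisor lam \<nu> K)"
    have n1: "\<not> small_divisor lam \<nu> K" unfolding \<nu>_def by (rule LeastI_ex) fact
    have e: "omega lam (2 ^ (\<nu> + 1)) / 2 \<le> ?e" using n1 K by (auto simp: small_divisor_def not_less)
    have w: "omega lam (2 ^ (\<nu> + 1)) > 0" by (rule omega_pos[OF nonres]) simp
    show ?thesis
    proof (cases \<nu>)
      case 0
      then have two: "(2::nat) ^ (\<nu> + 1) = 2" by simp
      have "1 \<le> 2 / omega lam 2 * ?e" using e w unfolding two by (simp add: field_simps)
      also have "\<dots> \<le> c * ?e" by (intro mult_right_mono) (auto simp: c_def)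
      also have "\<dots> \<le> c * ?e * exp ?s"
        using s0 c1 mult_left_mono[of 1 "exp ?s" "c * ?e"] by simp
      finally show ?thesis .
    next
      case (Suc n)
      then have "small_divisor lam n K" unfolding \<nu>_def using not_less_Least by (metis lessI)
      then have "a n \<le> ?s"
        using sum_le_suminf[OF sum_S[of K], of "{n}"] a0 by simp
      then have "exp (a n) \<le> exp ?s" by simp
      moreover have "2 / omega lam (2 ^ (\<nu> + 1)) \<le> exp (a n)"
      proof -
        have "2 / omega lam (2 ^ (\<nu> + 1)) = exp (ln (2 / omega lam (2 ^ (\<nu> + 1))))"
          using w by (intro exp_ln[symmetric]) simp
        also have "ln (2 / omega lam (2 ^ (\<nu> + 1))) \<le> a n"
          unfolding a_def brjuno_coeff_def Suc Suc_eq_plus1 add.assoc one_add_one by (rule max.cobounded2)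
        finally show ?thesis by simp
      qed
      ultimately have "2 / omega lam (2 ^ (\<nu> + 1)) \<le> exp ?s" by linarith
      then have "1 \<le> omega lam (2 ^ (\<nu> + 1)) / 2 * exp ?s" using w by (simp add: field_simps)
      also have "\<dots> \<le> ?e * exp ?s" using e by (intro mult_right_mono) auto
      also have "\<dots> \<le> c * (?e * exp ?s)"
        using c1 mult_right_mono[of 1 c "?e * exp ?s"] by simp
      finally show ?thesis by (simp add: mult_ac)
    qed
  qed
  show ?thesis
  proof (rule that[where A = A and B = B and c = c])
    show "c > 0" by (simp add: c_def)
    show "A 0 = 0" "\<And>i. A (mi_unit i) = 0" by (simp_all add: A_zero)
    show "A K \<le> B * real (mi_size K)" for K
    proof -
      have "A K \<le> (\<Sum>\<nu>. real (mi_size K) * (a \<nu> * (1/2) ^ \<nu>))"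
        unfolding A_def by (intro suminf_le T_le sum_T summable_mult sum_a)
      also have "\<dots> = B * real (mi_size K)" unfolding B_def using suminf_mult[OF sum_a] by simp
      finally show ?thesis .
    qed
    show "A L + A M \<le> A (L + M)" for L M
    proof (cases "L = 0 \<or> M = 0")
      case True
      then show ?thesis using A_zero[of 0] by auto
    next
      case False
      have "0 \<le> (\<Sum>\<nu>. a \<nu> * of_bool (small_divisor lam \<nu> (L + M)))"
        by (rule suminf_nonneg[OF sum_S]) (use a0 in auto)
      then show ?thesis using super False by fastforce
    qed
    show "exp (A L + A M) \<le> c * cmod (mi_pair (L + M) lam - lam $ j) * exp (A (L + M))"
      if "L \<noteq> 0" "M \<noteq> 0" for L M j
    proof -
      let ?s = "\<Sum>\<nu>. a \<nu> * of_bool (small_divisor lam \<nu> (L + M))"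
      let ?e = "cmod (mi_pair (L + M) lam - lam $ j)"
      have "mi_size L > 0" "mi_size M > 0" using that by (metis gr0I mi_size_eq_0_iff)+
      then have "1 \<le> c * ?e * exp ?s" by (intro div) simp
      then have "exp (A L + A M) * 1 \<le> exp (A L + A M) * (c * ?e * exp ?s)"
        by (intro mult_left_mono) auto
      also have "\<dots> = c * ?e * exp (A L + A M + ?s)" by (simp add: exp_add mult_ac)
      also have "\<dots> \<le> c * ?e * exp (A (L + M))"
        using super[OF that] by (intro mult_left_mono) (auto simp: c_def)
      finally show ?thesis by simp
    qed
  qed
qed

section \<open>The linearizing series\<close>

text \<open>The coefficient of R(h) at K for R of order at least two and h without constant term.
  Words longer than |K| have no coefficient at K, so the finite range of M is complete.\<close>

definition ps_subst_coeff ::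
  "(('n::finite \<Rightarrow> nat) \<Rightarrow> complex) \<Rightarrow> ('n \<Rightarrow> ('n \<Rightarrow> nat) \<Rightarrow> complex) \<Rightarrow> ('n \<Rightarrow> nat) \<Rightarrow> complex" where
  "ps_subst_coeff R h K = (\<Sum>M | 2 \<le> mi_size M \<and> mi_size M \<le> mi_size K. R M * conv_word h (mi_word M) K)"

text \<open>Picard iteration for the fixed point equation. At \<open>K = mi_unit j\<close> the
  divisor is 0, but so is the numerator, and the quotient is 0: the linear part of H stays the
  identity.\<close>

primrec lin_iter :: "complex^'n::finite \<Rightarrow> ('n \<Rightarrow> ('n \<Rightarrow> nat) \<Rightarrow> complex) \<Rightarrow> nat \<Rightarrow> 'n \<Rightarrow> ('n \<Rightarrow> nat) \<Rightarrow> complex" where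
  "lin_iter lam R 0 = (\<lambda>j K. 0)"
| "lin_iter lam R (Suc d) = (\<lambda>j K. of_bool (K = mi_unit j) +
     ps_subst_coeff (R j) (lin_iter lam R d) K / (mi_pair K lam - lam $ j))"

text \<open>The coefficient at K is constant from the iterate |K| on, so this diagonal is the formal
  limit.\<close>

definition lin_series :: "complex^'n::finite \<Rightarrow> ('n \<Rightarrow> ('n \<Rightarrow> nat) \<Rightarrow> complex) \<Rightarrow> 'n \<Rightarrow> ('n \<Rightarrow> nat) \<Rightarrow> complex" where
  "lin_series lam R j K = lin_iter lam R (mi_size K) j K"

section \<open>Stabilization of the iterates and the recursion for their limit\<close>

lemma ps_subst_coeff_cong:
  assumes "\<And>i L. mi_size L < mi_size K \<Longrightarrow> h i L = h' i L" "\<And>i. h i 0 = 0" "\<And>i. h' i 0 = 0"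
  shows "ps_subst_coeff R h K = ps_subst_coeff R h' K"
  unfolding ps_subst_coeff_def
  by (intro sum.cong refl arg_cong2[where f = "(*)"] conv_word_cong_less assms) auto

lemma ps_subst_coeff_small: "mi_size K < 2 \<Longrightarrow> ps_subst_coeff R h K = 0"
  unfolding ps_subst_coeff_def by (rule sum.neutral) auto

lemma zero_neq_mi_unit [simp]: "0 \<noteq> mi_unit (i::'n::finite)" "mi_unit i \<noteq> 0"
  by (metis mi_size_unit mi_size_zero zero_neq_one)+

lemma lin_iter_0 [simp]: "lin_iter lam R d i 0 = 0"
  by (cases d) (auto simp: ps_subst_coeff_small)

lemma lin_iter_stable_Suc: "mi_size K \<le> d \<Longrightarrow> lin_iter lam R (Suc d) j K = lin_iter lam R d j K"
proof (induction d arbitrary: j K)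
  case 0
  then have "K = 0" by simp
  then show ?case by (simp only: lin_iter_0)
next
  case (Suc d)
  have "ps_subst_coeff (R j) (lin_iter lam R (Suc d)) K = ps_subst_coeff (R j) (lin_iter lam R d) K"
    by (rule ps_subst_coeff_cong) (use Suc in \<open>auto simp del: lin_iter.simps\<close>)
  then show ?case by (simp only: lin_iter.simps)
qed

lemma lin_iter_eq_lin_series: "mi_size K \<le> d \<Longrightarrow> lin_iter lam R d j K = lin_series lam R j K"
proof (induction rule: dec_induct)
  case base
  then show ?case by (simp add: lin_series_def)
next
  case (step d)
  then show ?case by (metis lin_iter_stable_Suc)
qed

lemma lin_series_0 [simp]: "lin_series lam R j 0 = 0"
  by (simp add: lin_series_def)

lemma lin_series_eq:
  "lin_series lam R j K = of_bool (K = mi_unit j) +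
     ps_subst_coeff (R j) (lin_series lam R) K / (mi_pair K lam - lam $ j)"
proof -
  have "lin_series lam R j K = lin_iter lam R (Suc (mi_size K)) j K"
    by (rule lin_iter_eq_lin_series[symmetric]) simp
  also have "\<dots> = of_bool (K = mi_unit j) +
     ps_subst_coeff (R j) (lin_iter lam R (mi_size K)) K / (mi_pair K lam - lam $ j)"
    by simp
  also have "ps_subst_coeff (R j) (lin_iter lam R (mi_size K)) K = ps_subst_coeff (R j) (lin_series lam R) K"
    by (rule ps_subst_coeff_cong) (auto intro!: lin_iter_eq_lin_series)
  finally show ?thesis .
qed

lemma lin_series_unit: "lin_series lam R j (mi_unit i) = of_bool (i = j)"
proof -
  have "mi_unit i = mi_unit j \<longleftrightarrow> i = j"
    by (metis mi_unit_nth zero_neq_one)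
  then show ?thesis by (subst lin_series_eq) (simp add: ps_subst_coeff_small)
qed

text \<open>In degree at least two this clears the denominator. Below that the right side is 0, and
  the only nonzero coefficient on the left, at \<open>mi_unit j\<close>, meets the divisor
  0.\<close>

lemma lin_series_homological:
  assumes "nonresonant lam"
  shows "(mi_pair K lam - lam $ j) * lin_series lam R j K = ps_subst_coeff (R j) (lin_series lam R) K"
proof (cases "mi_size K \<ge> 2")
  case True
  then have "mi_pair K lam - lam $ j \<noteq> 0" "K \<noteq> mi_unit j"
    using assms unfolding nonresonant_def by (metis right_minus_eq, auto)
  then show ?thesis by (subst lin_series_eq) simp
next
  case False
  then have "ps_subst_coeff (R j) (lin_series lam R) K = 0" by (simp add: ps_subst_coeff_small)
  moreover from this have "lin_series lam R j K = of_bool (K = mi_unit j)"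
    by (subst lin_series_eq) simp
  ultimately show ?thesis by auto
qed

text \<open>Triangle inequality for a superposition of series with coefficients r_M. The index sets
  may vary with K, as in the substitution, where only |M| \<le> |K| occurs; their union over F
  majorizes them.\<close>

lemma weighted_le_sum_mono:
  assumes "finite F" "\<And>K. 0 \<le> w K" "\<And>M. weighted_le w (a M) (s M)"
    "\<And>K. finite (G K)"
    "\<And>X. finite X \<Longrightarrow> (\<Sum>M\<in>X. cmod (r M) * s M) \<le> t"
  shows "(\<Sum>K\<in>F. cmod (\<Sum>M\<in>G K. r M * a M K) * w K) \<le> t"
proof -
  define X where "X = (\<Union>K\<in>F. G K)"
  have X: "finite X" using assms by (auto simp: X_def)
  have "(\<Sum>K\<in>F. cmod (\<Sum>M\<in>G K. r M * a M K) * w K) \<le> (\<Sum>K\<in>F. \<Sum>M\<in>X. cmod (r M) * (cmod (a M K) * w K))"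
  proof (rule sum_mono)
    fix K assume K: "K \<in> F"
    have "cmod (\<Sum>M\<in>G K. r M * a M K) * w K \<le> (\<Sum>M\<in>G K. cmod (r M * a M K)) * w K"
      by (intro mult_right_mono norm_sum assms)
    also have "\<dots> = (\<Sum>M\<in>G K. cmod (r M) * (cmod (a M K) * w K))"
      by (simp add: sum_distrib_right norm_mult mult.assoc)
    also have "\<dots> \<le> (\<Sum>M\<in>X. cmod (r M) * (cmod (a M K) * w K))"
      using K X assms(2) by (intro sum_mono2) (auto simp: X_def)
    finally show "cmod (\<Sum>M\<in>G K. r M * a M K) * w K \<le> (\<Sum>M\<in>X. cmod (r M) * (cmod (a M K) * w K))" .
  qed
  also have "\<dots> = (\<Sum>M\<in>X. cmod (r M) * (\<Sum>K\<in>F. cmod (a M K) * w K))"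
    by (subst sum.swap) (simp add: sum_distrib_left)
  also have "\<dots> \<le> (\<Sum>M\<in>X. cmod (r M) * s M)"
    by (intro sum_mono mult_left_mono weighted_leD assms) auto
  also have "\<dots> \<le> t" by (rule assms(5)[OF X])
  finally show ?thesis .
qed

lemma abs_conv_bounded_sums:
  assumes "abs_conv a \<rho>" "0 \<le> \<rho>"
  obtains N where "N > 0" "\<And>X. finite X \<Longrightarrow> (\<Sum>M\<in>X. cmod (a M) * \<rho> ^ mi_size M) \<le> N"
proof -
  obtain s where s: "weighted_le (\<lambda>K. \<rho> ^ mi_size K) a s"
    using abs_conv_imp_weighted_le assms by metis
  show ?thesis
    by (rule that[of "max s 1"]) (use weighted_leD[OF s] in \<open>auto simp: le_max_iff_disj\<close>)
qed

text \<open>The weights \<open>exp (- A)\<close> turn the division by the small divisors into a bounded operation on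
  products of series without constant term, so that the fixed point equation is solved as if there
  were no small divisors.\<close>

theorem lin_series_bound:
  fixes lam :: "complex^'n::finite"
  assumes nonres: "nonresonant lam" and brj: "brjuno_sum_finite (omega lam)"
    and "\<rho> > 0" and R: "\<And>j. abs_conv (R j) \<rho>"
  obtains r s where "r > 0" "0 < s" "s \<le> \<rho>" "\<And>j. weighted_le (\<lambda>K. r ^ mi_size K) (lin_series lam R j) s"
proof -
  obtain A :: "('n \<Rightarrow> nat) \<Rightarrow> real" and B c :: real where
    c: "c > 0" and A0: "A 0 = 0" and A1: "\<And>i. A (mi_unit i) = 0" and AB: "\<And>K. A K \<le> B * mi_size K"
    and Aadd: "\<And>L M. A L + A M \<le> A (L + M)"
    and Adiv: "\<And>L M j. L \<noteq> 0 \<Longrightarrow> M \<noteq> 0 \<Longrightarrow>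
       exp (A L + A M) \<le> c * cmod (mi_pair (L + M) lam - lam $ j) * exp (A (L + M))"
    by (rule brjuno_weight[OF nonres brj]) (rule that)
  have "\<exists>N. \<forall>j. N j > 0 \<and> (\<forall>X. finite X \<longrightarrow> (\<Sum>M\<in>X. cmod (R j M) * \<rho> ^ mi_size M) \<le> N j)"
    using abs_conv_bounded_sums[OF R] \<open>\<rho> > 0\<close> by (intro choice allI) (metis less_imp_le)
  then obtain N0 where N0: "\<And>j. N0 j > 0"
    "\<And>j X. finite X \<Longrightarrow> (\<Sum>M\<in>X. cmod (R j M) * \<rho> ^ mi_size M) \<le> N0 j" by blast
  define N where "N = (\<Sum>j\<in>(UNIV :: 'n set). N0 j)"
  have N0_le: "N0 j \<le> N" for j
    unfolding N_def by (rule member_le_sum) (use N0(1) in \<open>auto intro: less_imp_le\<close>)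
  have N: "N > 0" using N0(1) N0_le less_le_trans by blast
  \<comment> \<open>On the ball of radius s the terms of R of order at least two contribute at most
    N (s/\<rho>)^2, and the divisors a factor c. This s makes the total at most s/2.\<close>
  define s where "s = min \<rho> (\<rho>\<^sup>2 / (2 * c * N))"
  have s: "0 < s" "s \<le> \<rho>" "c * N * (s / \<rho>)\<^sup>2 \<le> s / 2"
  proof -
    show "0 < s" "s \<le> \<rho>" using \<open>\<rho> > 0\<close> c N by (auto simp: s_def)
    have "s \<le> \<rho>\<^sup>2 / (2 * c * N)" by (simp add: s_def)
    then have "2 * c * N * s \<le> \<rho>\<^sup>2" using c N by (simp add: field_simps)
    then have "2 * c * N * s * s \<le> \<rho>\<^sup>2 * s" using \<open>0 < s\<close> by (intro mult_right_mono) auto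
    then show "c * N * (s / \<rho>)\<^sup>2 \<le> s / 2"
      using \<open>\<rho> > 0\<close> by (simp add: field_simps power2_eq_square)
  qed
  \<comment> \<open>With s/2 per degree each coordinate function has norm s/2, which together with
    the nonlinear part exactly fills the ball of radius s.\<close>
  define w where "w K = (s / 2) ^ mi_size K * exp (- A K)" for K
  have w0: "0 \<le> w K" for K using s by (simp add: w_def)
  have w_zero: "w 0 = 1" by (simp add: w_def A0)
  have w_unit: "w (mi_unit j) = s / 2" for j by (simp add: w_def A1)
  have w_add: "w (L + M) \<le> w L * w M" for L M
  proof -
    have "exp (- A (L + M)) \<le> exp (- A L) * exp (- A M)"
      using Aadd[of L M] by (simp flip: exp_add)
    then have "(s / 2) ^ mi_size (L + M) * exp (- A (L + M)) \<le>
        (s / 2) ^ mi_size (L + M) * (exp (- A L) * exp (- A M))"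
      using s by (intro mult_left_mono) auto
    then show ?thesis by (simp add: w_def power_add mult_ac)
  qed
  have w_div: "w (L + M) \<le> c * cmod (mi_pair (L + M) lam - lam $ j) * (w L * w M)"
    if "L \<noteq> 0" "M \<noteq> 0" for L M j
  proof -
    let ?e = "c * cmod (mi_pair (L + M) lam - lam $ j)"
    have "exp (A L + A M) * exp (- (A L + A M) - A (L + M)) \<le>
       ?e * exp (A (L + M)) * exp (- (A L + A M) - A (L + M))"
      by (intro mult_right_mono Adiv that) auto
    then have "exp (- A (L + M)) \<le> ?e * (exp (- A L) * exp (- A M))"
      by (simp add: mult.assoc flip: exp_add)
    then have "(s / 2) ^ mi_size (L + M) * exp (- A (L + M)) \<le>
        (s / 2) ^ mi_size (L + M) * (?e * (exp (- A L) * exp (- A M)))"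
      using s by (intro mult_left_mono) auto
    then show ?thesis by (simp add: w_def power_add mult_ac)
  qed
  \<comment> \<open>The divisor is charged to the outermost product, of the first letter and the
    remaining word. Neither has a constant term, since at least one letter remains.\<close>
  have word: "weighted_le w (\<lambda>K. conv_word h (mi_word M) K / (mi_pair K lam - lam $ j)) (c * s ^ mi_size M)"
    if h: "\<And>i. weighted_le w (h i) s" "\<And>i. h i 0 = 0" and M: "2 \<le> mi_size M" for h M j
  proof -
    obtain i js where ijs: "mi_word M = i # js" "js \<noteq> []"
      using M length_mi_word[of M] by (cases "mi_word M"; cases "tl (mi_word M)") auto
    have "weighted_le w (\<lambda>K. conv (h i) (conv_word h js) K / (mi_pair K lam - lam $ j)) (c * (s * s ^ length js))"
    proof (rule weighted_le_conv_div[where w = w])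
      show "weighted_le w (h i) s" by (rule h)
      show "weighted_le w (conv_word h js) (s ^ length js)"
        by (rule weighted_le_conv_word[where w = w]) (simp_all add: h w0 w_zero w_add)
      show "0 \<le> w K" for K by (rule w0)
    next
      fix L K assume *: "h i L \<noteq> 0" "conv_word h js K \<noteq> 0"
      have "L \<noteq> 0" using * h(2) by auto
      moreover have "K \<noteq> 0" using * conv_word_eq_0[of h 0 js] h(2) ijs(2) by auto
      ultimately show "w (L + K) \<le> c * cmod (mi_pair (L + K) lam - lam $ j) * (w L * w K)"
        by (rule w_div)
    next
      fix K assume K: "mi_pair K lam - lam $ j = 0"
      then have "\<not> 2 \<le> mi_size K" using nonres unfolding nonresonant_def by (metis right_minus_eq)
      then have "conv_word h (mi_word M) K = 0" using M by (intro conv_word_eq_0 h) simp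
      then show "conv (h i) (conv_word h js) K = 0" by (simp add: ijs)
    next
      show "0 \<le> c" using c by simp
    qed
    moreover have "mi_size M = Suc (length js)" by (metis ijs(1) length_Cons length_mi_word)
    ultimately show ?thesis by (simp add: ijs(1))
  qed
  have iter: "weighted_le w (lin_iter lam R d j) s" for d j
  proof (induction d arbitrary: j)
    case 0
    then show ?case using s by (simp add: weighted_le_def)
  next
    case (Suc d)
    define G where "G K = {M :: 'n \<Rightarrow> nat. 2 \<le> mi_size M \<and> mi_size M \<le> mi_size K}" for K :: "'n \<Rightarrow> nat"
    define r where "r M = (if 2 \<le> mi_size M then R j M else 0)" for M
    define q where "q M K = (if 2 \<le> mi_size M then
       conv_word (lin_iter lam R d) (mi_word M) K / (mi_pair K lam - lam $ j) else 0)" for M K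
    have finG: "finite (G K)" for K
      unfolding G_def by (rule finite_subset[OF _ finite_mi_size_le[of "mi_size K"]]) auto
    have S: "ps_subst_coeff (R j) (lin_iter lam R d) K / (mi_pair K lam - lam $ j) = (\<Sum>M\<in>G K. r M * q M K)" for K
      unfolding ps_subst_coeff_def G_def sum_divide_distrib by (rule sum.cong) (auto simp: r_def q_def)
    have q: "weighted_le w (q M) (c * s ^ mi_size M)" for M
    proof (cases "2 \<le> mi_size M")
      case True
      then show ?thesis unfolding q_def using word[OF Suc.IH lin_iter_0 True] by simp
    next
      case False
      then show ?thesis using c s by (simp add: q_def weighted_le_def)
    qed
    have r: "(\<Sum>M\<in>X. cmod (r M) * (c * s ^ mi_size M)) \<le> s / 2" if X: "finite X" for X
    proof -
      have "(\<Sum>M\<in>X. cmod (r M) * (c * s ^ mi_size M)) \<le>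
        (\<Sum>M\<in>X. c * (s / \<rho>)\<^sup>2 * (cmod (R j M) * \<rho> ^ mi_size M))"
      proof (rule sum_mono)
        fix M
        show "cmod (r M) * (c * s ^ mi_size M) \<le> c * (s / \<rho>)\<^sup>2 * (cmod (R j M) * \<rho> ^ mi_size M)"
        proof (cases "2 \<le> mi_size M")
          case True
          have "(s / \<rho>) ^ mi_size M \<le> (s / \<rho>)\<^sup>2"
            using s \<open>\<rho> > 0\<close> True by (intro power_decreasing) auto
          then have "s ^ mi_size M \<le> (s / \<rho>)\<^sup>2 * \<rho> ^ mi_size M"
            using \<open>\<rho> > 0\<close> by (simp add: power_divide pos_divide_le_eq)
          then have "cmod (R j M) * c * s ^ mi_size M \<le> cmod (R j M) * c * ((s / \<rho>)\<^sup>2 * \<rho> ^ mi_size M)"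
            using c by (intro mult_left_mono) auto
          then show ?thesis using True by (simp add: r_def mult_ac)
        next
          case False
          then show ?thesis using c \<open>\<rho> > 0\<close> by (simp add: r_def)
        qed
      qed
      also have "\<dots> = c * (s / \<rho>)\<^sup>2 * (\<Sum>M\<in>X. cmod (R j M) * \<rho> ^ mi_size M)"
        by (simp add: sum_distrib_left)
      also have "\<dots> \<le> c * (s / \<rho>)\<^sup>2 * N"
        using c N0(2)[OF X, of j] N0_le[of j] by (intro mult_left_mono) auto
      also have "\<dots> \<le> s / 2" using s(3) by (simp add: mult_ac)
      finally show ?thesis .
    qed
    show ?case unfolding weighted_le_def
    proof (intro allI impI)
      fix F :: "('n \<Rightarrow> nat) set" assume F: "finite F"
      have "(\<Sum>K\<in>F. cmod (lin_iter lam R (Suc d) j K) * w K) \<le>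
        (\<Sum>K\<in>F. of_bool (K = mi_unit j) * w K + cmod (\<Sum>M\<in>G K. r M * q M K) * w K)"
      proof (rule sum_mono)
        fix K
        have "cmod (lin_iter lam R (Suc d) j K) \<le> cmod (of_bool (K = mi_unit j)) + cmod (\<Sum>M\<in>G K. r M * q M K)"
          by (simp only: lin_iter.simps S norm_triangle_ineq)
        also have "cmod (of_bool (K = mi_unit j)) = of_bool (K = mi_unit j)" by simp
        finally show "cmod (lin_iter lam R (Suc d) j K) * w K \<le>
           of_bool (K = mi_unit j) * w K + cmod (\<Sum>M\<in>G K. r M * q M K) * w K"
          using w0[of K] by (metis distrib_right mult_right_mono)
      qed
      also have "\<dots> = (\<Sum>K\<in>F. of_bool (K = mi_unit j) * w K) + (\<Sum>K\<in>F. cmod (\<Sum>M\<in>G K. r M * q M K) * w K)"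
        by (rule sum.distrib)
      also have "(\<Sum>K\<in>F. of_bool (K = mi_unit j) * w K) \<le> s / 2"
      proof -
        have "(\<Sum>K\<in>F. of_bool (K = mi_unit j) * w K) = (\<Sum>K\<in>F. if K = mi_unit j then s / 2 else 0)"
          by (rule sum.cong) (auto simp: w_unit)
        also have "\<dots> \<le> s / 2" using F s by (simp add: sum.delta')
        finally show ?thesis .
      qed
      also have "(\<Sum>K\<in>F. cmod (\<Sum>M\<in>G K. r M * q M K) * w K) \<le> s / 2"
        by (rule weighted_le_sum_mono[where w = w, OF F w0 q finG r])
      finally show "(\<Sum>K\<in>F. cmod (lin_iter lam R (Suc d) j K) * w K) \<le> s" by simp
    qed
  qed
  \<comment> \<open>A is at most |B| |K|, so w dominates a geometric weight and the bound becomes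
    one on an ordinary polydisc.\<close>
  define r where "r = s / 2 * exp (- \<bar>B\<bar>)"
  have r: "r > 0" using s by (simp add: r_def)
  have rw: "r ^ mi_size K \<le> w K" for K
  proof -
    have "A K \<le> \<bar>B\<bar> * mi_size K" using AB[of K] by (meson abs_ge_self mult_right_mono of_nat_0_le_iff order_trans)
    then have "exp (- \<bar>B\<bar>) ^ mi_size K \<le> exp (- A K)"
      by (simp add: mult.commute flip: exp_of_nat_mult)
    then show ?thesis unfolding r_def w_def power_mult_distrib using s by (intro mult_left_mono) auto
  qed
  have "weighted_le (\<lambda>K. r ^ mi_size K) (lin_series lam R j) s" for j
    unfolding weighted_le_def
  proof (intro allI impI)
    fix F :: "('n \<Rightarrow> nat) set" assume F: "finite F"
    \<comment> \<open>One number of iterations after which every coefficient with index in F has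
      stabilized.\<close>
    define d where "d = (\<Sum>K\<in>F. mi_size K)"
    have d: "mi_size K \<le> d" if "K \<in> F" for K
      unfolding d_def by (rule member_le_sum[OF that]) (use F in auto)
    have "(\<Sum>K\<in>F. cmod (lin_series lam R j K) * r ^ mi_size K) \<le> (\<Sum>K\<in>F. cmod (lin_iter lam R d j K) * w K)"
      by (intro sum_mono mult_mono rw) (use d r in \<open>auto simp: lin_iter_eq_lin_series\<close>)
    also have "\<dots> \<le> s" by (rule weighted_leD[OF iter F])
    finally show "(\<Sum>K\<in>F. cmod (lin_series lam R j K) * r ^ mi_size K) \<le> s" .
  qed
  with r s that show ?thesis by blast
qed

text \<open>Turns a norm bound into a bound on values, which keeps H z in the polydisc where R
  converges.\<close>

lemma norm_ps_eval_le:
  assumes "weighted_le (\<lambda>K. r ^ mi_size K) a s" "0 \<le> r" "z \<in> cpolydisc r"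
  shows "cmod (ps_eval a z) \<le> s"
proof -
  have conv: "abs_conv a r" using weighted_le_imp_abs_conv[OF assms(1,2)] by simp
  have "cmod (ps_eval a z) \<le> (\<Sum>\<^sub>\<infinity>K. cmod (a K * mon z K))"
    unfolding ps_eval_def by (rule norm_infsum_bound) (rule abs_conv_summable[OF conv assms(3)])
  also have "\<dots> \<le> s"
  proof (rule infsum_le_finite_sums[OF abs_conv_summable[OF conv assms(3)]])
    fix F :: "('a \<Rightarrow> nat) set" assume "finite F"
    have "(\<Sum>K\<in>F. cmod (a K * mon z K)) \<le> (\<Sum>K\<in>F. cmod (a K) * r ^ mi_size K)"
      by (intro sum_mono) (auto simp: norm_mult intro!: mult_left_mono norm_mon_le assms)
    also have "\<dots> \<le> s" by (rule weighted_leD) fact+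
    finally show "(\<Sum>K\<in>F. cmod (a K * mon z K)) \<le> s" .
  qed
  finally show ?thesis .
qed

text \<open>The double series over (M, K) is absolutely summable, because the word of M has norm at
  most s^|M| and R converges absolutely at radius s. Summing over K first gives the value of R at
  the point with coordinates h_i(z), summing over M first the substituted coefficients.\<close>

theorem has_sum_ps_subst:
  fixes h :: "'n::finite \<Rightarrow> ('n \<Rightarrow> nat) \<Rightarrow> complex"
  assumes h: "\<And>i. weighted_le (\<lambda>K. r ^ mi_size K) (h i) s" "\<And>i. h i 0 = 0"
    and "0 \<le> r" and R: "abs_conv R s" "\<And>M. mi_size M < 2 \<Longrightarrow> R M = 0" and z: "z \<in> cpolydisc r"
  shows "((\<lambda>K. ps_subst_coeff R h K * mon z K) has_sum ps_eval R (\<chi> i. ps_eval (h i) z)) UNIV"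
proof -
  define u where "u M K = R M * (conv_word h (mi_word M) K * mon z K)" for M K
  define Hz where "Hz = (\<chi> i. ps_eval (h i) z)"
  have s0: "0 \<le> s" using weighted_le_nonneg[OF h(1)] .
  have hconv: "abs_conv (h i) r" for i using weighted_le_imp_abs_conv[OF h(1) \<open>0 \<le> r\<close>] by simp
  have Hz: "Hz \<in> cpolydisc s"
    using norm_ps_eval_le[OF h(1) \<open>0 \<le> r\<close> z] by (auto simp: Hz_def cpolydisc_def)
  have wword: "weighted_le (\<lambda>K. r ^ mi_size K) (conv_word h (mi_word M)) (s ^ mi_size M)" for M
  proof -
    have "weighted_le (\<lambda>K. r ^ mi_size K) (conv_word h (mi_word M)) (s ^ length (mi_word M))"
      by (rule weighted_le_conv_word[where w = "\<lambda>K. r ^ mi_size K", OF h(1)])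
         (use \<open>0 \<le> r\<close> in \<open>auto simp: power_add\<close>)
    then show ?thesis by simp
  qed
  have cword: "abs_conv (conv_word h (mi_word M)) r" for M
    by (rule conv_word_abs_conv[OF hconv \<open>0 \<le> r\<close>])
  have inner: "((\<lambda>K. u M K) has_sum (R M * mon Hz M)) UNIV" for M
  proof -
    have "mon Hz M = ps_eval (conv_word h (mi_word M)) z"
      by (simp add: ps_eval_conv_word[OF hconv \<open>0 \<le> r\<close> z] prod_list_mi_word mon_def Hz_def)
    then show ?thesis unfolding u_def by (simp add: has_sum_cmult_right abs_conv_has_sum[OF cword z])
  qed
  have "(\<lambda>x. norm (case x of (M, K) \<Rightarrow> u M K)) summable_on UNIV \<times> UNIV"
  proof (rule Infinite_Sum.abs_summable_on_Sigma_iff[THEN iffD2], intro conjI ballI)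
    fix M
    show "(\<lambda>K. norm (case (M, K) of (M, K) \<Rightarrow> u M K)) summable_on UNIV"
      using summable_on_cmult_right[OF abs_conv_summable[OF cword z], of "cmod (R M)"]
      by (simp add: u_def norm_mult)
  next
    have bound: "norm (\<Sum>\<^sub>\<infinity>K. norm (u M K)) \<le> cmod (R M) * s ^ mi_size M" for M
    proof -
      have "(\<Sum>\<^sub>\<infinity>K. norm (u M K)) = cmod (R M) * (\<Sum>\<^sub>\<infinity>K. norm (conv_word h (mi_word M) K * mon z K))"
        unfolding u_def norm_mult[of "R M"] by (intro infsum_cmult_right abs_conv_summable[OF cword z])
      also have "\<dots> \<le> cmod (R M) * s ^ mi_size M"
      proof (intro mult_left_mono infsum_le_finite_sums abs_conv_summable[OF cword z])
        fix F :: "('n \<Rightarrow> nat) set" assume "finite F"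
        have "(\<Sum>K\<in>F. norm (conv_word h (mi_word M) K * mon z K)) \<le>
            (\<Sum>K\<in>F. cmod (conv_word h (mi_word M) K) * r ^ mi_size K)"
          by (intro sum_mono) (auto simp: norm_mult intro!: mult_left_mono norm_mon_le z)
        also have "\<dots> \<le> s ^ mi_size M" by (rule weighted_leD[OF wword]) fact
        finally show "(\<Sum>K\<in>F. norm (conv_word h (mi_word M) K * mon z K)) \<le> s ^ mi_size M" .
      qed simp
      finally show ?thesis by (simp add: infsum_nonneg)
    qed
    show "(\<lambda>M. norm (\<Sum>\<^sub>\<infinity>K. norm (case (M, K) of (M, K) \<Rightarrow> u M K))) summable_on UNIV"
      unfolding prod.case
      by (rule summable_on_comparison_test[OF R(1)[unfolded abs_conv_def]]) (simp_all only: bound norm_ge_zero)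
  qed
  then obtain S where S: "((\<lambda>(M, K). u M K) has_sum S) (UNIV \<times> UNIV)"
    by (rule that[OF has_sum_infsum[OF abs_summable_summable]])
  have "((\<lambda>M. R M * mon Hz M) has_sum S) UNIV"
    by (rule has_sum_SigmaD[OF S]) (simp add: inner)
  then have S_eq: "S = ps_eval R Hz" using abs_conv_has_sum[OF R(1) Hz] has_sum_unique by blast
  have "((\<lambda>(K, M). u M K) has_sum S) (UNIV \<times> UNIV)"
    using S by (subst has_sum_swap) simp
  then have "((\<lambda>K. ps_subst_coeff R h K * mon z K) has_sum S) UNIV"
  proof (rule has_sum_SigmaD)
    fix K :: "'n \<Rightarrow> nat"
    let ?G = "{M :: 'n \<Rightarrow> nat. 2 \<le> mi_size M \<and> mi_size M \<le> mi_size K}"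
    have fin: "finite ?G" by (rule finite_subset[OF _ finite_mi_size_le[of "mi_size K"]]) auto
    have "((\<lambda>M. u M K) has_sum (ps_subst_coeff R h K * mon z K)) ?G"
      by (rule has_sum_finiteI[OF fin]) (simp add: ps_subst_coeff_def u_def sum_distrib_right mult.assoc)
    moreover have "u M K = 0" if "M \<notin> ?G" for M
    proof (cases "mi_size M < 2")
      case False
      then have "conv_word h (mi_word M) K = 0" using that by (intro conv_word_eq_0 h) auto
      then show ?thesis by (simp add: u_def)
    qed (use R in \<open>simp add: u_def\<close>)
    ultimately show "((\<lambda>M. case (K, M) of (K, M) \<Rightarrow> u M K) has_sum (ps_subst_coeff R h K * mon z K)) UNIV"
      by (subst has_sum_cong_neutral[where T = ?G and g = "\<lambda>M. u M K"]) auto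
  qed
  then show ?thesis by (simp add: S_eq Hz_def)
qed

section \<open>Linear fields acting on power series\<close>

definition lin_field :: "complex^'n::finite \<Rightarrow> complex^'n \<Rightarrow> complex^'n" where
  "lin_field lam z = (\<chi> i. lam $ i * z $ i)"

lemma lin_field_nth [simp]: "lin_field lam z $ i = lam $ i * z $ i"
  by (simp add: lin_field_def)

lemma diag_mat_mult: "diag_mat lam *v z = lin_field lam z"
proof -
  have "(\<Sum>j\<in>UNIV. (if i = j then lam $ i else 0) * z $ j) = lam $ i * z $ i" for i
  proof -
    have "(\<Sum>j\<in>UNIV. (if i = j then lam $ i else 0) * z $ j) = (\<Sum>j\<in>UNIV. if i = j then lam $ i * z $ j else 0)"
      by (rule sum.cong) auto
    then show ?thesis by (simp add: sum.delta)
  qed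
  then show ?thesis by (simp add: vec_eq_iff matrix_vector_mult_def diag_mat_def)
qed

lemma has_sum_finite_sum:
  fixes f :: "'i \<Rightarrow> 'a \<Rightarrow> complex"
  assumes "finite I" "\<And>i. i \<in> I \<Longrightarrow> (f i has_sum s i) A"
  shows "((\<lambda>x. \<Sum>i\<in>I. f i x) has_sum (\<Sum>i\<in>I. s i)) A"
  using assms by (induction I rule: finite_induct) (auto intro!: has_sum_add)

lemma has_sum_ps_deriv:
  assumes "abs_conv a r" "z \<in> polydisc r"
  shows "((\<lambda>K. a K * (of_nat (K i) * mon z (K - mi_unit i))) has_sum ps_eval (ps_deriv i a) z) UNIV"
proof -
  obtain s where s: "0 < s" "s < r" "z \<in> polydisc s" using polydisc_shrink assms(2) by blast
  have "abs_conv (ps_deriv i a) s" using abs_conv_ps_deriv[OF assms(1)] s by simp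
  moreover have "z \<in> cpolydisc s" using s polydisc_subset_cpolydisc by blast
  ultimately have "((\<lambda>K. ps_deriv i a K * mon z K) has_sum ps_eval (ps_deriv i a) z) UNIV"
    by (rule abs_conv_has_sum)
  then have "((\<lambda>K. a K * (of_nat (K i) * mon z (K - mi_unit i))) has_sum ps_eval (ps_deriv i a) z)
      (range (\<lambda>K. K + mi_unit i))"
    by (subst has_sum_reindex[OF inj_add_mi_unit]) (simp add: o_def ps_deriv_def mult_ac)
  then show ?thesis
    by (rule has_sum_cong_neutral[THEN iffD1, rotated -1]) (auto simp: range_add_mi_unit)
qed

text \<open>Monomials are eigenvectors of the diagonal field with eigenvalue
  \<open>mi_pair K lam\<close>, because z_i times the i-th derivative of z^K is K_i z^K.\<close>

lemma has_sum_lin_field: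
  assumes "abs_conv a r" "z \<in> polydisc r"
  shows "((\<lambda>K. mi_pair K lam * (a K * mon z K)) has_sum
     (\<Sum>i\<in>UNIV. lin_field lam z $ i * ps_eval (ps_deriv i a) z)) UNIV"
proof -
  have "((\<lambda>K. \<Sum>i\<in>UNIV. lin_field lam z $ i * (a K * (of_nat (K i) * mon z (K - mi_unit i)))) has_sum
     (\<Sum>i\<in>UNIV. lin_field lam z $ i * ps_eval (ps_deriv i a) z)) UNIV"
    by (intro has_sum_finite_sum has_sum_cmult_right has_sum_ps_deriv[OF assms]) simp
  moreover have "(\<Sum>i\<in>UNIV. lin_field lam z $ i * (a K * (of_nat (K i) * mon z (K - mi_unit i)))) =
      mi_pair K lam * (a K * mon z K)" for K
  proof -
    have "lin_field lam z $ i * (a K * (of_nat (K i) * mon z (K - mi_unit i))) =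
      of_nat (K i) * lam $ i * (a K * mon z K)" for i
    proof (cases "K i = 0")
      case False
      then have "mon z K = mon z (K - mi_unit i) * z $ i"
        by (metis mi_add_unit_diff mon_add mon_unit)
      then show ?thesis by simp
    qed simp
    then show ?thesis by (simp only: mi_pair_def sum_distrib_right)
  qed
  ultimately show ?thesis by simp
qed

text \<open>Comparing coefficients gives (\<langle>K,lam\<rangle> - \<mu>) k_K = g_K for K \<noteq>
  0, and the subtracted constants balance K = 0 for any \<kappa>. The lower bound on the divisors
  shrinks the radius by the factor q. The case \<mu> = 0 provides f, the general case k.\<close>

lemma linear_homological_equation:
  fixes lam :: "complex^'n::finite"
  assumes g: "abs_conv g r" "0 < r"
    and div: "\<And>K. K \<noteq> 0 \<Longrightarrow> c * q ^ mi_size K \<le> cmod (mi_pair K lam - \<mu>)"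
    and "0 < c" "0 < q" "q \<le> 1"
  shows "\<exists>k s. 0 < s \<and> s \<le> r \<and> abs_conv k s \<and> k 0 = \<kappa> \<and>
    (\<forall>z. z \<in> polydisc s \<longrightarrow>
      (\<Sum>i\<in>UNIV. lin_field lam z $ i * ps_eval (ps_deriv i k) z) = \<mu> * ps_eval k z + ps_eval g z - g 0 - \<mu> * \<kappa>)"
proof -
  define k where "k K = (if K = 0 then \<kappa> else g K / (mi_pair K lam - \<mu>))" for K
  have rq: "0 < r * q" "r * q \<le> r" using assms by (auto simp: mult_le_cancel_left1)
  have k0: "k 0 = \<kappa>" by (simp add: k_def)
  have k: "abs_conv k (r * q)"
  proof -
    obtain N where N: "N > 0" "\<And>X. finite X \<Longrightarrow> (\<Sum>M\<in>X. cmod (g M) * r ^ mi_size M) \<le> N"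
      using abs_conv_bounded_sums[OF g(1)] g(2) by (metis less_imp_le)
    show ?thesis
    proof (rule abs_convI)
      fix F :: "('n \<Rightarrow> nat) set" assume F: "finite F"
      have "(\<Sum>K\<in>F. cmod (k K) * (r * q) ^ mi_size K) \<le>
        (\<Sum>K\<in>F. (if K = 0 then cmod \<kappa> else 0) + 1 / c * (cmod (g K) * r ^ mi_size K))"
      proof (rule sum_mono)
        fix K
        show "cmod (k K) * (r * q) ^ mi_size K \<le>
          (if K = 0 then cmod \<kappa> else 0) + 1 / c * (cmod (g K) * r ^ mi_size K)"
        proof (cases "K = 0")
          case True
          then show ?thesis using assms by (simp add: k_def)
        next
          case False
          have e: "0 < cmod (mi_pair K lam - \<mu>)"
          proof -
            have "0 < c * q ^ mi_size K" using assms by simp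
            then show ?thesis using div[OF False] by linarith
          qed
          have "c * q ^ mi_size K * (cmod (g K) * r ^ mi_size K) \<le>
              cmod (mi_pair K lam - \<mu>) * (cmod (g K) * r ^ mi_size K)"
            using g(2) by (intro mult_right_mono div False) auto
          then have "cmod (g K) / cmod (mi_pair K lam - \<mu>) * (r * q) ^ mi_size K \<le>
              1 / c * (cmod (g K) * r ^ mi_size K)"
            using e \<open>0 < c\<close> by (simp add: field_simps power_mult_distrib)
          then show ?thesis using False by (simp add: k_def norm_divide)
        qed
      qed
      also have "\<dots> = (\<Sum>K\<in>F. if K = 0 then cmod \<kappa> else 0) + 1 / c * (\<Sum>K\<in>F. cmod (g K) * r ^ mi_size K)"
        by (simp only: sum.distrib sum_distrib_left)
      also have "\<dots> \<le> cmod \<kappa> + 1 / c * N"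
        using F N(2)[OF F] \<open>0 < c\<close> by (intro add_mono mult_left_mono) (auto simp: sum.delta')
      finally show "(\<Sum>K\<in>F. cmod (k K) * (r * q) ^ mi_size K) \<le> cmod \<kappa> + 1 / c * N" .
    qed (use assms in auto)
  qed
  have "(\<Sum>i\<in>UNIV. lin_field lam z $ i * ps_eval (ps_deriv i k) z) =
      \<mu> * ps_eval k z + ps_eval g z - g 0 - \<mu> * \<kappa>" if z: "z \<in> polydisc (r * q)" for z :: "complex^'n"
  proof -
  have zc: "z \<in> cpolydisc (r * q)" "z \<in> cpolydisc r"
    using z polydisc_subset_cpolydisc[of "r * q"] cpolydisc_mono[OF rq(2)] by auto
  have sum1: "((\<lambda>K. mi_pair K lam * (k K * mon z K)) has_sum
     (\<Sum>i\<in>UNIV. lin_field lam z $ i * ps_eval (ps_deriv i k) z)) UNIV"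
    by (rule has_sum_lin_field[OF k z])
  have "((\<lambda>K. \<mu> * (k K * mon z K) + g K * mon z K + (if K = 0 then - g 0 - \<mu> * \<kappa> else 0)) has_sum
    (\<mu> * ps_eval k z + ps_eval g z + (- g 0 - \<mu> * \<kappa>))) UNIV"
  proof (intro has_sum_add has_sum_cmult_right abs_conv_has_sum[OF k zc(1)] abs_conv_has_sum[OF g(1) zc(2)])
    show "((\<lambda>K. if K = 0 then - g 0 - \<mu> * \<kappa> else 0) has_sum (- g 0 - \<mu> * \<kappa>)) UNIV"
      by (rule has_sum_finite_neutralI[of "{0}"]) auto
  qed
  moreover have "mi_pair K lam * (k K * mon z K) =
     \<mu> * (k K * mon z K) + g K * mon z K + (if K = 0 then - g 0 - \<mu> * \<kappa> else 0)" for K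
  proof (cases "K = 0")
    case False
    have "0 < c * q ^ mi_size K" using assms by simp
    then have "mi_pair K lam - \<mu> \<noteq> 0" using div[OF False] by auto
    then have "(mi_pair K lam - \<mu>) * k K = g K" using False by (simp add: k_def)
    then have "mi_pair K lam * k K = \<mu> * k K + g K" by (simp add: algebra_simps)
    from arg_cong[OF this, of "\<lambda>x. x * mon z K"] show ?thesis
      using False by (simp add: distrib_right mult.assoc)
  qed (simp add: k0)
  ultimately have "((\<lambda>K. mi_pair K lam * (k K * mon z K)) has_sum
    (\<mu> * ps_eval k z + ps_eval g z + (- g 0 - \<mu> * \<kappa>))) UNIV" by presburger
  then have "(\<Sum>i\<in>UNIV. lin_field lam z $ i * ps_eval (ps_deriv i k) z) =
    \<mu> * ps_eval k z + ps_eval g z + (- g 0 - \<mu> * \<kappa>)" by (rule has_sum_unique[OF sum1])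
  then show ?thesis by simp
  qed
  then show ?thesis by (intro exI[of _ k] exI[of _ "r * q"] conjI allI impI rq k k0)
qed

text \<open>The terms of a convergent series are bounded, so - ln w(2^(\<nu>+1)) \<le> C 2^\<nu>.
  For 2^\<nu> \<le> m < 2^(\<nu>+1) monotonicity carries this over to m.\<close>

lemma brjuno_sum_exponential_bound:
  assumes "brjuno_sum_finite w" "\<And>m. 2 \<le> m \<Longrightarrow> 0 < w m"
    "\<And>k m. 2 \<le> k \<Longrightarrow> k \<le> m \<Longrightarrow> w m \<le> w k"
  obtains q where "0 < q" "q \<le> 1" "\<And>m. 2 \<le> m \<Longrightarrow> q ^ m \<le> w m"
proof -
  define x where "x \<nu> = - ((1/2) ^ \<nu> * ln (w (2 ^ (\<nu> + 1))))" for \<nu> :: nat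
  have "x \<longlonglongrightarrow> 0"
    using assms(1) summable_LIMSEQ_zero unfolding brjuno_sum_finite_def x_def by blast
  then have "Bseq x" by (intro convergent_imp_Bseq convergentI)
  then obtain C where C: "C > 0" "\<And>\<nu>. norm (x \<nu>) \<le> C" by (auto simp: Bseq_def)
  have "exp (- C) ^ m \<le> w m" if m: "2 \<le> m" for m
  proof -
    obtain \<nu> where \<nu>: "2 ^ \<nu> \<le> m" "m < 2 ^ (\<nu> + 1)"
      using ex_power_ivl1[of 2 m] m by auto
    have w: "0 < w (2 ^ (\<nu> + 1))" by (rule assms(2)) simp
    have "x \<nu> \<le> C" using C(2)[of \<nu>] by simp
    then have "- C * 2 ^ \<nu> \<le> ln (w (2 ^ (\<nu> + 1)))"
      by (simp add: x_def field_simps power_divide)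
    moreover have "C * real (2 ^ \<nu>) \<le> C * real m"
      using C(1) \<nu>(1) by (intro mult_left_mono) (simp_all only: of_nat_le_iff less_imp_le)
    ultimately have "- C * real m \<le> ln (w (2 ^ (\<nu> + 1)))" by simp
    then have "exp (- C * real m) \<le> w (2 ^ (\<nu> + 1))" using w by (metis exp_le_cancel_iff exp_ln)
    also have "\<dots> \<le> w m" by (rule assms(3)[OF m]) (use \<nu> in simp)
    finally show ?thesis by (simp add: mult.commute flip: exp_of_nat_mult)
  qed
  then show ?thesis using C(1) by (intro that[of "exp (- C)"]) auto
qed

text \<open>\<langle>K,lam\<rangle> is itself a divisor, of index K + e_i and component i, with size
  |K| + 1 \<ge> 2. The extra degree is the reason that q also serves as c.\<close>

lemma omega_exponential_bound:
  fixes lam :: "complex^'n::finite"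
  assumes "nonresonant lam" "brjuno_sum_finite (omega lam)"
  obtains c q where "0 < c" "0 < q" "q \<le> 1" "\<And>K. K \<noteq> 0 \<Longrightarrow> c * q ^ mi_size K \<le> cmod (mi_pair K lam)"
proof -
  obtain q where q: "0 < q" "q \<le> 1" "\<And>m. 2 \<le> m \<Longrightarrow> q ^ m \<le> omega lam m"
    using brjuno_sum_exponential_bound[OF assms(2) omega_pos[OF assms(1)] omega_antimono] by blast
  have "q * q ^ mi_size K \<le> cmod (mi_pair K lam)" if "K \<noteq> 0" for K
  proof -
    have "mi_size K > 0" using that by (metis gr0I mi_size_eq_0_iff)
    then have two: "2 \<le> mi_size K + 1" by simp
    have "q ^ (mi_size K + 1) \<le> omega lam (mi_size K + 1)" by (rule q(3)[OF two])
    also have "\<dots> \<le> cmod (mi_pair (K + mi_unit undefined) lam - lam $ undefined)"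
      by (rule omega_le) (use two in simp_all)
    finally show ?thesis by simp
  qed
  with q show ?thesis by (intro that[of q q]) auto
qed

lemma finite_divisors':
  "finite {cmod (mi_pair K lam - \<mu>) |K::'n::finite \<Rightarrow> nat. 2 \<le> mi_size K \<and> mi_size K \<le> m}"
proof (rule finite_subset)
  show "{cmod (mi_pair K lam - \<mu>) |K. 2 \<le> mi_size K \<and> mi_size K \<le> m} \<subseteq>
    (\<lambda>K. cmod (mi_pair K lam - \<mu>)) ` {K. mi_size K \<le> m}" by auto
qed (intro finite_imageI finite_mi_size_le)

lemma omega'_exponential_bound:
  fixes lam :: "complex^'n::finite"
  assumes "generic_connection_value lam \<mu>"
  obtains c q where "0 < c" "0 < q" "q \<le> 1"
    "\<And>K. K \<noteq> 0 \<Longrightarrow> c * q ^ mi_size K \<le> cmod (mi_pair K lam - \<mu>)"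
proof -
  let ?S = "\<lambda>m. {cmod (mi_pair K lam - \<mu>) |K. 2 \<le> mi_size K \<and> mi_size K \<le> m}"
  have nz: "0 < cmod (mi_pair K lam - \<mu>)" if "K \<noteq> 0" for K
    using assms that unfolding generic_connection_value_def zero_fun_def by force
  have ne: "?S m \<noteq> {}" if "2 \<le> m" for m
    using mi_size_two that by (auto intro!: exI[of _ "mi_unit undefined + mi_unit undefined"])
  have pos: "0 < omega' lam \<mu> m" if "2 \<le> m" for m
  proof -
    have "\<forall>x\<in>?S m. 0 < x"
    proof
      fix x assume "x \<in> ?S m"
      then obtain K where K: "x = cmod (mi_pair K lam - \<mu>)" "2 \<le> mi_size K" by blast
      then have "K \<noteq> 0" by auto
      then show "0 < x" using nz K(1) by simp
    qed
    then show ?thesis unfolding omega'_def using Min_gr_iff[OF finite_divisors' ne[OF that]] by blast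
  qed
  have anti: "omega' lam \<mu> m \<le> omega' lam \<mu> k" if "2 \<le> k" "k \<le> m" for k m
    unfolding omega'_def by (rule Min_antimono[OF _ ne[OF that(1)] finite_divisors']) (use that in auto)
  have brj: "brjuno_sum_finite (omega' lam \<mu>)" using assms by (simp add: generic_connection_value_def)
  obtain q where q: "0 < q" "q \<le> 1" "\<And>m. 2 \<le> m \<Longrightarrow> q ^ m \<le> omega' lam \<mu> m"
    using brjuno_sum_exponential_bound[OF brj pos anti] by blast
  \<comment> \<open>\<open>omega'\<close> starts at |K| = 2. The finitely many divisors with |K| = 1
    are nonzero by genericity, and their minimum, capped at 1, covers them.\<close>
  define c where "c = Min (insert 1 ((\<lambda>K. cmod (mi_pair K lam - \<mu>)) ` {K. mi_size K \<le> 1 \<and> K \<noteq> 0}))"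
  have fin: "finite {K :: 'n \<Rightarrow> nat. mi_size K \<le> 1 \<and> K \<noteq> 0}"
    by (rule finite_subset[OF _ finite_mi_size_le[of 1]]) auto
  have c: "0 < c" "c \<le> 1" using fin nz by (auto simp: c_def)
  have "c * q ^ mi_size K \<le> cmod (mi_pair K lam - \<mu>)" if K: "K \<noteq> 0" for K
  proof (cases "mi_size K \<le> 1")
    case True
    have "c * q ^ mi_size K \<le> c * 1" using q c by (intro mult_left_mono power_le_one) auto
    also have "\<dots> \<le> cmod (mi_pair K lam - \<mu>)"
      unfolding c_def mult_1_right by (rule Min_le) (use fin True K in auto)
    finally show ?thesis .
  next
    case False
    have "c * q ^ mi_size K \<le> 1 * q ^ mi_size K" using q c by (intro mult_right_mono) auto
    also have "\<dots> \<le> omega' lam \<mu> (mi_size K)" using q(3) False by simp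
    also have "\<dots> \<le> cmod (mi_pair K lam - \<mu>)"
      unfolding omega'_def by (rule Min_le[OF finite_divisors']) (use False in auto)
    finally show ?thesis .
  qed
  with c q show ?thesis by (intro that[of c q]) auto
qed

section \<open>Calculus of holomorphic maps\<close>

lemma has_derivative_vecI:
  fixes f :: "'a::real_normed_vector \<Rightarrow> complex^'m::finite"
  assumes "\<And>i. ((\<lambda>x. f x $ i) has_derivative (\<lambda>v. f' v $ i)) (at x within S)"
  shows "(f has_derivative f') (at x within S)"
  unfolding has_derivative_componentwise_within[of f]
  by (auto simp: Basis_vec_def inner_axis intro!: has_derivative_inner_left assms)

lemma holo_on_has_derivative:
  assumes "holo_on f U" "z \<in> U"
  shows "(f has_derivative frechet_derivative f (at z)) (at z)"
  using assms unfolding holo_on_def by (metis frechet_derivative_at)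

lemma holo_on_clinear:
  assumes "holo_on f U" "z \<in> U"
  shows "frechet_derivative f (at z) (c *s v) = c * frechet_derivative f (at z) v"
  using assms unfolding holo_on_def by (metis frechet_derivative_at)

lemma holo_onI:
  assumes "open U" "\<And>z. z \<in> U \<Longrightarrow> (f has_derivative D z) (at z)"
    "\<And>z c v. z \<in> U \<Longrightarrow> D z (c *s v) = c * D z v"
  shows "holo_on f U"
  using assms unfolding holo_on_def by blast

lemma holo_map_on_component: "holo_map_on F U \<Longrightarrow> holo_on (\<lambda>z. F z $ i) U"
  by (simp add: holo_map_on_def)

lemma holo_map_on_open: "holo_map_on F U \<Longrightarrow> open U"
  by (simp add: holo_map_on_def holo_on_def)

lemma holo_map_on_has_derivative:
  assumes "holo_map_on F U" "z \<in> U"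
  shows "(F has_derivative frechet_derivative F (at z)) (at z)"
    and "frechet_derivative F (at z) (c *s v) = c *s frechet_derivative F (at z) v"
proof -
  define D where "D v = (\<chi> i. frechet_derivative (\<lambda>z. F z $ i) (at z) v)" for v
  have D: "(F has_derivative D) (at z)"
    by (rule has_derivative_vecI)
       (simp add: D_def holo_on_has_derivative[OF holo_map_on_component[OF assms(1)] assms(2)])
  then have "D = frechet_derivative F (at z)" by (rule frechet_derivative_at)
  moreover have "D (c *s v) = c *s D v"
    by (simp add: D_def vec_eq_iff holo_on_clinear[OF holo_map_on_component[OF assms(1)] assms(2)])
  ultimately show "(F has_derivative frechet_derivative F (at z)) (at z)"
    "frechet_derivative F (at z) (c *s v) = c *s frechet_derivative F (at z) v"
    using D by simp_all
qed

lemma holo_map_onI: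
  assumes "open U" "\<And>z. z \<in> U \<Longrightarrow> (F has_derivative D z) (at z)"
    "\<And>z c v. z \<in> U \<Longrightarrow> D z (c *s v) = c *s D z v"
  shows "holo_map_on F U"
  unfolding holo_map_on_def
proof (intro allI holo_onI[OF assms(1)])
  fix i z assume "z \<in> U"
  then show "((\<lambda>z. F z $ i) has_derivative (\<lambda>v. D z v $ i)) (at z)"
    by (rule bounded_linear.has_derivative[OF bounded_linear_vec_nth assms(2)])
qed (simp add: assms(3))

lemma holo_map_on_continuous_on: "holo_map_on F U \<Longrightarrow> continuous_on U F"
  by (meson continuous_at_imp_continuous_on has_derivative_continuous holo_map_on_has_derivative(1))

lemma holo_on_subset: "holo_on f U \<Longrightarrow> open V \<Longrightarrow> V \<subseteq> U \<Longrightarrow> holo_on f V"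
  unfolding holo_on_def by blast

lemma holo_map_on_subset: "holo_map_on F U \<Longrightarrow> open V \<Longrightarrow> V \<subseteq> U \<Longrightarrow> holo_map_on F V"
  unfolding holo_map_on_def using holo_on_subset by blast

lemma holo_on_cong:
  assumes "holo_on f U" "\<And>z. z \<in> U \<Longrightarrow> g z = f z"
  shows "holo_on g U"
proof (rule holo_onI)
  show U: "open U" using assms(1) by (simp add: holo_on_def)
  fix z c v assume z: "z \<in> U"
  show "(g has_derivative frechet_derivative f (at z)) (at z)"
    by (rule has_derivative_transform_within_open[OF holo_on_has_derivative[OF assms(1) z] U z])
       (simp add: assms(2))
  show "frechet_derivative f (at z) (c *s v) = c * frechet_derivative f (at z) v"
    by (rule holo_on_clinear[OF assms(1) z])
qed

lemma holo_map_on_cong: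
  assumes "holo_map_on F U" "\<And>z. z \<in> U \<Longrightarrow> G z = F z"
  shows "holo_map_on G U"
  using assms unfolding holo_map_on_def by (metis (mono_tags, lifting) holo_on_cong)

lemma holo_on_compose:
  assumes g: "holo_on g W" and F: "holo_map_on F U" and "F ` U \<subseteq> W"
  shows "holo_on (\<lambda>z. g (F z)) U"
    and "z \<in> U \<Longrightarrow> frechet_derivative (\<lambda>z. g (F z)) (at z) v =
      frechet_derivative g (at (F z)) (frechet_derivative F (at z) v)"
proof -
  have D: "((\<lambda>z. g (F z)) has_derivative
      (\<lambda>v. frechet_derivative g (at (F z)) (frechet_derivative F (at z) v))) (at z)" if "z \<in> U" for z
    using has_derivative_compose[OF holo_map_on_has_derivative(1)[OF F that]
       holo_on_has_derivative[OF g]] that assms(3) by blast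
  show "holo_on (\<lambda>z. g (F z)) U"
  proof (rule holo_onI[OF holo_map_on_open[OF F] D])
    fix z c v assume z: "z \<in> U"
    then have "F z \<in> W" using assms(3) by blast
    then show "frechet_derivative g (at (F z)) (frechet_derivative F (at z) (c *s v)) =
      c * frechet_derivative g (at (F z)) (frechet_derivative F (at z) v)"
      by (simp add: holo_map_on_has_derivative(2)[OF F z] holo_on_clinear[OF g])
  qed
  show "frechet_derivative (\<lambda>z. g (F z)) (at z) v =
      frechet_derivative g (at (F z)) (frechet_derivative F (at z) v)" if "z \<in> U"
    by (rule fun_cong[OF frechet_derivative_at[OF D[OF that]], symmetric])
qed

lemma holo_map_on_compose:
  assumes G: "holo_map_on G W" and F: "holo_map_on F U" and "F ` U \<subseteq> W"
  shows "holo_map_on (\<lambda>z. G (F z)) U"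
    and "z \<in> U \<Longrightarrow> frechet_derivative (\<lambda>z. G (F z)) (at z) v =
      frechet_derivative G (at (F z)) (frechet_derivative F (at z) v)"
proof -
  show "holo_map_on (\<lambda>z. G (F z)) U"
    unfolding holo_map_on_def
    by (intro allI holo_on_compose(1)[OF holo_map_on_component[OF G] F assms(3)])
  assume z: "z \<in> U"
  then have "F z \<in> W" using assms(3) by blast
  from fun_cong[OF frechet_derivative_at[OF has_derivative_compose[OF holo_map_on_has_derivative(1)[OF F z]
       holo_map_on_has_derivative(1)[OF G this]]]]
  show "frechet_derivative (\<lambda>z. G (F z)) (at z) v =
      frechet_derivative G (at (F z)) (frechet_derivative F (at z) v)" by (rule sym)
qed

lemma holo_on_mult:
  assumes f: "holo_on f U" and g: "holo_on g U"
  shows "holo_on (\<lambda>z. f z * g z) U"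
    and "z \<in> U \<Longrightarrow> frechet_derivative (\<lambda>z. f z * g z) (at z) v =
      f z * frechet_derivative g (at z) v + frechet_derivative f (at z) v * g z"
proof -
  have D: "((\<lambda>z. f z * g z) has_derivative
     (\<lambda>v. f z * frechet_derivative g (at z) v + frechet_derivative f (at z) v * g z)) (at z)"
    if "z \<in> U" for z
    by (rule has_derivative_mult[OF holo_on_has_derivative[OF f that] holo_on_has_derivative[OF g that]])
  show "holo_on (\<lambda>z. f z * g z) U"
    by (rule holo_onI[OF _ D])
       (use f holo_on_clinear[OF f] holo_on_clinear[OF g] in \<open>auto simp: holo_on_def algebra_simps\<close>)
  show "frechet_derivative (\<lambda>z. f z * g z) (at z) v =
      f z * frechet_derivative g (at z) v + frechet_derivative f (at z) v * g z" if "z \<in> U"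
    by (rule fun_cong[OF frechet_derivative_at[OF D[OF that]], symmetric])
qed

lemma holo_on_exp_mult:
  assumes f: "holo_on f U"
  shows "holo_on (\<lambda>z. exp (c * f z)) U"
    and "z \<in> U \<Longrightarrow> frechet_derivative (\<lambda>z. exp (c * f z)) (at z) v =
      exp (c * f z) * (c * frechet_derivative f (at z) v)"
proof -
  have D: "((\<lambda>z. exp (c * f z)) has_derivative
     (\<lambda>v. exp (c * f z) * (c * frechet_derivative f (at z) v))) (at z)"
    if "z \<in> U" for z
    using has_derivative_compose[OF has_derivative_mult_right[OF holo_on_has_derivative[OF f that]]
       DERIV_exp[unfolded has_field_derivative_def]] .
  show "holo_on (\<lambda>z. exp (c * f z)) U"
    by (rule holo_onI[OF _ D])
       (use f holo_on_clinear[OF f] in \<open>auto simp: holo_on_def algebra_simps\<close>)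
  show "frechet_derivative (\<lambda>z. exp (c * f z)) (at z) v =
      exp (c * f z) * (c * frechet_derivative f (at z) v)" if "z \<in> U"
    by (rule fun_cong[OF frechet_derivative_at[OF D[OF that]], symmetric])
qed

lemma holo_on_const: "open U \<Longrightarrow> holo_on (\<lambda>_. c) U"
  by (rule holo_onI[of _ _ "\<lambda>_ _. 0"]) auto

section \<open>Linear maps and linear parts\<close>

lemma has_derivative_matrix_vector_mult:
  fixes A :: "complex^'n::finite^'m::finite"
  shows "((*v) A has_derivative (*v) A) (at z within S)"
  by (rule bounded_linear_imp_has_derivative)
     (use linear_conv_bounded_linear matrix_vector_mul_linear in blast)

lemma holo_map_on_matrix: "open U \<Longrightarrow> holo_map_on ((*v) A) U"
  by (rule holo_map_onI[OF _ has_derivative_matrix_vector_mult]) (auto simp: vector_scalar_commute)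

lemma frechet_derivative_matrix: "frechet_derivative ((*v) A) (at z) v = (A :: complex^'n::finite^'m::finite) *v v"
  by (rule fun_cong[OF frechet_derivative_at[OF has_derivative_matrix_vector_mult], symmetric])

text \<open>A matrix represents a complex linear map, whereas a Frechet derivative is a priori only
  real linear; holomorphy closes the gap.\<close>

lemma linear_part_mult:
  assumes "holo_map_on X U" "0 \<in> U"
  shows "linear_part X *v v = frechet_derivative X (at 0) v"
proof -
  interpret D: bounded_linear "frechet_derivative X (at 0)"
    by (rule has_derivative_bounded_linear[OF holo_map_on_has_derivative(1)[OF assms]])
  have "Vector_Spaces.linear (*s) (*s) (frechet_derivative X (at 0))"
    by unfold_locales
       (auto simp: D.add holo_map_on_has_derivative(2)[OF assms] vec_eq_iff algebra_simps)
  then show ?thesis unfolding linear_part_def by (rule matrix_works)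
qed

lemma frechet_derivative_ps_eval:
  assumes "abs_conv a r" "z \<in> polydisc r"
  shows "frechet_derivative (ps_eval a) (at z) v = (\<Sum>i\<in>UNIV. v $ i * ps_eval (ps_deriv i a) z)"
  by (rule fun_cong[OF frechet_derivative_at[OF has_derivative_ps_eval[OF assms]], symmetric])

text \<open>Supplies the continuous derivative required by the inverse function theorem.\<close>

lemma continuous_on_ps_deriv:
  fixes a :: "('n::finite \<Rightarrow> nat) \<Rightarrow> complex"
  assumes "abs_conv a r"
  shows "continuous_on (polydisc r) (ps_eval (ps_deriv i a))"
proof (rule continuous_at_imp_continuous_on, rule ballI)
  fix z :: "complex^'n" assume "z \<in> polydisc r"
  then obtain s where s: "0 < s" "s < r" "z \<in> polydisc s" using polydisc_shrink by blast
  have "abs_conv (ps_deriv i a) s" using abs_conv_ps_deriv[OF assms] s by simp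
  from has_derivative_continuous[OF has_derivative_ps_eval[OF this s(3)]]
  show "isCont (ps_eval (ps_deriv i a)) z" .
qed

section \<open>Brjuno's linearization theorem\<close>

lemma mi_size_eq_1: "mi_size K = 1 \<Longrightarrow> \<exists>i. K = mi_unit (i::'n::finite)"
proof -
  assume *: "mi_size K = 1"
  then have "K \<noteq> 0" by auto
  then obtain i where i: "K i \<noteq> 0" by (auto simp: fun_eq_iff)
  have "mi_size (K - mi_unit i) + 1 = 1" using * mi_add_unit_diff[of K i, OF i] by (metis mi_size_add mi_size_unit)
  then have "K - mi_unit i = 0" by simp
  then have "K = mi_unit i" using mi_add_unit_diff[of K i, OF i] by simp
  then show ?thesis by blast
qed

lemma holo_map_on_power_series:
  fixes Y :: "complex^'n::finite \<Rightarrow> complex^'n"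
  assumes Y: "holo_map_on Y U" and "0 \<in> U"
  shows "\<exists>y \<rho>. \<rho> > 0 \<and> cpolydisc \<rho> \<subseteq> U \<and> (\<forall>j. abs_conv (y j) \<rho>) \<and>
    (\<forall>j. \<forall>z\<in>cpolydisc \<rho>. Y z $ j = ps_eval (y j) z)"
proof -
  have "\<exists>a r. r > 0 \<and> cpolydisc r \<subseteq> U \<and> abs_conv a r \<and> (\<forall>z\<in>cpolydisc r. Y z $ j = ps_eval a z)" for j
    by (rule holo_on_power_series[OF holo_map_on_component[OF Y] assms(2), of j]) blast
  then obtain y r where yr: "\<And>j. r j > 0" "\<And>j. cpolydisc (r j) \<subseteq> U" "\<And>j. abs_conv (y j) (r j)"
    "\<And>j z. z \<in> cpolydisc (r j) \<Longrightarrow> Y z $ j = ps_eval (y j) z" by metis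
  define \<rho> where "\<rho> = Min (range r)"
  have \<rho>: "\<rho> \<le> r j" for j unfolding \<rho>_def by (rule Min_le) auto
  have "\<rho> \<in> range r" unfolding \<rho>_def by (rule Min_in) auto
  then have "\<rho> > 0" using yr(1) by auto
  have sub: "cpolydisc \<rho> \<subseteq> cpolydisc (r j)" for j by (rule cpolydisc_mono[OF \<rho>])
  have "abs_conv (y j) \<rho>" for j
    by (rule abs_conv_mono[OF yr(3)]) (use \<rho> \<open>\<rho> > 0\<close> in auto)
  moreover have "cpolydisc \<rho> \<subseteq> U" using sub yr(2) by blast
  moreover have "Y z $ j = ps_eval (y j) z" if "z \<in> cpolydisc \<rho>" for j z
    using yr(4) sub that by blast
  ultimately show ?thesis using \<open>\<rho> > 0\<close> by blast
qed

text \<open>The recursion for the series says, coefficient by coefficient, that H carries the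
  diagonal linear field to Y. Its derivative at 0 is the identity, so H has a local holomorphic
  inverse g, and g is the linearizing chart.\<close>

lemma linearization_diagonal:
  fixes lam :: "complex^'n::finite"
  assumes nonres: "nonresonant lam" and brj: "brjuno_sum_finite (omega lam)"
    and Y: "holo_map_on Y U" and "0 \<in> U" and "Y 0 = 0"
    and lin: "\<And>v. frechet_derivative Y (at 0) v = lin_field lam v"
  shows "\<exists>V W H g. open W \<and> 0 \<in> V \<and> W \<subseteq> U \<and> H 0 = 0 \<and> homeomorphism V W H g \<and>
    holo_map_on H V \<and> holo_map_on g W \<and>
    (\<forall>z\<in>W. frechet_derivative g (at z) (Y z) = lin_field lam (g z))"
proof -
  obtain y \<rho> where \<rho>: "\<rho> > 0" "cpolydisc \<rho> \<subseteq> U" and y: "\<And>j. abs_conv (y j) \<rho>"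
    and Yy: "\<And>j z. z \<in> cpolydisc \<rho> \<Longrightarrow> Y z $ j = ps_eval (y j) z"
    using holo_map_on_power_series[OF Y \<open>0 \<in> U\<close>] by blast
  have z0: "(0 :: complex^'n) \<in> cpolydisc \<rho>" "(0 :: complex^'n) \<in> polydisc \<rho>"
    using \<rho> by (auto simp: cpolydisc_def polydisc_def)
  have y0: "y j 0 = 0" for j using Yy[OF z0(1), of j] \<open>Y 0 = 0\<close> by (simp add: ps_eval_at_0)
  have y1: "y j (mi_unit i) = (if i = j then lam $ j else 0)" for i j
  proof -
    have "((\<lambda>z. Y z $ j) has_derivative (\<lambda>v. \<Sum>i\<in>UNIV. v $ i * ps_eval (ps_deriv i (y j)) 0)) (at 0)"
      by (rule has_derivative_transform_within_open[OF has_derivative_ps_eval[OF y z0(2)] open_polydisc z0(2)])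
         (simp add: Yy subsetD[OF polydisc_subset_cpolydisc])
    moreover have "((\<lambda>z. Y z $ j) has_derivative (\<lambda>v. frechet_derivative Y (at 0) v $ j)) (at 0)"
      by (rule bounded_linear.has_derivative[OF bounded_linear_vec_nth holo_map_on_has_derivative(1)[OF Y \<open>0 \<in> U\<close>]])
    ultimately have "(\<lambda>v. \<Sum>i\<in>UNIV. v $ i * ps_eval (ps_deriv i (y j)) 0) = (\<lambda>v. frechet_derivative Y (at 0) v $ j)"
      by (rule has_derivative_unique)
    from fun_cong[OF this, of "axis i 1"]
    have "(\<Sum>k\<in>UNIV. (axis i 1 :: complex^'n) $ k * ps_deriv k (y j) 0) = lam $ j * axis i 1 $ j"
      by (simp add: lin ps_eval_at_0)
    moreover have "(\<Sum>k\<in>UNIV. (axis i 1 :: complex^'n) $ k * ps_deriv k (y j) 0) =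
       (\<Sum>k\<in>UNIV. if k = i then ps_deriv k (y j) 0 else 0)"
      by (rule sum.cong) (auto simp: axis_def)
    ultimately show ?thesis by (auto simp: ps_deriv_def axis_def split: if_splits)
  qed
  define R where "R j K = (if mi_size K < 2 then 0 else y j K)" for j and K :: "'n \<Rightarrow> nat"
  have R: "abs_conv (R j) \<rho>" for j
    by (rule abs_conv_mono[OF y]) (use \<rho> in \<open>auto simp: R_def\<close>)
  have YR: "Y z $ j = lam $ j * z $ j + ps_eval (R j) z" if z: "z \<in> cpolydisc \<rho>" for z j
  proof -
    have "y j K * mon z K = (if K = mi_unit j then lam $ j * z $ j else 0) + R j K * mon z K" for K
    proof (cases "mi_size K < 2")
      case True
      then consider "K = 0" | i where "K = mi_unit i"
        using mi_size_eq_1[of K] less_2_cases[of "mi_size K"] mi_size_eq_0_iff[of K]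
        unfolding One_nat_def by blast
      then show ?thesis
      proof cases
        case 1
        then show ?thesis by (simp add: y0 R_def)
      next
        case 2
        have "mi_unit i = mi_unit j \<longleftrightarrow> i = j" by (metis mi_unit_nth zero_neq_one)
        then show ?thesis unfolding 2 by (simp add: y1 R_def)
      qed
    next
      case False
      then have "K \<noteq> mi_unit j" by auto
      then show ?thesis using False by (simp add: R_def)
    qed
    moreover have "((\<lambda>K. (if K = mi_unit j then lam $ j * z $ j else 0) + R j K * mon z K) has_sum
        (lam $ j * z $ j + ps_eval (R j) z)) UNIV"
    proof (intro has_sum_add abs_conv_has_sum[OF R z])
      show "((\<lambda>K. if K = mi_unit j then lam $ j * z $ j else 0) has_sum lam $ j * z $ j) UNIV"
        by (rule has_sum_finite_neutralI[of "{mi_unit j}"]) auto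
    qed
    ultimately have "((\<lambda>K. y j K * mon z K) has_sum (lam $ j * z $ j + ps_eval (R j) z)) UNIV" by simp
    then have "ps_eval (y j) z = lam $ j * z $ j + ps_eval (R j) z"
      unfolding ps_eval_def[of "y j"] by (rule infsumI)
    then show ?thesis using Yy[OF z] by simp
  qed
  define h where "h = lin_series lam R"
  obtain r s where rs: "r > 0" "0 < s" "s \<le> \<rho>" and h: "\<And>j. weighted_le (\<lambda>K. r ^ mi_size K) (h j) s"
  proof -
    have "\<exists>r s. r > 0 \<and> 0 < s \<and> s \<le> \<rho> \<and> (\<forall>j. weighted_le (\<lambda>K. r ^ mi_size K) (h j) s)"
      unfolding h_def by (rule lin_series_bound[where R = R, OF nonres brj \<rho>(1) R]) blast
    with that show thesis by blast
  qed
  have h0: "h j 0 = 0" for j by (simp add: h_def)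
  have hconv: "abs_conv (h j) r" for j using weighted_le_imp_abs_conv[OF h] rs by simp
  define H where "H z = (\<chi> j. ps_eval (h j) z)" for z
  have Hs: "H z \<in> cpolydisc \<rho>" if "z \<in> cpolydisc r" for z
  proof -
    have "H z \<in> cpolydisc s" using norm_ps_eval_le[OF h _ that] rs by (auto simp: H_def cpolydisc_def)
    then show ?thesis using cpolydisc_mono[OF rs(3)] by blast
  qed
  define J where "J z v = (\<chi> j. \<Sum>i\<in>UNIV. v $ i * ps_eval (ps_deriv i (h j)) z)" for z v
  have HJ: "(H has_derivative J z) (at z)" if "z \<in> polydisc r" for z
    by (rule has_derivative_vecI) (simp add: H_def J_def has_derivative_ps_eval[OF hconv that])
  have J_lin: "J z (c *s v) = c *s J z v" for z c v
    by (simp add: J_def vec_eq_iff sum_distrib_left mult_ac)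
  have J0: "J 0 v = v" for v
  proof -
    have "(\<Sum>i\<in>UNIV. v $ i * ps_eval (ps_deriv i (h j)) 0) = (\<Sum>i\<in>UNIV. if i = j then v $ i else 0)" for j
      by (rule sum.cong) (auto simp: ps_eval_at_0 ps_deriv_def h_def lin_series_unit)
    then show ?thesis by (simp add: J_def vec_eq_iff)
  qed
  have conj: "J z (lin_field lam z) = Y (H z)" if z: "z \<in> polydisc r" for z
  proof -
    have zc: "z \<in> cpolydisc r" using z polydisc_subset_cpolydisc by blast
    have "J z (lin_field lam z) $ j = Y (H z) $ j" for j
    proof -
      have "((\<lambda>K. lam $ j * (h j K * mon z K) + ps_subst_coeff (R j) h K * mon z K) has_sum
        (lam $ j * ps_eval (h j) z + ps_eval (R j) (H z))) UNIV"
        unfolding H_def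
      proof (intro has_sum_add has_sum_cmult_right abs_conv_has_sum[OF hconv zc] has_sum_ps_subst[OF h h0 _ _ _ zc])
        show "abs_conv (R j) s" by (rule abs_conv_mono[OF R]) (use rs in auto)
      qed (use rs in \<open>auto simp: R_def\<close>)
      moreover have "lam $ j * (h j K * mon z K) + ps_subst_coeff (R j) h K * mon z K = mi_pair K lam * (h j K * mon z K)" for K
        unfolding h_def lin_series_homological[OF nonres, symmetric] by (simp add: algebra_simps)
      ultimately have "((\<lambda>K. mi_pair K lam * (h j K * mon z K)) has_sum
        (lam $ j * ps_eval (h j) z + ps_eval (R j) (H z))) UNIV" by simp
      then have "(\<Sum>i\<in>UNIV. lin_field lam z $ i * ps_eval (ps_deriv i (h j)) z) =
         lam $ j * ps_eval (h j) z + ps_eval (R j) (H z)"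
        by (rule has_sum_unique[OF has_sum_lin_field[OF hconv z]])
      then show ?thesis using YR[OF Hs[OF zc], of j] by (simp add: J_def H_def)
    qed
    then show ?thesis by (simp add: vec_eq_iff)
  qed
  \<comment> \<open>The inverse function theorem wants the derivative as a continuous map into the
    space of bounded operators.\<close>
  define f' where "f' z = Blinfun (J z)" for z
  have f': "blinfun_apply (f' z) = J z" if "z \<in> polydisc r" for z
    unfolding f'_def by (rule bounded_linear_Blinfun_apply[OF has_derivative_bounded_linear[OF HJ[OF that]]])
  have f'_cont: "continuous_on (polydisc r) f'"
  proof (rule continuous_on_blinfun_componentwise)
    fix b :: "complex^'n"
    have "continuous_on (polydisc r) (\<lambda>z. J z b)"
      unfolding J_def by (intro continuous_on_vec_lambda continuous_intros continuous_on_ps_deriv hconv)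
    then show "continuous_on (polydisc r) (\<lambda>z. f' z b)"
      by (rule continuous_on_eq) (simp add: f')
  qed
  have r0: "(0 :: complex^'n) \<in> polydisc r" using rs by simp
  have id: "id_blinfun o\<^sub>L f' 0 = id_blinfun"
    by (rule blinfun_eqI) (simp add: f'[OF r0] J0)
  have HJ': "(H has_derivative blinfun_apply (f' z)) (at z)" if "z \<in> polydisc r" for z
    using HJ[OF that] f'[OF that] by simp
  obtain V W g g' where V: "open V" "V \<subseteq> polydisc r" "0 \<in> V" and W: "open W" "H 0 \<in> W"
    and hom: "homeomorphism V W H g"
    and g: "\<And>w. w \<in> W \<Longrightarrow> (g has_derivative (g' w)) (at w)"
    and g': "\<And>w. w \<in> W \<Longrightarrow> g' w = inv (blinfun_apply (f' (g w)))"
    and bij: "\<And>w. w \<in> W \<Longrightarrow> bij (blinfun_apply (f' (g w)))"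
  proof (rule inverse_function_theorem[OF open_polydisc HJ' f'_cont r0 id])
    fix V W g g'
    assume "open V" "V \<subseteq> polydisc r" "0 \<in> V" "open W" "H 0 \<in> W" "homeomorphism V W H g"
      "\<And>w. w \<in> W \<Longrightarrow> (g has_derivative (g' w)) (at w)"
      "\<And>w. w \<in> W \<Longrightarrow> g' w = inv (blinfun_apply (f' (g w)))"
      "\<And>w. w \<in> W \<Longrightarrow> bij (blinfun_apply (f' (g w)))"
    then show thesis by (rule that)
  qed
  have gV: "g w \<in> V" "g w \<in> polydisc r" "H (g w) = w" if "w \<in> W" for w
    using hom V that by (auto simp: homeomorphism_def)
  have gJ: "g' w = inv (J (g w))" "bij (J (g w))" if "w \<in> W" for w
    using g'[OF that] bij[OF that] f'[OF gV(2)[OF that]] by simp_all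
  have inv_J: "g' w (J (g w) v) = v" "J (g w) (g' w v) = v" if "w \<in> W" for w v
    using gJ[OF that] by (simp_all add: bij_is_inj bij_is_surj surj_f_inv_f)
  \<comment> \<open>The inverse function theorem is real; g is holomorphic because the inverse of
    the complex linear map J is complex linear.\<close>
  have g'_lin: "g' w (c *s v) = c *s g' w v" if "w \<in> W" for w c v
  proof -
    have "J (g w) (c *s g' w v) = c *s v" by (simp add: J_lin inv_J[OF that])
    then show ?thesis by (metis inv_J(1)[OF that])
  qed
  have H0: "H 0 = 0" by (simp add: H_def vec_eq_iff ps_eval_at_0 h0)
  have "W \<subseteq> U"
  proof
    fix w assume w: "w \<in> W"
    have "H (g w) \<in> cpolydisc \<rho>" using Hs gV(2)[OF w] polydisc_subset_cpolydisc by blast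
    then show "w \<in> U" using \<rho> gV(3)[OF w] by auto
  qed
  moreover have "holo_map_on H V"
    by (rule holo_map_onI[OF V(1) HJ J_lin]) (use V in auto)
  moreover have "holo_map_on g W" by (rule holo_map_onI[OF W(1) g g'_lin])
  moreover have "frechet_derivative g (at w) (Y w) = lin_field lam (g w)" if w: "w \<in> W" for w
  proof -
    have "frechet_derivative g (at w) = g' w" using frechet_derivative_at[OF g[OF w]] by simp
    moreover have "Y w = J (g w) (lin_field lam (g w))" using conj[OF gV(2)[OF w]] gV(3)[OF w] by simp
    ultimately show ?thesis by (simp add: inv_J[OF w])
  qed
  ultimately show ?thesis using V(3) W(1) H0 hom by blast
qed

text \<open>Reduction to the diagonal case by the linear change of coordinates P. The chart is g
  after the inverse Q of P, with inverse P after H.\<close>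

theorem brjuno_linearization:
  fixes X :: "complex^'n::finite \<Rightarrow> complex^'n"
  assumes X: "holo_map_on X U" and "0 \<in> U" and "X 0 = 0" and brj: "brjuno_condition X lam"
  obtains V \<phi> where "open V" "0 \<in> V" "V \<subseteq> U" "biholo_on \<phi> V" "\<phi> 0 = 0"
    "\<And>z. z \<in> V \<Longrightarrow> frechet_derivative \<phi> (at z) (X z) = lin_field lam (\<phi> z)"
proof -
  obtain P :: "complex^'n^'n" where P: "invertible P" "linear_part X = P ** diag_mat lam ** matrix_inv P"
    using brj by (auto simp: brjuno_condition_def diagonalizable_with_def)
  define Q where "Q = matrix_inv P"
  have "P ** Q = mat 1 \<and> Q ** P = mat 1"
    unfolding Q_def matrix_inv_def by (rule someI_ex[OF P(1)[unfolded invertible_def]])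
  then have PQ: "P *v (Q *v v) = v" "Q *v (P *v v) = v" for v
    by (simp_all add: matrix_vector_mul_assoc)
  have contM: "continuous_on A ((*v) M)" for A and M :: "complex^'n^'n"
    using holo_map_on_continuous_on[OF holo_map_on_matrix[OF open_UNIV]] continuous_on_subset by blast
  have "open U" by (rule holo_map_on_open[OF X])
  define U' where "U' = {w. P *v w \<in> U}"
  have U': "open U'" unfolding U'_def
    using open_vimage[OF \<open>open U\<close> contM[of UNIV P]] by (simp add: vimage_def)
  have P_holo: "holo_map_on ((*v) P) U'" by (rule holo_map_on_matrix[OF U'])
  have PU: "(*v) P ` U' \<subseteq> U" by (auto simp: U'_def)
  note XP = holo_map_on_compose[OF X P_holo PU]
  define Y where "Y w = Q *v X (P *v w)" for w
  note QXP = holo_map_on_compose[OF holo_map_on_matrix[OF open_UNIV, of Q] XP(1)]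
  have Y: "holo_map_on Y U'" unfolding Y_def by (rule QXP(1)) simp
  have U'0: "0 \<in> U'" using \<open>0 \<in> U\<close> by (simp add: U'_def)
  have "frechet_derivative Y (at 0) v = lin_field lam v" for v
  proof -
    have "frechet_derivative Y (at 0) v = Q *v (frechet_derivative X (at (P *v 0)) (P *v v))"
      unfolding Y_def using QXP(2)[OF subset_UNIV U'0] XP(2)[OF U'0] by (simp add: frechet_derivative_matrix)
    also have "\<dots> = Q *v (linear_part X *v (P *v v))"
      using linear_part_mult[OF X \<open>0 \<in> U\<close>] by simp
    also have "\<dots> = diag_mat lam *v v"
      unfolding P(2) Q_def[symmetric] by (simp add: PQ flip: matrix_vector_mul_assoc)
    finally show ?thesis by (simp add: diag_mat_mult)
  qed
  moreover have "Y 0 = 0" using \<open>X 0 = 0\<close> by (simp add: Y_def)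
  moreover have "nonresonant lam" "brjuno_sum_finite (omega lam)"
    using brj by (auto simp: brjuno_condition_def)
  ultimately obtain V W H g where W: "open W" "0 \<in> V" "W \<subseteq> U'" and H0: "H 0 = 0"
    and hom: "homeomorphism V W H g" and H: "holo_map_on H V" and g: "holo_map_on g W"
    and conj: "\<And>z. z \<in> W \<Longrightarrow> frechet_derivative g (at z) (Y z) = lin_field lam (g z)"
    using linearization_diagonal[OF _ _ Y U'0] by metis
  have gV: "g w \<in> V" "H (g w) = w" if "w \<in> W" for w
    using hom that by (auto simp: homeomorphism_def)
  have HW: "H v \<in> W" "g (H v) = v" if "v \<in> V" for v
    using hom that by (auto simp: homeomorphism_def)
  define V1 where "V1 = {z. Q *v z \<in> W}"
  define \<phi> where "\<phi> z = g (Q *v z)" for z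
  have V1: "open V1" unfolding V1_def
    using open_vimage[OF W(1) contM[of UNIV Q]] by (simp add: vimage_def)
  have Q_holo: "holo_map_on ((*v) Q) V1" by (rule holo_map_on_matrix[OF V1])
  have QW: "(*v) Q ` V1 \<subseteq> W" by (auto simp: V1_def)
  note gQ = holo_map_on_compose[OF g Q_holo QW]
  have W0: "0 \<in> W" using HW(1)[OF W(2)] H0 by simp
  have V10: "0 \<in> V1" using W0 by (simp add: V1_def)
  have V1U: "V1 \<subseteq> U"
  proof
    fix z assume "z \<in> V1"
    then have "Q *v z \<in> U'" using W(3) by (auto simp: V1_def)
    then show "z \<in> U" by (simp add: U'_def PQ)
  qed
  have inj: "inj_on \<phi> V1"
  proof (rule inj_onI)
    fix z z' assume "z \<in> V1" "z' \<in> V1" "\<phi> z = \<phi> z'"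
    then have "Q *v z = Q *v z'" unfolding V1_def \<phi>_def by (metis gV(2) mem_Collect_eq)
    then show "z = z'" by (metis PQ(1))
  qed
  have inv: "P *v H v \<in> V1" "\<phi> (P *v H v) = v" if "v \<in> V" for v
    using HW[OF that] by (auto simp: V1_def \<phi>_def PQ)
  have img: "\<phi> ` V1 = V"
  proof
    show "\<phi> ` V1 \<subseteq> V" using gV(1) by (auto simp: \<phi>_def V1_def)
    show "V \<subseteq> \<phi> ` V1" using inv by (metis image_eqI subsetI)
  qed
  have "holo_map_on (\<lambda>v. P *v H v) V"
    by (rule holo_map_on_compose(1)[OF holo_map_on_matrix[OF open_UNIV] H]) simp
  then have "holo_map_on (the_inv_into V1 \<phi>) V"
    by (rule holo_map_on_cong) (use inv inj in \<open>auto intro!: the_inv_into_f_eq\<close>)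
  moreover have "holo_map_on \<phi> V1" unfolding \<phi>_def by (rule gQ(1))
  ultimately have "biholo_on \<phi> V1"
    unfolding biholo_on_def img using inj holo_map_on_open[OF H] by blast
  moreover have "\<phi> 0 = 0" using HW(2)[OF W(2)] H0 by (simp add: \<phi>_def)
  moreover have "frechet_derivative \<phi> (at z) (X z) = lin_field lam (\<phi> z)" if z: "z \<in> V1" for z
  proof -
    have "frechet_derivative \<phi> (at z) (X z) = frechet_derivative g (at (Q *v z)) (Q *v X z)"
      unfolding \<phi>_def using gQ(2)[OF z] by (simp add: frechet_derivative_matrix)
    also have "Q *v X z = Y (Q *v z)" by (simp add: Y_def PQ)
    also have "frechet_derivative g (at (Q *v z)) (Y (Q *v z)) = lin_field lam (\<phi> z)"
      unfolding \<phi>_def[of z] by (rule conj) (use z in \<open>simp add: V1_def\<close>)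
    finally show ?thesis .
  qed
  ultimately show ?thesis using that V1 V10 V1U by blast
qed

section \<open>Normalization of the connection\<close>

text \<open>If the field maps F to g + \<mu>, the product rule turns the left side, for h = k exp (-
  F), into exp (- F) times (field applied to k, minus \<mu> k). As g + \<mu> vanishes at 0, the
  equation for F is solvable.\<close>

lemma constant_christoffel_in_linear_coords:
  fixes lam :: "complex^'n::finite"
  assumes g: "holo_on g W" and "0 \<in> W" and "g 0 = - \<mu>"
    and nonres: "nonresonant lam" and brj: "brjuno_sum_finite (omega lam)"
    and gen: "generic_connection_value lam \<mu>"
  obtains s h where "s > 0" "polydisc s \<subseteq> W" "holo_on h (polydisc s)" "h 0 = 1"
    "\<And>w. w \<in> polydisc s \<Longrightarrow> frechet_derivative h (at w) (lin_field lam w) + g w * h w = - \<mu>"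
proof -
  obtain a r where ar: "r > 0" "cpolydisc r \<subseteq> W" "abs_conv a r" "\<And>z. z \<in> cpolydisc r \<Longrightarrow> g z = ps_eval a z"
    by (rule holo_on_power_series[OF g \<open>0 \<in> W\<close>]) (rule that)
  have a0: "a 0 = - \<mu>"
    using ar(4)[of 0] ar(1) \<open>g 0 = - \<mu>\<close> by (simp add: ps_eval_at_0 cpolydisc_def)
  have "\<exists>c q. 0 < c \<and> 0 < q \<and> q \<le> 1 \<and> (\<forall>K. K \<noteq> 0 \<longrightarrow> c * q ^ mi_size K \<le> cmod (mi_pair K lam - 0))"
    by (rule omega_exponential_bound[OF nonres brj]) auto
  then obtain c q where cq: "0 < c" "0 < q" "q \<le> 1"
    "\<And>K. K \<noteq> 0 \<Longrightarrow> c * q ^ mi_size K \<le> cmod (mi_pair K lam - 0)" by blast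
  obtain F s1 where F: "0 < s1" "s1 \<le> r" "abs_conv F s1" "F 0 = 0" and
    F_eq: "\<And>z. z \<in> polydisc s1 \<Longrightarrow>
      (\<Sum>i\<in>UNIV. lin_field lam z $ i * ps_eval (ps_deriv i F) z) = 0 * ps_eval F z + ps_eval a z - a 0 - 0 * 0"
    using linear_homological_equation[OF ar(3,1) cq(4,1-3), where \<kappa> = 0] by blast
  \<comment> \<open>The inhomogeneous term of the equation for k. It is expanded anew as a
    holomorphic function, which avoids exponentiating a series by coefficients.\<close>
  define e where "e w = - \<mu> * exp (1 * ps_eval F w)" for w
  note expF = holo_on_exp_mult[OF holo_on_ps_eval[OF F(3)]]
  have s10: "(0 :: complex^'n) \<in> polydisc s1" using F(1) by simp
  have e: "holo_on e (polydisc s1)"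
    unfolding e_def by (rule holo_on_mult(1)[OF holo_on_const[OF open_polydisc] expF(1)])
  obtain b r2 where b: "r2 > 0" "cpolydisc r2 \<subseteq> (polydisc s1 :: (complex^'n) set)" "abs_conv b r2"
    "\<And>z. z \<in> cpolydisc r2 \<Longrightarrow> e z = ps_eval b z"
    by (rule holo_on_power_series[OF e s10]) (rule that)
  have b0: "b 0 = - \<mu>"
    using b(4)[of 0] b(1) F(4) by (simp add: ps_eval_at_0 cpolydisc_def e_def)
  have "\<exists>c q. 0 < c \<and> 0 < q \<and> q \<le> 1 \<and> (\<forall>K. K \<noteq> 0 \<longrightarrow> c * q ^ mi_size K \<le> cmod (mi_pair K lam - \<mu>))"
    by (rule omega'_exponential_bound[OF gen]) auto
  then obtain c' q' where cq': "0 < c'" "0 < q'" "q' \<le> 1"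
    "\<And>K. K \<noteq> 0 \<Longrightarrow> c' * q' ^ mi_size K \<le> cmod (mi_pair K lam - \<mu>)" by blast
  \<comment> \<open>Because F vanishes at 0, \<open>b 0 = - \<mu>\<close>; with
    \<open>k 0 = 1\<close> the constants of the general equation cancel.\<close>
  obtain k s where k: "0 < s" "s \<le> r2" "abs_conv k s" "k 0 = 1" and
    k_eq: "\<And>z. z \<in> polydisc s \<Longrightarrow>
      (\<Sum>i\<in>UNIV. lin_field lam z $ i * ps_eval (ps_deriv i k) z) = \<mu> * ps_eval k z + ps_eval b z - b 0 - \<mu> * 1"
    using linear_homological_equation[OF b(3,1) cq'(4,1-3), where \<kappa> = 1] by blast
  have sub: "polydisc s \<subseteq> (cpolydisc r2 :: (complex^'n) set)"
    using polydisc_subset_cpolydisc polydisc_mono[OF k(2)] by blast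
  have sub1: "polydisc s \<subseteq> (polydisc s1 :: (complex^'n) set)" using sub b(2) by blast
  have subr: "polydisc s \<subseteq> (cpolydisc r :: (complex^'n) set)"
    using sub1 polydisc_subset_cpolydisc cpolydisc_mono[OF F(2)] by blast
  define h where "h w = ps_eval k w * exp (- 1 * ps_eval F w)" for w
  note kholo = holo_on_ps_eval[OF k(3)]
  have eF: "holo_on (\<lambda>w. exp (- 1 * ps_eval F w)) (polydisc s)"
    by (rule holo_on_subset[OF expF(1) open_polydisc sub1])
  have "frechet_derivative h (at w) (lin_field lam w) + g w * h w = - \<mu>" if w: "w \<in> polydisc s" for w
  proof -
    have w1: "w \<in> polydisc s1" using w sub1 by blast
    have dF: "frechet_derivative (ps_eval F) (at w) (lin_field lam w) = g w + \<mu>"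
      using frechet_derivative_ps_eval[OF F(3) w1] F_eq[OF w1] ar(4) subr w a0 by auto
    have dk: "frechet_derivative (ps_eval k) (at w) (lin_field lam w) =
       \<mu> * ps_eval k w - \<mu> * exp (ps_eval F w)"
      using frechet_derivative_ps_eval[OF k(3) w] k_eq[OF w] b(4)[of w] sub w b0 by (auto simp: e_def)
    have "frechet_derivative h (at w) (lin_field lam w) =
      ps_eval k w * (exp (- 1 * ps_eval F w) * (- 1 * (g w + \<mu>))) +
      (\<mu> * ps_eval k w - \<mu> * exp (ps_eval F w)) * exp (- 1 * ps_eval F w)"
      unfolding h_def holo_on_mult(2)[OF kholo eF w] expF(2)[OF w1] dF dk ..
    also have "\<dots> = - (g w * h w) - \<mu> * (exp (ps_eval F w) * exp (- 1 * ps_eval F w))"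
      by (simp add: h_def algebra_simps)
    also have "exp (ps_eval F w) * exp (- 1 * ps_eval F w) = 1" by (simp flip: exp_add)
    finally show ?thesis by simp
  qed
  moreover have "holo_on h (polydisc s)" unfolding h_def by (rule holo_on_mult(1)[OF kholo eF])
  moreover have "h 0 = 1" by (simp add: h_def ps_eval_at_0 F(4) k(4))
  moreover have "polydisc s \<subseteq> W" using subr ar(2) by blast
  ultimately show ?thesis using that k(1) by blast
qed

theorem theorem3p2:
  fixes U :: "(complex^'n::finite) set"
    and Z :: "complex^'n \<Rightarrow> complex^'n"
    and lam :: "complex^'n"
    and nabla :: "(complex^'n) set \<Rightarrow> (complex^'n \<Rightarrow> complex^'n) \<Rightarrow> complex^'n \<Rightarrow> complex"
    and \<gamma> :: "complex^'n \<Rightarrow> complex"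
    and \<mu> :: complex
  assumes "open U" and "0 \<in> U"
    and "holo_map_on Z U" and "Z 0 = 0"
    and "codim_ge_two {z\<in>U. Z z = 0}"
    and "invertible (linear_part Z)"
    and "brjuno_condition Z lam"
    and "foliated_connection U Z nabla"
    and "\<gamma> = nabla U Z"
    and "\<mu> = - \<gamma> 0"
    and "generic_connection_value lam \<mu>"
  shows "\<exists>V \<phi> Z'. open V \<and> 0 \<in> V \<and> V \<subseteq> U \<and>
           biholo_on \<phi> V \<and> \<phi> 0 = 0 \<and>
           generator_on Z V Z' \<and> linear_in_coords \<phi> V Z' \<and>
           (\<exists>c. \<forall>z\<in>V. nabla V Z' z = c)"
proof -
  note Z = \<open>holo_map_on Z U\<close>
  have nonres: "nonresonant lam" and brj: "brjuno_sum_finite (omega lam)"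
    using \<open>brjuno_condition Z lam\<close> by (auto simp: brjuno_condition_def)
  have Z_section: "Z \<in> sections_on Z V" if "open V" for V
    unfolding sections_on_def using holo_on_const[OF that, of 1] by auto
  note conn = \<open>foliated_connection U Z nabla\<close>[unfolded foliated_connection_def]
  have nabla_holo: "holo_on (nabla V X) V" if "open V" "V \<subseteq> U" "X \<in> sections_on Z V" for V X
    by (rule conn[THEN conjunct1, rule_format]) (simp add: that)
  have nabla_mult: "nabla V (\<lambda>w. f w *s X w) z = vf_apply X f z + f z * nabla V X z"
    if "open V" "V \<subseteq> U" "X \<in> sections_on Z V" "holo_on f V" "z \<in> V" for V X f z
    by (rule conn[THEN conjunct2, THEN conjunct2, THEN conjunct1, rule_format]) (simp_all add: that)
  \<comment> \<open>\<gamma> is the symbol over U, while the field is rescaled only near 0; the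
    sheaf clause identifies the two symbols of Z.\<close>
  have nabla_restrict: "nabla V Z z = \<gamma> z" if "open V" "V \<subseteq> U" "z \<in> V" for V z
    using conn[THEN conjunct2, THEN conjunct2, THEN conjunct2, rule_format, of U V Z Z z]
      that Z_section \<open>open U\<close> \<open>\<gamma> = nabla U Z\<close> by simp
  have \<gamma>: "holo_on \<gamma> U"
    unfolding \<open>\<gamma> = nabla U Z\<close> by (rule nabla_holo[OF \<open>open U\<close> order_refl Z_section[OF \<open>open U\<close>]])
  obtain V1 \<phi>1 where V1: "open V1" "0 \<in> V1" "V1 \<subseteq> U" and \<phi>1: "biholo_on \<phi>1 V1" "\<phi>1 0 = 0"
    and conj1: "\<And>z. z \<in> V1 \<Longrightarrow> frechet_derivative \<phi>1 (at z) (Z z) = lin_field lam (\<phi>1 z)"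
    by (rule brjuno_linearization[OF Z \<open>0 \<in> U\<close> \<open>Z 0 = 0\<close> \<open>brjuno_condition Z lam\<close>]) (rule that)
  define \<psi> where "\<psi> = the_inv_into V1 \<phi>1"
  have inj: "inj_on \<phi>1 V1" and \<phi>1_holo: "holo_map_on \<phi>1 V1" and \<psi>: "holo_map_on \<psi> (\<phi>1 ` V1)"
    using \<phi>1(1) by (auto simp: biholo_on_def \<psi>_def)
  have \<psi>\<phi>: "\<psi> (\<phi>1 z) = z" if "z \<in> V1" for z
    unfolding \<psi>_def by (rule the_inv_into_f_f[OF inj that])
  define g where "g w = \<gamma> (\<psi> w)" for w
  have g: "holo_on g (\<phi>1 ` V1)"
    unfolding g_def by (rule holo_on_compose(1)[OF \<gamma> \<psi>]) (use \<psi>\<phi> V1 in auto)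
  have W0: "0 \<in> \<phi>1 ` V1" using V1(2) \<phi>1(2) by force
  have g0: "g 0 = - \<mu>" using \<psi>\<phi>[OF V1(2)] \<phi>1(2) \<open>\<mu> = - \<gamma> 0\<close> by (simp add: g_def)
  obtain s hh where s: "s > 0" "polydisc s \<subseteq> \<phi>1 ` V1" and hh: "holo_on hh (polydisc s)" "hh 0 = 1"
    and hh_eq: "\<And>w. w \<in> polydisc s \<Longrightarrow> frechet_derivative hh (at w) (lin_field lam w) + g w * hh w = - \<mu>"
    by (rule constant_christoffel_in_linear_coords[OF g W0 g0 nonres brj \<open>generic_connection_value lam \<mu>\<close>]) (rule that)
  define V2 where "V2 = V1 \<inter> \<phi>1 -` polydisc s"
  have V2: "open V2" unfolding V2_def
    by (metis Int_commute V1(1) \<phi>1_holo continuous_on_open_vimage holo_map_on_continuous_on open_polydisc)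
  have V2_sub: "V2 \<subseteq> V1" "\<phi>1 ` V2 \<subseteq> polydisc s" by (auto simp: V2_def)
  have \<phi>1_V2: "holo_map_on \<phi>1 V2" by (rule holo_map_on_subset[OF \<phi>1_holo V2 V2_sub(1)])
  define h where "h z = hh (\<phi>1 z)" for z
  note h_comp = holo_on_compose[OF hh(1) \<phi>1_V2 V2_sub(2), folded h_def]
  \<comment> \<open>Since \<open>h 0 = 1\<close>, removing the zeros of h leaves a neighborhood of
    0, on which \<open>Z'\<close> generates the foliation.\<close>
  define V3 where "V3 = V2 \<inter> h -` (- {0})"
  have V3: "open V3" unfolding V3_def
    by (metis Int_commute V2 h_comp(1) continuous_on_open_vimage holo_on_imp_continuous_on open_Compl closed_singleton)
  have h0: "h 0 = 1" by (simp add: h_def \<phi>1(2) hh(2))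
  have V30: "0 \<in> V3" using V1(2) s(1) h0 \<phi>1(2) by (simp add: V3_def V2_def)
  have V3_sub: "V3 \<subseteq> V2" "V3 \<subseteq> V1" "V3 \<subseteq> U" using V2_sub V1(3) by (auto simp: V3_def)
  have h: "holo_on h V3" by (rule holo_on_subset[OF h_comp(1) V3 V3_sub(1)])
  have Z3: "holo_map_on Z V3" by (rule holo_map_on_subset[OF Z V3 V3_sub(3)])
  define Z' where "Z' z = h z *s Z z" for z
  have Z'_holo: "holo_map_on Z' V3"
    unfolding holo_map_on_def Z'_def vector_smult_component
    by (intro allI holo_on_mult(1)[OF h holo_map_on_component[OF Z3]])
  have Z'0: "Z' 0 = 0" by (simp add: Z'_def \<open>Z 0 = 0\<close>)
  \<comment> \<open>In the product rule the derivative of h is multiplied by \<open>Z 0 = 0\<close>,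
    and that of Z by \<open>h 0 = 1\<close>. Brjuno's condition depends on the field only through
    this derivative.\<close>
  have "frechet_derivative Z' (at 0) = frechet_derivative Z (at 0)"
  proof -
    have "(Z' has_derivative frechet_derivative Z (at 0)) (at 0)"
    proof (rule has_derivative_vecI)
      fix i
      have Zi: "((\<lambda>z. Z z $ i) has_derivative (\<lambda>v. frechet_derivative Z (at 0) v $ i)) (at 0)"
        by (rule bounded_linear.has_derivative[OF bounded_linear_vec_nth holo_map_on_has_derivative(1)[OF Z3 V30]])
      show "((\<lambda>z. Z' z $ i) has_derivative (\<lambda>v. frechet_derivative Z (at 0) v $ i)) (at 0)"
        using has_derivative_mult[OF holo_on_has_derivative[OF h V30] Zi]
        by (simp add: Z'_def h0 \<open>Z 0 = 0\<close>)
    qed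
    from frechet_derivative_at[OF this] show ?thesis by simp
  qed
  then have Z'_brj: "brjuno_condition Z' lam"
    using \<open>brjuno_condition Z lam\<close> by (simp add: brjuno_condition_def linear_part_def)
  obtain V \<phi> where V: "open V" "0 \<in> V" "V \<subseteq> V3" and \<phi>: "biholo_on \<phi> V" "\<phi> 0 = 0"
    and conj: "\<And>z. z \<in> V \<Longrightarrow> frechet_derivative \<phi> (at z) (Z' z) = lin_field lam (\<phi> z)"
    by (rule brjuno_linearization[OF Z'_holo V30 Z'0 Z'_brj]) (rule that)
  have VU: "V \<subseteq> U" using V(3) V3_sub(3) by blast
  have hV: "holo_on h V" by (rule holo_on_subset[OF h V(1,3)])
  have "generator_on Z V Z'"
    unfolding generator_on_def using hV V(3) by (intro exI[of _ h]) (auto simp: Z'_def V3_def)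
  moreover have "linear_in_coords \<phi> V Z'"
    unfolding linear_in_coords_def using conj by (intro exI[of _ "diag_mat lam"]) (simp add: diag_mat_mult)
  \<comment> \<open>The symbol is a function on V independent of coordinates, so it can be computed
    in the first chart \<open>\<phi>1\<close>, where the equation for h was solved, while
    \<open>\<phi>\<close> linearizes \<open>Z'\<close>.\<close>
  moreover have "nabla V Z' z = - \<mu>" if z: "z \<in> V" for z
  proof -
    have z2: "z \<in> V2" "z \<in> V1" using z V(3) V3_sub by auto
    have "nabla V Z' z = frechet_derivative h (at z) (Z z) + h z * \<gamma> z"
      unfolding Z'_def[abs_def]
      using nabla_mult[OF V(1) VU Z_section[OF V(1)] hV z] nabla_restrict[OF V(1) VU z]
      by (simp add: vf_apply_def)
    also have "frechet_derivative h (at z) (Z z) = frechet_derivative hh (at (\<phi>1 z)) (lin_field lam (\<phi>1 z))"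
      using h_comp(2)[OF z2(1)] conj1[OF z2(2)] by simp
    also have "\<gamma> z = g (\<phi>1 z)" by (simp add: g_def \<psi>\<phi>[OF z2(2)])
    finally show ?thesis
      using hh_eq[of "\<phi>1 z"] V2_sub(2) z2(1) by (auto simp: h_def mult.commute)
  qed
  ultimately show ?thesis using V(1,2) VU \<phi> by blast
qed

end
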